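(* There exists a sequence of total Boolean functions $f_j:\{0,1\}^{N_j}\to\{0,1\}$ with $\mathrm{UC}(f_j)\to\infty$ such that $Q(f_j)\geq \mathrm{UC}(f_j)^{1.5-o(1)}$, i.e. $Q(f_j)\geq \mathrm{UC}(f_j)^{1.5-\epsilon_j}$ for some sequence $\epsilon_j\to0$.
   Context: For $f:\{0,1\}^n\to\{0,1\}$, $Q(f)$ is the bounded-error quantum query complexity: the minimum worst-case number of queries to the standard input oracle made by a quantum algorithm that outputs $f(x)$ with probability at least $2/3$ on every input $x$. A certificate for an input $x$ is a partial assignment consistent with $x$ such that every input consistent with it has the same $f$-value as $x$. The unambiguous $b$-certificate complexity $\mathrm{UC}_b(f)$ ($b\in\{0,1\}$) is the minimum $w$ such that there is a set of $b$-certificates, each fixing at most $w$ variables, such that every input $x$ with $f(x)=b$ is consistent with exactly one of them. $\mathrm{UC}(f)=\max\{\mathrm{UC}_0(f),\mathrm{UC}_1(f)\}$. *)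

theory Defs
  imports Complex_Main "Jordan_Normal_Form.Schur_Decomposition"
begin

text \<open>A total Boolean function on \<open>N\<close> bits is given by \<open>N\<close> together with a function
  \<open>f :: bool list \<Rightarrow> bool\<close>, of which only the values on lists of length \<open>N\<close> are ever used.\<close>

definition cube :: "nat \<Rightarrow> bool list set" where
  "cube N = {x. length x = N}"


subsection \<open>Unambiguous certificate complexity\<close>

definition partial_assignment :: "nat \<Rightarrow> (nat \<rightharpoonup> bool) \<Rightarrow> bool" where
  "partial_assignment N p \<longleftrightarrow> dom p \<subseteq> {..<N}"

definition consistent :: "(nat \<rightharpoonup> bool) \<Rightarrow> bool list \<Rightarrow> bool" where
  "consistent p x \<longleftrightarrow> (\<forall>i\<in>dom p. p i = Some (x ! i))"

definition certificate :: "nat \<Rightarrow> (bool list \<Rightarrow> bool) \<Rightarrow> bool list \<Rightarrow> (nat \<rightharpoonup> bool) \<Rightarrow> bool" where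
  "certificate N f x p \<longleftrightarrow>
     partial_assignment N p \<and> consistent p x \<and> (\<forall>y\<in>cube N. consistent p y \<longrightarrow> f y = f x)"

definition b_certificate :: "nat \<Rightarrow> (bool list \<Rightarrow> bool) \<Rightarrow> bool \<Rightarrow> (nat \<rightharpoonup> bool) \<Rightarrow> bool" where
  "b_certificate N f b p \<longleftrightarrow> (\<exists>x\<in>cube N. f x = b \<and> certificate N f x p)"

definition UCb :: "nat \<Rightarrow> (bool list \<Rightarrow> bool) \<Rightarrow> bool \<Rightarrow> nat" where
  "UCb N f b = (LEAST w. \<exists>S.
     (\<forall>p\<in>S. b_certificate N f b p \<and> card (dom p) \<le> w) \<and>
     (\<forall>x\<in>cube N. f x = b \<longrightarrow> (\<exists>!p. p \<in> S \<and> consistent p x)))"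

definition UC :: "nat \<Rightarrow> (bool list \<Rightarrow> bool) \<Rightarrow> nat" where
  "UC N f = max (UCb N f False) (UCb N f True)"


subsection \<open>Bounded-error quantum query complexity\<close>

text \<open>The state space is spanned by the basis vectors \<open>|i, b, z\<rangle>\<close> with a query index \<open>i < N\<close>,
  a target bit \<open>b\<close> and a workspace value \<open>z < m\<close>.  The vector \<open>|i, b, z\<rangle>\<close> is the unit vector
  number \<open>(2 * i + b) * m + z\<close> of dimension \<open>2 * N * m\<close>.\<close>

definition query_index :: "nat \<Rightarrow> nat \<Rightarrow> nat" where
  "query_index m k = k div m div 2"

definition target_bit :: "nat \<Rightarrow> nat \<Rightarrow> bool" where
  "target_bit m k \<longleftrightarrow> odd (k div m)"

definition work_part :: "nat \<Rightarrow> nat \<Rightarrow> nat" where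
  "work_part m k = k mod m"

text \<open>The standard oracle \<open>|i, b, z\<rangle> \<mapsto> |i, b XOR x\<^sub>i, z\<rangle>\<close>; exclusive or is \<open>\<noteq>\<close> on \<open>bool\<close>.\<close>

definition oracle_mat :: "nat \<Rightarrow> nat \<Rightarrow> bool list \<Rightarrow> complex mat" where
  "oracle_mat N m x = mat (2 * N * m) (2 * N * m) (\<lambda>(r, c).
     if query_index m r = query_index m c \<and>
        target_bit m r = (target_bit m c \<noteq> x ! query_index m c) \<and>
        work_part m r = work_part m c
     then 1 else 0)"

definition unitary_mat :: "nat \<Rightarrow> complex mat \<Rightarrow> bool" where
  "unitary_mat d U \<longleftrightarrow>
     U \<in> carrier_mat d d \<and> mat_adjoint U * U = 1\<^sub>m d \<and> U * mat_adjoint U = 1\<^sub>m d"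

text \<open>The state \<open>U\<^sub>T O\<^sub>x U\<^sub>T\<^sub>-\<^sub>1 \<dots> U\<^sub>1 O\<^sub>x U\<^sub>0 |0, 0, 0\<rangle>\<close> after \<open>T\<close> queries.\<close>

fun query_state ::
  "nat \<Rightarrow> nat \<Rightarrow> (nat \<Rightarrow> complex mat) \<Rightarrow> bool list \<Rightarrow> nat \<Rightarrow> complex vec" where
  "query_state N m U x 0 = U 0 *\<^sub>v unit_vec (2 * N * m) 0"
| "query_state N m U x (Suc T) = U (Suc T) *\<^sub>v (oracle_mat N m x *\<^sub>v query_state N m U x T)"

text \<open>The final state is measured in the computational basis and the bit \<open>out r\<close> is returned
  on outcome \<open>r\<close>.\<close>

definition output_prob ::
  "nat \<Rightarrow> nat \<Rightarrow> (nat \<Rightarrow> complex mat) \<Rightarrow> (nat \<Rightarrow> bool) \<Rightarrow> nat \<Rightarrow> bool list \<Rightarrow> bool \<Rightarrow> real" where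
  "output_prob N m U out T x b =
     (\<Sum>r | r < 2 * N * m \<and> out r = b. (cmod (vec_index (query_state N m U x T) r))\<^sup>2)"

definition quantum_computes :: "nat \<Rightarrow> (bool list \<Rightarrow> bool) \<Rightarrow> nat \<Rightarrow> bool" where
  "quantum_computes N f T \<longleftrightarrow>
     (\<exists>m U out. m > 0 \<and> (\<forall>t\<le>T. unitary_mat (2 * N * m) (U t)) \<and>
        (\<forall>x\<in>cube N. output_prob N m U out T x (f x) \<ge> 2 / 3))"

text \<open>The minimum is attained for \<open>N > 0\<close>.  For \<open>N = 0\<close> the state space is \<open>0\<close>-dimensional and the
  value is unspecified.\<close>

definition Q :: "nat \<Rightarrow> (bool list \<Rightarrow> bool) \<Rightarrow> nat" where
  "Q N f = (LEAST T. quantum_computes N f T)"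

end

theory Submission
  imports Defs "HOL-Analysis.L2_Norm" "HOL-Analysis.Function_Topology" "HOL-Real_Asymp.Real_Asymp"
begin

text \<open>The negative-weight adversary bound lower-bounds \<open>Q\<close> up to a constant, is multiplicative under
  block composition, and does not decrease when a function is turned into its cheat-sheet version.
  Take \<open>k\<close>-SUM with \<open>k\<close> blocks of \<open>M\<close> symbols, written as a monotone DNF in dual-rail encoding.
  Its composition with an AND of fan-in \<open>M\<close> multiplies the adversary bound by almost
  \<open>M\<^sup>3\<^sup>/\<^sup>2\<close>, while certificates grow by a factor of about \<open>M\<close>; the cheat sheet then makes the
  certificates of the positive inputs unambiguous again, at a polylogarithmic cost. Iterating \<open>n\<close>
  times with \<open>k = 2n\<close> and \<open>M\<close> large gives the exponent \<open>(3n\<^sup>2 - 1) / (2n\<^sup>2 + 3n + 2)\<close>, which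
  tends to \<open>3/2\<close>.\<close>

section \<open>Bilinear operator bounds and Gram factorisation\<close>

text \<open>The exponent rests on an asymmetry. A 1-certificate of \<open>k\<close>-SUM has
  polylogarithmic size but uses 1-certificates of the inner AND, of size \<open>M\<close>; a
  0-certificate reads all symbols, but only variables that are off, each certified by a single zero
  of an AND. So both kinds grow by about \<open>M\<close>, while \<open>k\<close>-SUM contributes
  almost \<open>M\<close> to the adversary bound and AND contributes \<open>sqrt M\<close>.
  Unambiguity is the obstacle: the unambiguous certificates at hand for the composed function are
  about \<open>M\<close> times larger than its ordinary ones. A cheat sheet cures this for 1-inputs
  only, and that suffices, because an AND read up to its first zero uses many 1-certificates of its
  arguments but at most one 0-certificate. This is the invariant \<open>hard\<close>. The cost of a
  cheat sheet depends on the logarithm of the number of variables, so its exponentially many cells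
  are harmless at bounded depth. All main parameters are powers of 2 with exponents linear in
  \<open>a\<close>; a large \<open>a\<close> makes polynomials in \<open>a\<close> smaller than
  \<open>2 ^ a\<close>.\<close>

definition opbound :: "'i set \<Rightarrow> 'j set \<Rightarrow> ('i \<Rightarrow> 'j \<Rightarrow> real) \<Rightarrow> real \<Rightarrow> bool" where
  "opbound I J M \<mu> \<longleftrightarrow>
     (\<forall>a b. \<bar>\<Sum>i\<in>I. \<Sum>j\<in>J. M i j * a i * b j\<bar> \<le> \<mu> * (L2_set a I * L2_set b J))"

lemma opboundI:
  assumes "\<And>a b. \<bar>\<Sum>i\<in>I. \<Sum>j\<in>J. M i j * a i * b j\<bar> \<le> \<mu> * (L2_set a I * L2_set b J)"
  shows "opbound I J M \<mu>"
  using assms unfolding opbound_def by blast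

lemma opboundD:
  assumes "opbound I J M \<mu>"
  shows "\<bar>\<Sum>i\<in>I. \<Sum>j\<in>J. M i j * a i * b j\<bar> \<le> \<mu> * (L2_set a I * L2_set b J)"
  using assms unfolding opbound_def by blast

lemma opbound_cong:
  assumes "\<And>i j. i \<in> I \<Longrightarrow> j \<in> J \<Longrightarrow> M i j = M' i j"
  shows "opbound I J M \<mu> \<longleftrightarrow> opbound I J M' \<mu>"
proof -
  have "(\<Sum>i\<in>I. \<Sum>j\<in>J. M i j * a i * b j) = (\<Sum>i\<in>I. \<Sum>j\<in>J. M' i j * a i * b j)" for a b
    by (intro sum.cong refl) (simp add: assms)
  then show ?thesis unfolding opbound_def by simp
qed

lemma opbound_mono:
  assumes "opbound I J M \<mu>" "\<mu> \<le> \<nu>"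
  shows "opbound I J M \<nu>"
proof (rule opboundI)
  fix a b
  show "\<bar>\<Sum>i\<in>I. \<Sum>j\<in>J. M i j * a i * b j\<bar> \<le> \<nu> * (L2_set a I * L2_set b J)"
    using opboundD[OF assms(1), of a b] mult_right_mono[OF assms(2), of "L2_set a I * L2_set b J"]
    by simp
qed

lemma opbound_scale:
  assumes "opbound I J M \<mu>"
  shows "opbound I J (\<lambda>i j. c * M i j) (\<bar>c\<bar> * \<mu>)"
proof (rule opboundI)
  fix a b
  have "(\<Sum>i\<in>I. \<Sum>j\<in>J. c * M i j * a i * b j) = c * (\<Sum>i\<in>I. \<Sum>j\<in>J. M i j * a i * b j)"
    by (simp add: sum_distrib_left mult.assoc)
  then show "\<bar>\<Sum>i\<in>I. \<Sum>j\<in>J. c * M i j * a i * b j\<bar> \<le> \<bar>c\<bar> * \<mu> * (L2_set a I * L2_set b J)"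
    using mult_left_mono[OF opboundD[OF assms, of a b], of "\<bar>c\<bar>"] by (simp add: abs_mult mult.assoc)
qed

lemma opbound_add:
  assumes "opbound I J M \<mu>" "opbound I J M' \<nu>"
  shows "opbound I J (\<lambda>i j. M i j + M' i j) (\<mu> + \<nu>)"
proof (rule opboundI)
  fix a b
  have "(\<Sum>i\<in>I. \<Sum>j\<in>J. (M i j + M' i j) * a i * b j) =
     (\<Sum>i\<in>I. \<Sum>j\<in>J. M i j * a i * b j) + (\<Sum>i\<in>I. \<Sum>j\<in>J. M' i j * a i * b j)"
    by (simp add: sum.distrib distrib_right)
  then show "\<bar>\<Sum>i\<in>I. \<Sum>j\<in>J. (M i j + M' i j) * a i * b j\<bar> \<le> (\<mu> + \<nu>) * (L2_set a I * L2_set b J)"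
    using opboundD[OF assms(1), of a b] opboundD[OF assms(2), of a b] by (simp add: distrib_right)
qed

lemma L2_set_mask_le:
  assumes "\<And>i. i \<in> I \<Longrightarrow> \<bar>p i\<bar> \<le> 1"
  shows "L2_set (\<lambda>i. p i * a i) I \<le> L2_set a I"
proof -
  have "(\<Sum>i\<in>I. (p i * a i)\<^sup>2) \<le> (\<Sum>i\<in>I. (a i)\<^sup>2)"
  proof (rule sum_mono)
    fix i assume "i \<in> I"
    then have "(p i)\<^sup>2 \<le> 1" using assms by (simp add: abs_square_le_1)
    then show "(p i * a i)\<^sup>2 \<le> (a i)\<^sup>2"
      by (simp add: power_mult_distrib mult_left_le_one_le)
  qed
  then show ?thesis by (simp add: L2_set_def)
qed

text \<open>A rank-one mask can be absorbed into the two test vectors, which only shortens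
  them.\<close>

lemma opbound_mask:
  assumes "opbound I J M \<mu>" "\<mu> \<ge> 0"
    and p: "\<And>i. i \<in> I \<Longrightarrow> \<bar>p i\<bar> \<le> 1" and q: "\<And>j. j \<in> J \<Longrightarrow> \<bar>q j\<bar> \<le> 1"
  shows "opbound I J (\<lambda>i j. M i j * (p i * q j)) \<mu>"
proof (rule opboundI)
  fix a b
  have "(\<Sum>i\<in>I. \<Sum>j\<in>J. M i j * (p i * q j) * a i * b j) =
     (\<Sum>i\<in>I. \<Sum>j\<in>J. M i j * (p i * a i) * (q j * b j))"
    by (simp add: mult_ac)
  also have "\<bar>\<dots>\<bar> \<le> \<mu> * (L2_set (\<lambda>i. p i * a i) I * L2_set (\<lambda>j. q j * b j) J)"
    by (rule opboundD[OF assms(1)])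
  also have "\<dots> \<le> \<mu> * (L2_set a I * L2_set b J)"
    by (intro mult_left_mono mult_mono L2_set_mask_le p q) (use assms in auto)
  finally show "\<bar>\<Sum>i\<in>I. \<Sum>j\<in>J. M i j * (p i * q j) * a i * b j\<bar> \<le> \<mu> * (L2_set a I * L2_set b J)" .
qed

lemma opbound_transpose:
  assumes "opbound I J M \<mu>"
  shows "opbound J I (\<lambda>j i. M i j) \<mu>"
proof (rule opboundI)
  fix a b
  have "(\<Sum>j\<in>J. \<Sum>i\<in>I. M i j * a j * b i) = (\<Sum>i\<in>I. \<Sum>j\<in>J. M i j * b i * a j)"
    by (subst sum.swap) (simp add: mult_ac)
  then show "\<bar>\<Sum>j\<in>J. \<Sum>i\<in>I. M i j * a j * b i\<bar> \<le> \<mu> * (L2_set a J * L2_set b I)"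
    using opboundD[OF assms, of b a] by (simp add: mult_ac)
qed

text \<open>Taking absolute values of the test vectors does not change their norms. The dominating
  matrix is nonnegative, so this serves the constant matrix of the cheat sheet; signed matrices are
  masked by other means.\<close>

lemma opbound_dominated:
  assumes "opbound I J M \<mu>" "\<And>i j. i \<in> I \<Longrightarrow> j \<in> J \<Longrightarrow> \<bar>M' i j\<bar> \<le> M i j"
  shows "opbound I J M' \<mu>"
proof (rule opboundI)
  fix a b
  have "\<bar>\<Sum>i\<in>I. \<Sum>j\<in>J. M' i j * a i * b j\<bar> \<le> (\<Sum>i\<in>I. \<Sum>j\<in>J. \<bar>M' i j * a i * b j\<bar>)"
    by (intro order_trans[OF sum_abs] sum_mono sum_abs)
  also have "\<dots> \<le> (\<Sum>i\<in>I. \<Sum>j\<in>J. M i j * \<bar>a i\<bar> * \<bar>b j\<bar>)"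
    by (intro sum_mono) (simp add: abs_mult mult_right_mono assms(2))
  also have "\<dots> \<le> \<mu> * (L2_set (\<lambda>i. \<bar>a i\<bar>) I * L2_set (\<lambda>j. \<bar>b j\<bar>) J)"
    using opboundD[OF assms(1), of "\<lambda>i. \<bar>a i\<bar>" "\<lambda>j. \<bar>b j\<bar>"] by linarith
  also have "\<dots> = \<mu> * (L2_set a I * L2_set b J)" by (simp add: L2_set_def)
  finally show "\<bar>\<Sum>i\<in>I. \<Sum>j\<in>J. M' i j * a i * b j\<bar> \<le> \<mu> * (L2_set a I * L2_set b J)" .
qed

lemma sum_le_sqrt_card_L2_set:
  assumes "finite I"
  shows "\<bar>\<Sum>i\<in>I. a i\<bar> \<le> sqrt (card I) * L2_set a I"
proof -
  have "\<bar>\<Sum>i\<in>I. a i\<bar> \<le> (\<Sum>i\<in>I. \<bar>1\<bar> * \<bar>a i\<bar>)" by simp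
  also have "\<dots> \<le> L2_set (\<lambda>_. 1) I * L2_set a I" by (rule L2_set_mult_ineq)
  finally show ?thesis by (simp add: L2_set_constant)
qed

lemma opbound_all_ones:
  assumes "finite I" "finite J"
  shows "opbound I J (\<lambda>_ _. 1) (sqrt (card I) * sqrt (card J))"
proof (rule opboundI)
  fix a :: "'a \<Rightarrow> real" and b :: "'b \<Rightarrow> real"
  have "(\<Sum>i\<in>I. \<Sum>j\<in>J. 1 * a i * b j) = (\<Sum>i\<in>I. a i) * (\<Sum>j\<in>J. b j)"
    by (simp add: sum_product)
  then show "\<bar>\<Sum>i\<in>I. \<Sum>j\<in>J. 1 * a i * b j\<bar> \<le>
      sqrt (card I) * sqrt (card J) * (L2_set a I * L2_set b J)"
    using mult_mono[OF sum_le_sqrt_card_L2_set[OF assms(1), of a]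
        sum_le_sqrt_card_L2_set[OF assms(2), of b]]
    by (simp add: abs_mult mult_ac)
qed

text \<open>The matrix tensored with the identity on the coordinates \<open>D\<close> has the same
  norm: the bound is applied for every coordinate and the results are added by Cauchy-Schwarz. Gram
  vectors and quantum states enter through this form.\<close>

lemma opbound_vector:
  assumes M: "opbound I J M \<mu>" and "\<mu> \<ge> 0"
  shows "\<bar>\<Sum>i\<in>I. \<Sum>j\<in>J. M i j * (\<Sum>k\<in>D. a i k * b j k)\<bar> \<le>
    \<mu> * (sqrt (\<Sum>i\<in>I. \<Sum>k\<in>D. (a i k)\<^sup>2) * sqrt (\<Sum>j\<in>J. \<Sum>k\<in>D. (b j k)\<^sup>2))"
proof -
  let ?A = "\<lambda>k. L2_set (\<lambda>i. a i k) I" and ?B = "\<lambda>k. L2_set (\<lambda>j. b j k) J"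
  have "(\<Sum>i\<in>I. \<Sum>j\<in>J. M i j * (\<Sum>k\<in>D. a i k * b j k)) =
     (\<Sum>i\<in>I. \<Sum>j\<in>J. \<Sum>k\<in>D. M i j * a i k * b j k)"
    by (simp add: sum_distrib_left mult.assoc)
  also have "\<dots> = (\<Sum>i\<in>I. \<Sum>k\<in>D. \<Sum>j\<in>J. M i j * a i k * b j k)"
    by (intro sum.cong refl sum.swap)
  also have "\<dots> = (\<Sum>k\<in>D. \<Sum>i\<in>I. \<Sum>j\<in>J. M i j * a i k * b j k)"
    by (rule sum.swap)
  also have "\<bar>\<dots>\<bar> \<le> (\<Sum>k\<in>D. \<mu> * (?A k * ?B k))"
    by (intro order_trans[OF sum_abs] sum_mono opboundD[OF M])
  also have "\<dots> = \<mu> * (\<Sum>k\<in>D. \<bar>?A k\<bar> * \<bar>?B k\<bar>)"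
    by (simp add: sum_distrib_left)
  also have "\<dots> \<le> \<mu> * (L2_set ?A D * L2_set ?B D)"
    by (intro mult_left_mono L2_set_mult_ineq \<open>\<mu> \<ge> 0\<close>)
  also have "L2_set ?A D = sqrt (\<Sum>k\<in>D. \<Sum>i\<in>I. (a i k)\<^sup>2)"
    by (simp add: L2_set_def sum_nonneg)
  also have "L2_set ?B D = sqrt (\<Sum>k\<in>D. \<Sum>j\<in>J. (b j k)\<^sup>2)"
    by (simp add: L2_set_def sum_nonneg)
  also have "(\<Sum>k\<in>D. \<Sum>i\<in>I. (a i k)\<^sup>2) = (\<Sum>i\<in>I. \<Sum>k\<in>D. (a i k)\<^sup>2)"
    by (rule sum.swap)
  also have "(\<Sum>k\<in>D. \<Sum>j\<in>J. (b j k)\<^sup>2) = (\<Sum>j\<in>J. \<Sum>k\<in>D. (b j k)\<^sup>2)"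
    by (rule sum.swap)
  finally show ?thesis .
qed

text \<open>Cholesky factorisation by induction: the row of \<open>y0\<close> gives one factor
  \<open>l\<close>, and the Schur complement \<open>P'\<close> on the remaining indices is again
  positive semidefinite.\<close>

lemma psd_gram:
  assumes "finite Y" and sym: "\<And>y z. y \<in> Y \<Longrightarrow> z \<in> Y \<Longrightarrow> P y z = P z y"
    and psd: "\<And>c. 0 \<le> (\<Sum>y\<in>Y. \<Sum>z\<in>Y. c y * c z * P y z)"
  shows "\<exists>R :: 'a \<Rightarrow> 'a \<Rightarrow> real. \<forall>y\<in>Y. \<forall>z\<in>Y. P y z = (\<Sum>k\<in>Y. R k y * R k z)"
  using assms
proof (induction Y arbitrary: P rule: finite_induct)
  case empty
  then show ?case by simp
next
  case (insert y0 Y)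
  have sym': "P y y0 = P y0 y" if "y \<in> Y" for y
    using insert.prems(1) that by simp
  have expand: "(\<Sum>y\<in>insert y0 Y. \<Sum>z\<in>insert y0 Y. c y * c z * P y z) =
     c y0 * c y0 * P y0 y0 + 2 * c y0 * (\<Sum>z\<in>Y. c z * P y0 z) + (\<Sum>y\<in>Y. \<Sum>z\<in>Y. c y * c z * P y z)" for c
  proof -
    have "(\<Sum>y\<in>Y. c y * c y0 * P y y0) = c y0 * (\<Sum>z\<in>Y. c z * P y0 z)"
      unfolding sum_distrib_left by (intro sum.cong refl) (simp add: sym' mult_ac)
    moreover have "(\<Sum>z\<in>Y. c y0 * c z * P y0 z) = c y0 * (\<Sum>z\<in>Y. c z * P y0 z)"
      by (simp add: sum_distrib_left mult_ac)
    ultimately show ?thesis using insert.hyps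
      by (simp add: sum.distrib)
  qed
  have diag: "P y0 y0 \<ge> 0"
    using insert.prems(2)[of "\<lambda>y. if y = y0 then 1 else 0"] insert.hyps
    unfolding expand by (simp add: sum.neutral if_distrib cong: if_cong sum.cong)
  \<comment> \<open>If the pivot is 0, division by zero makes \<open>l\<close> vanish; this is right
    because the whole row of \<open>y0\<close> is then 0 by \<open>zero\<close>.\<close>
  define l where "l = (\<lambda>y. P y0 y / sqrt (P y0 y0))"
  have zero: "P y0 y = 0" if "P y0 y0 = 0" "y \<in> Y" for y
  proof (rule ccontr)
    assume nz: "P y0 y \<noteq> 0"
    \<comment> \<open>With this \<open>t\<close> the quadratic form at the vector with entries
      \<open>t\<close> on \<open>y0\<close> and 1 on \<open>y\<close> would be -1.\<close>
    define t where "t = - (P y y + 1) / (2 * P y0 y)"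
    define c where "c = (\<lambda>z. if z = y0 then t else if z = y then 1 else (0::real))"
    have "y \<noteq> y0" using that insert.hyps by auto
    have cz: "c z = (if z = y then 1 else 0)" if "z \<in> Y" for z
      using that insert.hyps by (auto simp: c_def)
    have pick: "(\<Sum>z\<in>Y. c z * g z) = g y" for g :: "'a \<Rightarrow> real"
    proof -
      have "(\<Sum>z\<in>Y. c z * g z) = (\<Sum>z\<in>Y. if z = y then g z else 0)"
        by (intro sum.cong refl) (simp add: cz)
      then show ?thesis using that insert.hyps by simp
    qed
    have 1: "(\<Sum>z\<in>Y. c z * P y0 z) = P y0 y" by (rule pick)
    have "(\<Sum>u\<in>Y. \<Sum>z\<in>Y. c u * c z * P u z) = (\<Sum>u\<in>Y. c u * (\<Sum>z\<in>Y. c z * P u z))"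
      by (simp add: sum_distrib_left mult.assoc)
    then have 2: "(\<Sum>u\<in>Y. \<Sum>z\<in>Y. c u * c z * P u z) = P y y" by (simp add: pick)
    have "0 \<le> 2 * t * P y0 y + P y y"
      using insert.prems(2)[of c] unfolding expand 1 2 by (simp add: that c_def)
    also have "2 * t * P y0 y = - (P y y + 1)" using nz by (simp add: t_def field_simps)
    finally show False by simp
  qed
  define P' where "P' = (\<lambda>y z. P y z - l y * l z)"
  have "0 \<le> (\<Sum>y\<in>Y. \<Sum>z\<in>Y. c y * c z * P' y z)" for c
  proof -
    define s where "s = (\<Sum>z\<in>Y. c z * P y0 z)"
    define T where "T = (\<Sum>y\<in>Y. \<Sum>z\<in>Y. c y * c z * P y z)"
    have "(\<Sum>y\<in>Y. \<Sum>z\<in>Y. c y * c z * (l y * l z)) = (\<Sum>y\<in>Y. c y * l y) * (\<Sum>z\<in>Y. c z * l z)"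
      by (simp add: sum_product mult_ac)
    also have "(\<Sum>y\<in>Y. c y * l y) = s / sqrt (P y0 y0)"
      by (simp add: s_def l_def sum_divide_distrib)
    finally have ll: "(\<Sum>y\<in>Y. \<Sum>z\<in>Y. c y * c z * (l y * l z)) = s\<^sup>2 / P y0 y0"
      using diag by (simp add: power2_eq_square)
    have eq: "(\<Sum>y\<in>Y. \<Sum>z\<in>Y. c y * c z * P' y z) = T - s\<^sup>2 / P y0 y0"
      unfolding ll[symmetric] T_def P'_def by (simp add: sum_subtractf right_diff_distrib)
    \<comment> \<open>For a positive pivot this entry at \<open>y0\<close> minimises the quadratic
      form with the other entries fixed; the minimum is the form of the Schur complement.\<close>
    define d where "d = c(y0 := - s / P y0 y0)"
    have dY: "d z = c z" if "z \<in> Y" for z using that insert.hyps by (auto simp: d_def)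
    have "0 \<le> d y0 * d y0 * P y0 y0 + 2 * d y0 * s + T"
      using insert.prems(2)[of d] unfolding expand s_def T_def by (simp add: dY cong: sum.cong)
    also have "\<dots> = T - s\<^sup>2 / P y0 y0"
      by (cases "P y0 y0 = 0") (simp_all add: d_def power2_eq_square field_simps)
    finally show ?thesis using eq by simp
  qed
  moreover have "P' y z = P' z y" if "y \<in> Y" "z \<in> Y" for y z
    using insert.prems(1) that by (simp add: P'_def mult.commute)
  ultimately obtain R where R: "\<forall>y\<in>Y. \<forall>z\<in>Y. P' y z = (\<Sum>k\<in>Y. R k y * R k z)"
    using insert.IH[of P'] by blast
  define R' where "R' = (\<lambda>k y. if k = y0 then l y else if y = y0 then 0 else R k y)"
  have l0: "l y0 * l y = P y0 y" if "y \<in> insert y0 Y" for y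
    using diag zero that by (cases "P y0 y0 = 0") (auto simp: l_def)
  have "P y z = (\<Sum>k\<in>insert y0 Y. R' k y * R' k z)" if "y \<in> insert y0 Y" "z \<in> insert y0 Y" for y z
  proof -
    have "(\<Sum>k\<in>insert y0 Y. R' k y * R' k z) = l y * l z + (\<Sum>k\<in>Y. R' k y * R' k z)"
      using insert.hyps by (simp add: R'_def)
    also have "(\<Sum>k\<in>Y. R' k y * R' k z) = (if y = y0 \<or> z = y0 then 0 else P' y z)"
    proof (cases "y = y0 \<or> z = y0")
      case True
      then show ?thesis using insert.hyps by (auto simp: R'_def intro!: sum.neutral)
    next
      case False
      then have "y \<in> Y" "z \<in> Y" using that by auto
      then have "P' y z = (\<Sum>k\<in>Y. R k y * R k z)" using R by blast
      moreover have "(\<Sum>k\<in>Y. R' k y * R' k z) = (\<Sum>k\<in>Y. R k y * R k z)"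
        using insert.hyps False by (intro sum.cong refl) (auto simp: R'_def)
      ultimately show ?thesis using False by simp
    qed
    also have "l y * l z + (if y = y0 \<or> z = y0 then 0 else P' y z) = P y z"
    proof (cases "y = y0 \<or> z = y0")
      case True
      then have "l y * l z = P y z"
      proof
        assume "y = y0"
        then show ?thesis using l0[OF that(2)] by simp
      next
        assume "z = y0"
        then show ?thesis using l0[OF that(1)] sym'[of y] that(1) by (cases "y = y0") (simp_all add: mult.commute)
      qed
      then show ?thesis using True by simp
    qed (simp add: P'_def)
    finally show ?thesis by simp
  qed
  then show ?case by blast
qed

section \<open>Attainment of the norm\<close>

definition unit_vectors :: "'i set \<Rightarrow> ('i \<Rightarrow> real) set" where
  "unit_vectors I = {a. (\<forall>i. i \<notin> I \<longrightarrow> a i = 0) \<and> (\<Sum>i\<in>I. (a i)\<^sup>2) = 1}"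

text \<open>Vectors are required to vanish outside \<open>I\<close>, so no coordinate is free and
  the set is a closed part of a product of compact sets, to which Tychonoff's theorem
  applies.\<close>

lemma compact_unit_vectors:
  fixes I :: "'i set"
  assumes "finite I"
  shows "compact (unit_vectors I)"
proof -
  let ?K = "PiE UNIV (\<lambda>i. if i \<in> I then {-1..1} else {0 :: real})"
  have "compactin (product_topology (\<lambda>i. euclidean) UNIV) ?K"
    unfolding compactin_PiE by (auto simp: compactin_euclidean_iff)
  then have "compact ?K"
    by (simp add: euclidean_product_topology compactin_euclidean_iff)
  moreover have "closed {a :: 'i \<Rightarrow> real. (\<Sum>i\<in>I. (a i)\<^sup>2) = 1}"
    by (intro closed_Collect_eq continuous_intros continuous_on_product_coordinates)
  moreover have "{a :: 'i \<Rightarrow> real. (\<forall>i. i \<notin> I \<longrightarrow> a i = 0) \<and> (\<Sum>i\<in>I. (a i)\<^sup>2) = 1} =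
      ?K \<inter> {a. (\<Sum>i\<in>I. (a i)\<^sup>2) = 1}"
  proof (intro equalityI subsetI)
    fix a :: "'i \<Rightarrow> real"
    assume a: "a \<in> {a. (\<forall>i. i \<notin> I \<longrightarrow> a i = 0) \<and> (\<Sum>i\<in>I. (a i)\<^sup>2) = 1}"
    have "\<bar>a i\<bar> \<le> 1" if "i \<in> I" for i
    proof -
      have "(a i)\<^sup>2 \<le> (\<Sum>i\<in>I. (a i)\<^sup>2)"
        using assms that by (intro member_le_sum) auto
      then show ?thesis using a by (simp add: abs_square_le_1)
    qed
    then show "a \<in> ?K \<inter> {a. (\<Sum>i\<in>I. (a i)\<^sup>2) = 1}"
      using a by (auto simp: PiE_iff abs_le_iff minus_le_iff)
  next
    fix a :: "'i \<Rightarrow> real"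
    assume a: "a \<in> ?K \<inter> {a. (\<Sum>i\<in>I. (a i)\<^sup>2) = 1}"
    then have "a i \<in> (if i \<in> I then {-1..1} else {0})" for i by (auto simp: PiE_iff)
    then have "i \<notin> I \<longrightarrow> a i = 0" for i by (metis singletonD)
    with a show "a \<in> {a. (\<forall>i. i \<notin> I \<longrightarrow> a i = 0) \<and> (\<Sum>i\<in>I. (a i)\<^sup>2) = 1}" by simp
  qed
  ultimately show ?thesis unfolding unit_vectors_def by (simp add: compact_Int_closed)
qed

lemma ex_unit_vector:
  assumes "finite I" "I \<noteq> {}"
  shows "\<exists>a. a \<in> unit_vectors I"
  proof -
    obtain i where "i \<in> I" using assms by blast
    have "(\<Sum>k\<in>I. (if k = i then 1 else 0 :: real)\<^sup>2) = (\<Sum>k\<in>I. if k = i then 1 else 0)"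
      by (intro sum.cong) auto
    also have "\<dots> = 1" using \<open>i \<in> I\<close> assms by simp
    finally have "(\<lambda>k. if k = i then 1 else 0) \<in> unit_vectors I" using \<open>i \<in> I\<close> by (auto simp: unit_vectors_def)
    then show ?thesis by blast
  qed

lemma normalize_unit_vector:
  assumes "L2_set c I \<noteq> 0" "s\<^sup>2 = 1"
  shows "(\<lambda>i. if i \<in> I then s * c i / L2_set c I else 0) \<in> unit_vectors I"
  proof -
    have "(\<Sum>i\<in>I. (if i \<in> I then s * c i / L2_set c I else 0)\<^sup>2) = (\<Sum>i\<in>I. (c i)\<^sup>2 / (L2_set c I)\<^sup>2)"
      by (intro sum.cong refl) (simp add: power_divide power_mult_distrib assms)
    also have "\<dots> = (L2_set c I)\<^sup>2 / (L2_set c I)\<^sup>2"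
      by (simp add: sum_divide_distrib[symmetric] L2_set_def sum_nonneg)
    finally show ?thesis using assms by (simp add: unit_vectors_def)
  qed

text \<open>A continuous function on a compact set attains its supremum, and unit vectors are closed
  under sign change, so the supremum also bounds absolute values. For \<open>k\<close>-SUM this
  supplies the vectors of the adversary witness, which are not given explicitly.\<close>

lemma opbound_attained:
  assumes fin: "finite I" "finite J" and ne: "I \<noteq> {}" "J \<noteq> {}"
  shows "\<exists>a b \<mu>. (\<Sum>i\<in>I. (a i)\<^sup>2) = 1 \<and> (\<Sum>j\<in>J. (b j)\<^sup>2) = 1 \<and>
    (\<Sum>i\<in>I. \<Sum>j\<in>J. M i j * a i * b j) = \<mu> \<and> opbound I J M \<mu>"
proof -
  define f where "f = (\<lambda>p. \<Sum>i\<in>I. \<Sum>j\<in>J. M i j * fst p i * snd p j)"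
  have 1: "continuous_on (unit_vectors I \<times> unit_vectors J) (\<lambda>p. fst p i)" for i
    by (rule continuous_on_compose2[OF continuous_on_product_coordinates continuous_on_fst[OF continuous_on_id]]) simp
  have 2: "continuous_on (unit_vectors I \<times> unit_vectors J) (\<lambda>p. snd p j)" for j
    by (rule continuous_on_compose2[OF continuous_on_product_coordinates continuous_on_snd[OF continuous_on_id]]) simp
  have cont: "continuous_on (unit_vectors I \<times> unit_vectors J) f"
    unfolding f_def by (intro continuous_on_sum continuous_on_mult continuous_on_const 1 2)
  have comp: "compact (unit_vectors I \<times> unit_vectors J)"
    by (intro compact_Times compact_unit_vectors fin)
  have "unit_vectors I \<times> unit_vectors J \<noteq> {}" using ex_unit_vector[OF fin(1) ne(1)] ex_unit_vector[OF fin(2) ne(2)] by auto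
  then obtain p where p: "p \<in> unit_vectors I \<times> unit_vectors J" and max: "\<And>q. q \<in> unit_vectors I \<times> unit_vectors J \<Longrightarrow> f q \<le> f p"
    using continuous_attains_sup[OF comp _ cont] by blast
  obtain a b where ab: "p = (a, b)" by (cases p)
  have "opbound I J M (f p)"
  proof (rule opboundI)
    fix c d
    define S where "S = (\<Sum>i\<in>I. \<Sum>j\<in>J. M i j * c i * d j)"
    show "\<bar>\<Sum>i\<in>I. \<Sum>j\<in>J. M i j * c i * d j\<bar> \<le> f p * (L2_set c I * L2_set d J)"
    proof (cases "L2_set c I = 0 \<or> L2_set d J = 0")
      case True
      then have "(\<forall>i\<in>I. c i = 0) \<or> (\<forall>j\<in>J. d j = 0)"
        using fin by (simp add: L2_set_eq_0_iff)
      then have "(\<Sum>i\<in>I. \<Sum>j\<in>J. M i j * c i * d j) = 0"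
        by (auto intro!: sum.neutral)
      then show ?thesis using True by auto
    next
      case False
      have pos: "L2_set c I * L2_set d J > 0"
        using False by (simp add: less_le)
      have "s * S / (L2_set c I * L2_set d J) \<le> f p" if "s\<^sup>2 = 1" for s
      proof -
        let ?c = "\<lambda>i. if i \<in> I then s * c i / L2_set c I else 0"
        let ?d = "\<lambda>j. if j \<in> J then 1 * d j / L2_set d J else 0"
        have "f (?c, ?d) = (\<Sum>i\<in>I. \<Sum>j\<in>J. s * (M i j * c i * d j) / (L2_set c I * L2_set d J))"
          unfolding f_def by (intro sum.cong refl) simp
        also have "\<dots> = s * S / (L2_set c I * L2_set d J)"
          by (simp add: S_def sum_divide_distrib sum_distrib_left)
        finally show ?thesis
          using max[of "(?c, ?d)"] normalize_unit_vector[of c I s] normalize_unit_vector[of d J 1] False that by simp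
      qed
      from this[of 1] this[of "-1"] have "\<bar>S\<bar> / (L2_set c I * L2_set d J) \<le> f p"
        by (simp add: abs_if)
      then show ?thesis using pos by (simp add: S_def divide_le_eq)
    qed
  qed
  then show ?thesis using p unfolding ab by (auto simp: unit_vectors_def f_def)
qed

text \<open>The kernel is the symmetric block matrix with identity diagonal blocks and off-diagonal block
  \<open>G\<close>. It is positive semidefinite, hence a Gram matrix, exactly when \<open>G\<close> has norm at most 1;
  entrywise products of Gram matrices are Gram matrices of tensor products, so multiplying a
  matrix entrywise by such kernels does not increase its operator norm.\<close>

definition kern :: "(bool \<Rightarrow> 'i set) \<Rightarrow> ('i \<Rightarrow> 'i \<Rightarrow> real) \<Rightarrow> 'i \<Rightarrow> 'i \<Rightarrow> real" where
  "kern Y G y z =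
     (if y \<in> Y False \<and> z \<in> Y True then G y z
      else if y \<in> Y True \<and> z \<in> Y False then G z y
      else if y = z then 1 else 0)"

lemma kern_same:
  assumes "Y False \<inter> Y True = {}" "y \<in> Y b" "z \<in> Y b"
  shows "kern Y G y z = (if y = z then 1 else 0)"
  using assms by (cases b) (auto simp: kern_def)

lemma kern_gram:
  assumes fin: "\<And>b. finite (Y b)" and disj: "Y False \<inter> Y True = {}"
    and G: "opbound (Y False) (Y True) G 1"
  shows "\<exists>R. \<forall>y\<in>Y False \<union> Y True. \<forall>z\<in>Y False \<union> Y True.
    kern Y G y z = (\<Sum>k\<in>Y False \<union> Y True. R k y * R k z)"
proof (rule psd_gram[where Y = "Y False \<union> Y True" and P = "kern Y G"])
  show "finite (Y False \<union> Y True)" using fin by simp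
  show "kern Y G y z = kern Y G z y" if "y \<in> Y False \<union> Y True" "z \<in> Y False \<union> Y True" for y z
  proof -
    have "y \<notin> Y True" if "y \<in> Y False" for y
      using disj that by (metis disjoint_iff)
    then show ?thesis
      by (cases "y \<in> Y False"; cases "z \<in> Y False"; cases "y = z") (simp_all add: kern_def)
  qed
  show "0 \<le> (\<Sum>y\<in>Y False \<union> Y True. \<Sum>z\<in>Y False \<union> Y True. c y * c z * kern Y G y z)" for c
  proof -
    let ?S = "\<lambda>b d. \<Sum>y\<in>Y b. \<Sum>z\<in>Y d. c y * c z * kern Y G y z"
    let ?g = "\<Sum>y\<in>Y False. \<Sum>z\<in>Y True. G y z * c y * c z"
    have diag: "?S b b = (L2_set c (Y b))\<^sup>2" for b
    proof -
      have "?S b b = (\<Sum>y\<in>Y b. \<Sum>z\<in>Y b. if z = y then c y * c z else 0)"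
        by (intro sum.cong refl) (auto simp: kern_same[OF disj])
      then show ?thesis using fin by (simp add: L2_set_def sum_nonneg power2_eq_square)
    qed
    have FT: "?S False True = ?g"
      by (intro sum.cong refl) (auto simp: kern_def)
    have "?S True False = (\<Sum>y\<in>Y True. \<Sum>z\<in>Y False. G z y * c z * c y)"
      using disj by (intro sum.cong refl) (auto simp: kern_def)
    then have TF: "?S True False = ?g" by (simp add: sum.swap[of _ "Y True"])
    have "(\<Sum>y\<in>Y False \<union> Y True. \<Sum>z\<in>Y False \<union> Y True. c y * c z * kern Y G y z) =
       ?S False False + ?S False True + ?S True False + ?S True True"
      using fin disj by (simp add: sum.union_disjoint sum.distrib)
    also have "\<dots> = (L2_set c (Y False))\<^sup>2 + 2 * ?g + (L2_set c (Y True))\<^sup>2"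
      unfolding diag FT TF by simp
    \<comment> \<open>As \<open>G\<close> has norm at most 1, the cross term is at least minus twice
      the product of the two norms, which completes a square.\<close>
    also have "\<dots> \<ge> (L2_set c (Y False) - L2_set c (Y True))\<^sup>2"
      using opboundD[OF G, of c c] by (simp add: power2_diff)
    finally show ?thesis using zero_le_power2 order_trans by blast
  qed
qed

section \<open>Lifting an outer matrix by kernels of inner matrices\<close>

locale lift =
  fixes P :: "'p set" and Y :: "bool \<Rightarrow> 'i set" and lab :: "'s \<Rightarrow> 'p \<Rightarrow> bool"
  assumes finP: "finite P" and finY: "\<And>b. finite (Y b)" and disj: "Y False \<inter> Y True = {}"
begin

text \<open>An \<open>s\<close> is an outer input and \<open>lab s p\<close> its bit at block
  \<open>p\<close>; a tuple substitutes for each block an inner input with that value.\<close>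

definition tup :: "'s \<Rightarrow> ('p \<Rightarrow> 'i) set" where
  "tup s = PiE P (\<lambda>p. Y (lab s p))"

text \<open>\<open>G\<close> may depend on the block, so that the bound for a query can exchange the
  matrix of the queried block alone.\<close>

definition lifted :: "('s \<Rightarrow> 's \<Rightarrow> real) \<Rightarrow> ('p \<Rightarrow> 'i \<Rightarrow> 'i \<Rightarrow> real) \<Rightarrow> 's \<times> ('p \<Rightarrow> 'i) \<Rightarrow> 's \<times> ('p \<Rightarrow> 'i) \<Rightarrow> real" where
  "lifted M G y z = M (fst y) (fst z) * (\<Prod>p\<in>P. kern Y (G p) (snd y p) (snd z p))"

lemma finite_tup: "finite (tup s)"
  unfolding tup_def by (intro finite_PiE finP finY)

lemma sum_rows:
  assumes "finite L"
  shows "(\<Sum>x\<in>Sigma L tup. f x) = (\<Sum>s\<in>L. \<Sum>y\<in>tup s. f (s, y))"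
  using assms finite_tup by (subst sum.Sigma) auto

lemma tupD: "y \<in> tup s \<Longrightarrow> p \<in> P \<Longrightarrow> y p \<in> Y (lab s p)"
  unfolding tup_def by auto

lemma prod_kern_same:
  assumes "y \<in> tup s" "z \<in> tup s"
  shows "(\<Prod>p\<in>P. kern Y (G p) (y p) (z p)) = (if y = z then 1 else 0)"
proof -
  have 1: "(\<Prod>p\<in>P. kern Y (G p) (y p) (z p)) = (\<Prod>p\<in>P. if y p = z p then 1 else 0)"
    by (intro prod.cong refl kern_same[OF disj]) (auto intro: tupD assms)
  show ?thesis
  proof (cases "y = z")
    case False
    then obtain p where "p \<in> P" "y p \<noteq> z p"
      using assms unfolding tup_def by (meson PiE_ext)
    then show ?thesis using False finP unfolding 1 by (auto intro!: prod_zero)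
  next
    case True
    then show ?thesis unfolding 1 by simp
  qed
qed

text \<open>The products of kernels are inner products of the tensors \<open>W\<close>. Tensors over
  the same \<open>s\<close> are orthonormal by \<open>prod_kern_same\<close>, so passing from the
  coefficients on \<open>tup s\<close> to the vector \<open>F a s\<close> is an isometry, and the
  claim is \<open>opbound_vector\<close> for \<open>M\<close>.\<close>

lemma opbound_lifted:
  assumes fin: "finite L0" "finite L1"
    and G: "\<And>p. p \<in> P \<Longrightarrow> opbound (Y False) (Y True) (G p) 1"
    and M: "opbound L0 L1 M \<mu>" and "\<mu> \<ge> 0"
  shows "opbound (Sigma L0 tup) (Sigma L1 tup) (lifted M G) \<mu>"
proof (rule opboundI)
  fix a b :: "'s \<times> ('p \<Rightarrow> 'i) \<Rightarrow> real"
  let ?Y = "Y False \<union> Y True"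
  have "\<forall>p\<in>P. \<exists>R. \<forall>y\<in>?Y. \<forall>z\<in>?Y. kern Y (G p) y z = (\<Sum>k\<in>?Y. R k y * R k z)"
    using kern_gram[OF finY disj G] by blast
  then obtain R where R: "\<And>p y z. p \<in> P \<Longrightarrow> y \<in> ?Y \<Longrightarrow> z \<in> ?Y \<Longrightarrow>
      kern Y (G p) y z = (\<Sum>k\<in>?Y. R p k y * R p k z)"
    unfolding bchoice_iff by blast
  define K where "K = PiE P (\<lambda>_. ?Y)"
  define W where "W = (\<lambda>\<kappa> y. \<Prod>p\<in>P. R p (\<kappa> p) (y p))"
  have inY: "y p \<in> ?Y" if "y \<in> tup s" "p \<in> P" for y s p
    using tupD[OF that] by (cases "lab s p") auto
  have prodW: "(\<Prod>p\<in>P. kern Y (G p) (y p) (z p)) = (\<Sum>\<kappa>\<in>K. W \<kappa> y * W \<kappa> z)"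
    if "y \<in> tup s" "z \<in> tup t" for y z s t
  proof -
    have "(\<Prod>p\<in>P. kern Y (G p) (y p) (z p)) = (\<Prod>p\<in>P. \<Sum>k\<in>?Y. R p k (y p) * R p k (z p))"
      using that by (intro prod.cong refl R inY)
    also have "\<dots> = (\<Sum>\<kappa>\<in>K. W \<kappa> y * W \<kappa> z)"
      unfolding K_def W_def using finP finY by (subst prod_sum_PiE) (auto simp: prod.distrib)
    finally show ?thesis .
  qed
  define F where "F = (\<lambda>a s \<kappa>. \<Sum>y\<in>tup s. a (s, y) * W \<kappa> y)"
  have norm: "(\<Sum>\<kappa>\<in>K. (F a s \<kappa>)\<^sup>2) = (\<Sum>y\<in>tup s. (a (s, y))\<^sup>2)" for a s
  proof -
    have "(\<Sum>\<kappa>\<in>K. (F a s \<kappa>)\<^sup>2) =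
        (\<Sum>\<kappa>\<in>K. \<Sum>y\<in>tup s. \<Sum>z\<in>tup s. a (s, y) * a (s, z) * (W \<kappa> y * W \<kappa> z))"
      by (simp add: F_def power2_eq_square sum_product mult_ac)
    also have "\<dots> = (\<Sum>y\<in>tup s. \<Sum>\<kappa>\<in>K. \<Sum>z\<in>tup s. a (s, y) * a (s, z) * (W \<kappa> y * W \<kappa> z))"
      by (rule sum.swap)
    also have "\<dots> = (\<Sum>y\<in>tup s. \<Sum>z\<in>tup s. \<Sum>\<kappa>\<in>K. a (s, y) * a (s, z) * (W \<kappa> y * W \<kappa> z))"
      by (intro sum.cong refl sum.swap)
    also have "\<dots> = (\<Sum>y\<in>tup s. \<Sum>z\<in>tup s. a (s, y) * a (s, z) * (\<Prod>p\<in>P. kern Y (G p) (y p) (z p)))"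
      by (intro sum.cong refl) (simp add: prodW sum_distrib_left)
    also have "\<dots> = (\<Sum>y\<in>tup s. \<Sum>z\<in>tup s. if z = y then (a (s, y))\<^sup>2 else 0)"
      by (intro sum.cong refl) (auto simp: prod_kern_same power2_eq_square)
    also have "\<dots> = (\<Sum>y\<in>tup s. (a (s, y))\<^sup>2)"
      using finite_tup by simp
    finally show ?thesis .
  qed
  have L2: "L2_set a (Sigma L tup) = sqrt (\<Sum>s\<in>L. \<Sum>\<kappa>\<in>K. (F a s \<kappa>)\<^sup>2)" if "finite L" for a L
  proof -
    show ?thesis unfolding L2_set_def norm by (simp add: sum_rows that)
  qed
  have "(\<Sum>x\<in>Sigma L0 tup. \<Sum>x'\<in>Sigma L1 tup. lifted M G x x' * a x * b x') =
     (\<Sum>s\<in>L0. \<Sum>y\<in>tup s. \<Sum>t\<in>L1. \<Sum>z\<in>tup t. lifted M G (s, y) (t, z) * a (s, y) * b (t, z))"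
    by (simp add: sum_rows fin)
  also have "\<dots> = (\<Sum>s\<in>L0. \<Sum>t\<in>L1. \<Sum>y\<in>tup s. \<Sum>z\<in>tup t. lifted M G (s, y) (t, z) * a (s, y) * b (t, z))"
    by (intro sum.cong refl sum.swap)
  also have "\<dots> = (\<Sum>s\<in>L0. \<Sum>t\<in>L1. M s t * (\<Sum>\<kappa>\<in>K. F a s \<kappa> * F b t \<kappa>))"
  proof (intro sum.cong refl)
    fix s t
    have "(\<Sum>\<kappa>\<in>K. F a s \<kappa> * F b t \<kappa>) = (\<Sum>\<kappa>\<in>K. \<Sum>y\<in>tup s. \<Sum>z\<in>tup t. a (s, y) * b (t, z) * (W \<kappa> y * W \<kappa> z))"
      by (simp add: F_def sum_product mult_ac)
    also have "\<dots> = (\<Sum>y\<in>tup s. \<Sum>\<kappa>\<in>K. \<Sum>z\<in>tup t. a (s, y) * b (t, z) * (W \<kappa> y * W \<kappa> z))"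
      by (rule sum.swap)
    also have "\<dots> = (\<Sum>y\<in>tup s. \<Sum>z\<in>tup t. \<Sum>\<kappa>\<in>K. a (s, y) * b (t, z) * (W \<kappa> y * W \<kappa> z))"
      by (intro sum.cong refl sum.swap)
    also have "\<dots> = (\<Sum>y\<in>tup s. \<Sum>z\<in>tup t. a (s, y) * b (t, z) * (\<Prod>p\<in>P. kern Y (G p) (y p) (z p)))"
      by (intro sum.cong refl) (simp add: prodW sum_distrib_left)
    finally show "(\<Sum>y\<in>tup s. \<Sum>z\<in>tup t. lifted M G (s, y) (t, z) * a (s, y) * b (t, z)) =
        M s t * (\<Sum>\<kappa>\<in>K. F a s \<kappa> * F b t \<kappa>)"
      by (simp add: lifted_def sum_distrib_left mult_ac)
  qed
  also have "\<bar>\<dots>\<bar> \<le> \<mu> * (sqrt (\<Sum>s\<in>L0. \<Sum>\<kappa>\<in>K. (F a s \<kappa>)\<^sup>2) * sqrt (\<Sum>t\<in>L1. \<Sum>\<kappa>\<in>K. (F b t \<kappa>)\<^sup>2))"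
    by (rule opbound_vector[OF M \<open>\<mu> \<ge> 0\<close>])
  also have "\<dots> = \<mu> * (L2_set a (Sigma L0 tup) * L2_set b (Sigma L1 tup))"
    by (simp add: L2 fin)
  finally show "\<bar>\<Sum>x\<in>Sigma L0 tup. \<Sum>x'\<in>Sigma L1 tup. lifted M G x x' * a x * b x'\<bar> \<le>
     \<mu> * (L2_set a (Sigma L0 tup) * L2_set b (Sigma L1 tup))" .
qed

text \<open>If \<open>s\<close> and \<open>t\<close> agree at \<open>j\<close>, the kernel there is
  the identity and no query inside the block distinguishes the two sides. So \<open>M\<close> can be
  restricted to pairs that differ at \<open>j\<close>, where the masked inner matrix, bounded by 1
  instead of \<open>A\<close>, takes the place of \<open>G\<close>; this gains the factor
  \<open>1 / A\<close>.\<close>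

lemma opbound_lifted_query:
  assumes fin: "finite L0" "finite L1" and "A > 0" "j \<in> P"
    and G: "opbound (Y False) (Y True) G A"
    and Gv: "opbound (Y False) (Y True) (\<lambda>y z. if \<xi> y \<noteq> \<xi> z then G y z else 0) 1"
    and M: "opbound L0 L1 (\<lambda>s t. if lab s j \<noteq> lab t j then M s t else 0) \<mu>" and "\<mu> \<ge> 0"
  shows "opbound (Sigma L0 tup) (Sigma L1 tup)
    (\<lambda>y z. if \<xi> (snd y j) \<noteq> \<xi> (snd z j) then lifted M (\<lambda>_ y z. G y z / A) y z else 0) (\<mu> / A)"
proof -
  define G' where "G' = (\<lambda>p y z. if p = j then if \<xi> y \<noteq> \<xi> z then G y z else 0 else G y z / A)"
  define M' where "M' = (\<lambda>s t. if lab s j \<noteq> lab t j then M s t else 0)"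
  have "opbound (Y False) (Y True) (G' p) 1" for p
  proof (cases "p = j")
    case True
    then show ?thesis using Gv by (simp add: G'_def)
  next
    case False
    then show ?thesis using opbound_scale[OF G, of "1 / A"] \<open>A > 0\<close> by (simp add: G'_def)
  qed
  then have "opbound (Sigma L0 tup) (Sigma L1 tup) (lifted M' G') \<mu>"
    by (intro opbound_lifted fin) (use M \<open>\<mu> \<ge> 0\<close> in \<open>auto simp: M'_def\<close>)
  from opbound_scale[OF this, of "1 / A"]
  have "opbound (Sigma L0 tup) (Sigma L1 tup) (\<lambda>y z. 1 / A * lifted M' G' y z) (\<mu> / A)"
    using \<open>A > 0\<close> by simp
  moreover have "(if \<xi> (snd y j) \<noteq> \<xi> (snd z j) then lifted M (\<lambda>_ y z. G y z / A) y z else 0) =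
      1 / A * lifted M' G' y z" if yz: "y \<in> Sigma L0 tup" "z \<in> Sigma L1 tup" for y z
  proof -
    obtain s y' t z' where [simp]: "y = (s, y')" "z = (t, z')" by (cases y, cases z)
    have y': "y' \<in> tup s" and z': "z' \<in> tup t" using yz by auto
    have yj: "y' j \<in> Y (lab s j)" and zj: "z' j \<in> Y (lab t j)"
      using tupD[OF y' \<open>j \<in> P\<close>] tupD[OF z' \<open>j \<in> P\<close>] by auto
    let ?rest = "\<Prod>p\<in>P - {j}. kern Y (\<lambda>y z. G y z / A) (y' p) (z' p)"
    have split1: "(\<Prod>p\<in>P. kern Y (\<lambda>y z. G y z / A) (y' p) (z' p)) = kern Y (\<lambda>y z. G y z / A) (y' j) (z' j) * ?rest"
      using finP \<open>j \<in> P\<close> by (simp add: prod.remove)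
    have "(\<Prod>p\<in>P. kern Y (G' p) (y' p) (z' p)) = kern Y (G' j) (y' j) (z' j) * (\<Prod>p\<in>P - {j}. kern Y (G' p) (y' p) (z' p))"
      using finP \<open>j \<in> P\<close> by (simp add: prod.remove)
    also have "(\<Prod>p\<in>P - {j}. kern Y (G' p) (y' p) (z' p)) = ?rest"
      by (intro prod.cong refl) (simp add: G'_def)
    finally have split2: "(\<Prod>p\<in>P. kern Y (G' p) (y' p) (z' p)) = kern Y (G' j) (y' j) (z' j) * ?rest" .
    show ?thesis
    proof (cases "lab s j = lab t j")
      case True
      then have "kern Y (\<lambda>y z. G y z / A) (y' j) (z' j) = (if y' j = z' j then 1 else 0)"
        using yj zj by (intro kern_same[OF disj, of _ "lab s j"]) auto
      then show ?thesis using True by (auto simp: lifted_def M'_def split1)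
    next
      case False
      have "(if \<xi> (y' j) \<noteq> \<xi> (z' j) then kern Y (\<lambda>y z. G y z / A) (y' j) (z' j) else 0) =
          1 / A * kern Y (G' j) (y' j) (z' j)"
        using yj zj False disj by (cases "lab s j"; cases "lab t j") (auto simp: kern_def G'_def)
      then show ?thesis using False by (auto simp: lifted_def M'_def split1 split2)
    qed
  qed
  ultimately show ?thesis
    by (subst opbound_cong[where M' = "\<lambda>y z. 1 / A * lifted M' G' y z"]) auto
qed

text \<open>Against \<open>w\<close> each of the four blocks of the kernel has value 1: the identity
  blocks because \<open>w\<close> has norm 1 on each side, the others by the normalisation of
  \<open>G\<close>. So every outer entry keeps its weight.\<close>

lemma lifted_value:
  fixes u w :: "_ \<Rightarrow> real"
  assumes fin: "finite L0" "finite L1"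
    and w: "\<And>b. (\<Sum>y\<in>Y b. (w y)\<^sup>2) = 1"
    and G: "(\<Sum>y\<in>Y False. \<Sum>z\<in>Y True. G y z * w y * w z) = 1"
  shows "(\<Sum>y\<in>Sigma L0 tup. \<Sum>z\<in>Sigma L1 tup. lifted M (\<lambda>_. G) y z *
      (u (fst y) * (\<Prod>p\<in>P. w (snd y p))) * (u (fst z) * (\<Prod>p\<in>P. w (snd z p)))) =
    (\<Sum>s\<in>L0. \<Sum>t\<in>L1. M s t * u s * u t)"
proof -
  have one: "(\<Sum>y\<in>Y b. \<Sum>z\<in>Y d. kern Y G y z * w y * w z) = 1" for b d
  proof (cases "b = d")
    case True
    have "(\<Sum>y\<in>Y b. \<Sum>z\<in>Y b. kern Y G y z * w y * w z) = (\<Sum>y\<in>Y b. \<Sum>z\<in>Y b. if z = y then w y * w z else 0)"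
      by (intro sum.cong refl) (auto simp: kern_same[OF disj])
    then show ?thesis using w[of b] finY True by (simp add: power2_eq_square)
  next
    case False
    have FT: "(\<Sum>y\<in>Y False. \<Sum>z\<in>Y True. kern Y G y z * w y * w z) = 1"
      unfolding G[symmetric] by (intro sum.cong refl) (auto simp: kern_def)
    have "(\<Sum>y\<in>Y True. \<Sum>z\<in>Y False. kern Y G y z * w y * w z) =
        (\<Sum>y\<in>Y True. \<Sum>z\<in>Y False. G z y * w z * w y)"
      using disj by (intro sum.cong refl) (auto simp: kern_def)
    also have "\<dots> = 1" unfolding G[symmetric] by (rule sum.swap)
    finally have "(\<Sum>y\<in>Y True. \<Sum>z\<in>Y False. kern Y G y z * w y * w z) = 1" .
    with FT False show ?thesis by (cases b; cases d) auto
  qed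
  have tot: "(\<Sum>y\<in>tup s. \<Sum>z\<in>tup t. \<Prod>p\<in>P. kern Y G (y p) (z p) * w (y p) * w (z p)) = 1" for s t
  proof -
    have "(\<Sum>y\<in>tup s. \<Sum>z\<in>tup t. \<Prod>p\<in>P. kern Y G (y p) (z p) * w (y p) * w (z p)) =
        (\<Sum>y\<in>tup s. \<Prod>p\<in>P. \<Sum>z\<in>Y (lab t p). kern Y G (y p) z * w (y p) * w z)"
      unfolding tup_def using finP finY by (subst prod_sum_PiE) auto
    also have "\<dots> = (\<Prod>p\<in>P. \<Sum>y\<in>Y (lab s p). \<Sum>z\<in>Y (lab t p). kern Y G y z * w y * w z)"
      unfolding tup_def using finP finY by (subst prod_sum_PiE) auto
    finally show ?thesis by (simp add: one)
  qed
  have "(\<Sum>y\<in>Sigma L0 tup. \<Sum>z\<in>Sigma L1 tup. lifted M (\<lambda>_. G) y z *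
      (u (fst y) * (\<Prod>p\<in>P. w (snd y p))) * (u (fst z) * (\<Prod>p\<in>P. w (snd z p)))) =
    (\<Sum>s\<in>L0. \<Sum>y\<in>tup s. \<Sum>t\<in>L1. \<Sum>z\<in>tup t. M s t * u s * u t * (\<Prod>p\<in>P. kern Y G (y p) (z p) * w (y p) * w (z p)))"
    by (simp add: sum_rows fin lifted_def prod.distrib mult_ac)
  also have "\<dots> = (\<Sum>s\<in>L0. \<Sum>t\<in>L1. \<Sum>y\<in>tup s. \<Sum>z\<in>tup t. M s t * u s * u t * (\<Prod>p\<in>P. kern Y G (y p) (z p) * w (y p) * w (z p)))"
    by (intro sum.cong refl sum.swap)
  also have "\<dots> = (\<Sum>s\<in>L0. \<Sum>t\<in>L1. M s t * u s * u t *
      (\<Sum>y\<in>tup s. \<Sum>z\<in>tup t. \<Prod>p\<in>P. kern Y G (y p) (z p) * w (y p) * w (z p)))"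
    by (simp add: sum_distrib_left)
  finally show ?thesis unfolding tot by simp
qed

lemma lifted_unit:
  fixes u w :: "_ \<Rightarrow> real"
  assumes "finite L" and w: "\<And>b. (\<Sum>y\<in>Y b. (w y)\<^sup>2) = 1"
  shows "(\<Sum>y\<in>Sigma L tup. (u (fst y) * (\<Prod>p\<in>P. w (snd y p)))\<^sup>2) = (\<Sum>s\<in>L. (u s)\<^sup>2)"
proof -
  have "(\<Sum>y\<in>tup s. \<Prod>p\<in>P. (w (y p))\<^sup>2) = 1" for s
  proof -
    have "(\<Sum>y\<in>tup s. \<Prod>p\<in>P. (w (y p))\<^sup>2) = (\<Prod>p\<in>P. \<Sum>y\<in>Y (lab s p). (w y)\<^sup>2)"
      unfolding tup_def by (rule prod_sum_PiE[OF finP finY, symmetric])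
    then show ?thesis by (simp add: w)
  qed
  then show ?thesis
    by (simp add: sum_rows assms(1) power_mult_distrib prod_power_distrib flip: sum_distrib_left)
qed

end

section \<open>The negative-weight adversary bound\<close>

definition depends_on :: "'v set \<Rightarrow> (('v \<Rightarrow> bool) \<Rightarrow> bool) \<Rightarrow> bool" where
  "depends_on V F \<longleftrightarrow> (\<forall>x x'. (\<forall>v\<in>V. x' v = x v) \<longrightarrow> F x' = F x)"

text \<open>Only the block between 0-inputs and 1-inputs is kept, and its entries may be negative.
  The query bounds are normalised to 1, and \<open>w\<close> holds on both sides the unit vectors
  that attain the norm \<open>A\<close>. Rows are indices mapped to inputs by \<open>\<xi>\<close>,
  since one input can label several rows, as in \<open>k\<close>-SUM with one row for each
  solution.\<close>

definition adversary ::
  "'v set \<Rightarrow> (('v \<Rightarrow> bool) \<Rightarrow> bool) \<Rightarrow> real \<Rightarrow> (bool \<Rightarrow> 'i set) \<Rightarrow> ('i \<Rightarrow> 'v \<Rightarrow> bool) \<Rightarrow>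
    ('i \<Rightarrow> 'i \<Rightarrow> real) \<Rightarrow> ('i \<Rightarrow> real) \<Rightarrow> bool" where
  "adversary V F A Y \<xi> G w \<longleftrightarrow>
     (\<forall>b. finite (Y b)) \<and> (\<forall>b. \<forall>y\<in>Y b. F (\<xi> y) = b) \<and> (\<forall>b. (\<Sum>y\<in>Y b. (w y)\<^sup>2) = 1) \<and>
     opbound (Y False) (Y True) G A \<and> (\<Sum>y\<in>Y False. \<Sum>z\<in>Y True. G y z * w y * w z) = A \<and>
     (\<forall>v\<in>V. opbound (Y False) (Y True) (\<lambda>y z. if \<xi> y v \<noteq> \<xi> z v then G y z else 0) 1)"

text \<open>A definition cannot quantify over the type of row indices. Fixing \<open>nat\<close>
  loses nothing, as \<open>advI\<close> moves any finite witness there.\<close>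

definition adv :: "'v set \<Rightarrow> (('v \<Rightarrow> bool) \<Rightarrow> bool) \<Rightarrow> real \<Rightarrow> bool" where
  "adv V F A \<longleftrightarrow> (\<exists>(Y :: bool \<Rightarrow> nat set) \<xi> G w. adversary V F A Y \<xi> G w)"

lemma adversary_label: "adversary V F A Y \<xi> G w \<Longrightarrow> y \<in> Y b \<Longrightarrow> F (\<xi> y) = b"
  unfolding adversary_def by simp

lemma adversary_disjoint:
  assumes "adversary V F A Y \<xi> G w"
  shows "Y False \<inter> Y True = {}"
proof (rule ccontr)
  assume "Y False \<inter> Y True \<noteq> {}"
  then obtain y where "y \<in> Y False" "y \<in> Y True" by blast
  then have "F (\<xi> y) = False" "F (\<xi> y) = True" using adversary_label[OF assms] by metis+
  then show False by simp
qed

lemma opbound_reindex: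
  assumes "inj_on f I" "inj_on g J" "opbound I J M \<mu>"
    and "\<And>i j. i \<in> I \<Longrightarrow> j \<in> J \<Longrightarrow> M' (f i) (g j) = M i j"
  shows "opbound (f ` I) (g ` J) M' \<mu>"
proof (rule opboundI)
  fix a b
  have "(\<Sum>i\<in>f ` I. \<Sum>j\<in>g ` J. M' i j * a i * b j) = (\<Sum>i\<in>I. \<Sum>j\<in>J. M i j * a (f i) * b (g j))"
    using assms by (simp add: sum.reindex cong: sum.cong)
  moreover have "L2_set a (f ` I) = L2_set (\<lambda>i. a (f i)) I" "L2_set b (g ` J) = L2_set (\<lambda>j. b (g j)) J"
    using assms by (simp_all add: L2_set_def sum.reindex)
  ultimately show "\<bar>\<Sum>i\<in>f ` I. \<Sum>j\<in>g ` J. M' i j * a i * b j\<bar> \<le> \<mu> * (L2_set a (f ` I) * L2_set b (g ` J))"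
    using opboundD[OF assms(3), of "\<lambda>i. a (f i)" "\<lambda>j. b (g j)"] by simp
qed

lemma advI:
  fixes Y :: "bool \<Rightarrow> 'i set"
  assumes "adversary V F A Y \<xi> G w"
  shows "adv V F A"
proof -
  let ?Y = "Y False \<union> Y True"
  have fin: "finite (Y b)" for b using assms by (simp add: adversary_def)
  obtain f :: "'i \<Rightarrow> nat" where f: "inj_on f ?Y"
    using finite_imp_inj_to_nat_seg[of ?Y] fin by auto
  define g where "g = the_inv_into ?Y f"
  have sub: "Y b \<subseteq> ?Y" for b by (cases b) auto
  have gf: "g (f y) = y" if "y \<in> Y b" for y b
    unfolding g_def using f sub[of b] that by (intro the_inv_into_f_f) auto
  have inj: "inj_on f (Y b)" for b by (rule inj_on_subset[OF f sub])
  have "adversary V F A (\<lambda>b. f ` Y b) (\<lambda>n. \<xi> (g n)) (\<lambda>m n. G (g m) (g n)) (\<lambda>n. w (g n))"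
    unfolding adversary_def
  proof (intro conjI allI ballI)
    show "finite (f ` Y b)" for b using fin by simp
    show "F (\<xi> (g n)) = b" if "n \<in> f ` Y b" for n b
      using that assms by (auto simp: adversary_def gf)
    show "(\<Sum>n\<in>f ` Y b. (w (g n))\<^sup>2) = 1" for b
      using assms by (simp add: sum.reindex[OF inj] gf adversary_def cong: sum.cong)
    show "opbound (f ` Y False) (f ` Y True) (\<lambda>m n. G (g m) (g n)) A"
      by (rule opbound_reindex[OF inj inj, of _ _ G]) (use assms in \<open>auto simp: adversary_def gf\<close>)
    show "(\<Sum>y\<in>f ` Y False. \<Sum>z\<in>f ` Y True. G (g y) (g z) * w (g y) * w (g z)) = A"
      using assms by (simp add: sum.reindex[OF inj] gf adversary_def cong: sum.cong)
    show "opbound (f ` Y False) (f ` Y True) (\<lambda>y z. if \<xi> (g y) v \<noteq> \<xi> (g z) v then G (g y) (g z) else 0) 1"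
      if "v \<in> V" for v
      by (rule opbound_reindex[OF inj inj, of _ _ "\<lambda>y z. if \<xi> y v \<noteq> \<xi> z v then G y z else 0"])
        (use assms that in \<open>auto simp: adversary_def gf\<close>)
  qed
  then show ?thesis unfolding adv_def by blast
qed

lemma adv_mono:
  assumes "adv V F A" "0 \<le> A'" "A' \<le> A"
  shows "adv V F A'"
proof (cases "A = 0")
  case False
  obtain Y :: "bool \<Rightarrow> nat set" and \<xi> G w where adv: "adversary V F A Y \<xi> G w"
    using assms(1) unfolding adv_def by blast
  define c where "c = A' / A"
  have c: "0 \<le> c" "c \<le> 1" "c * A = A'" using assms False by (auto simp: c_def)
  have "adversary V F A' Y \<xi> (\<lambda>y z. c * G y z) w"
    unfolding adversary_def
  proof (intro conjI allI ballI)
    show "opbound (Y False) (Y True) (\<lambda>y z. c * G y z) A'"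
      using opbound_scale[of "Y False" "Y True" G A c] adv c by (simp add: adversary_def)
    have "(\<Sum>y\<in>Y False. \<Sum>z\<in>Y True. c * G y z * w y * w z) =
        c * (\<Sum>y\<in>Y False. \<Sum>z\<in>Y True. G y z * w y * w z)"
      by (simp add: sum_distrib_left mult.assoc)
    then show "(\<Sum>y\<in>Y False. \<Sum>z\<in>Y True. c * G y z * w y * w z) = A'"
      using adv c by (simp add: adversary_def)
    show "opbound (Y False) (Y True) (\<lambda>y z. if \<xi> y v \<noteq> \<xi> z v then c * G y z else 0) 1" if "v \<in> V" for v
    proof (rule opbound_mono)
      have "opbound (Y False) (Y True) (\<lambda>y z. c * (if \<xi> y v \<noteq> \<xi> z v then G y z else 0)) (\<bar>c\<bar> * 1)"
        using adv that by (intro opbound_scale) (simp add: adversary_def)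
      then show "opbound (Y False) (Y True) (\<lambda>y z. if \<xi> y v \<noteq> \<xi> z v then c * G y z else 0) (\<bar>c\<bar> * 1)"
        by (simp add: if_distrib cong: if_cong)
    qed (use c in simp)
  qed (use adv in \<open>auto simp: adversary_def\<close>)
  then show ?thesis by (rule advI)
qed (use assms in simp)

definition block_compose :: "(('p \<Rightarrow> bool) \<Rightarrow> bool) \<Rightarrow> (('v \<Rightarrow> bool) \<Rightarrow> bool) \<Rightarrow> ('p \<times> 'v \<Rightarrow> bool) \<Rightarrow> bool" where
  "block_compose h g x = h (\<lambda>p. g (\<lambda>v. x (p, v)))"

text \<open>The outer matrix is lifted by the kernels of \<open>Gg / B\<close> and scaled by
  \<open>B\<close>. A query to block \<open>p\<close> sees only outer pairs that differ at
  \<open>p\<close>, with bound 1, and the gain \<open>1 / B\<close> of the inner block cancels the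
  scaling. The value is exactly \<open>A * B\<close>, so iterated composition loses no
  constants.\<close>

lemma adv_compose:
  assumes "finite P" "depends_on P h" "adv P h A" "A > 0" "adv V g B" "B > 0"
  shows "adv (P \<times> V) (block_compose h g) (A * B)"
proof -
  obtain Yh :: "bool \<Rightarrow> nat set" and \<xi>h Gh wh where h: "adversary P h A Yh \<xi>h Gh wh"
    using assms unfolding adv_def by blast
  obtain Yg :: "bool \<Rightarrow> nat set" and \<xi>g Gg wg where g: "adversary V g B Yg \<xi>g Gg wg"
    using assms unfolding adv_def by blast
  interpret lift P Yg \<xi>h
    using g assms(1) adversary_disjoint[OF g] by unfold_locales (auto simp: adversary_def)
  have finh: "finite (Yh b)" for b using h by (simp add: adversary_def)
  define Y where "Y = (\<lambda>b. Sigma (Yh b) tup)"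
  define \<Xi> where "\<Xi> = (\<lambda>x :: nat \<times> ('a \<Rightarrow> nat). \<lambda>(p, v). \<xi>g (snd x p) v)"
  define N where "N = (\<lambda>_ :: 'a. \<lambda>a b. Gg a b / B)"
  define w where "w = (\<lambda>x. wh (fst x) * (\<Prod>p\<in>P. wg (snd x p)))"
  have wg: "(\<Sum>y\<in>Yg b. (wg y)\<^sup>2) = 1" for b using g by (simp add: adversary_def)
  have Nbound: "opbound (Yg False) (Yg True) (N p) 1" for p
    using opbound_scale[of "Yg False" "Yg True" Gg B "1 / B"] g \<open>B > 0\<close>
    by (simp add: N_def adversary_def)
  have "(\<Sum>y\<in>Yg False. \<Sum>z\<in>Yg True. Gg y z / B * wg y * wg z) =
      (\<Sum>y\<in>Yg False. \<Sum>z\<in>Yg True. Gg y z * wg y * wg z) / B"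
    by (simp add: sum_divide_distrib)
  then have Nval: "(\<Sum>y\<in>Yg False. \<Sum>z\<in>Yg True. Gg y z / B * wg y * wg z) = 1"
    using g \<open>B > 0\<close> by (simp add: adversary_def)
  have "adversary (P \<times> V) (block_compose h g) (A * B) Y \<Xi> (\<lambda>y z. B * lifted Gh N y z) w"
    unfolding adversary_def
  proof (intro conjI allI ballI)
    show "finite (Y b)" for b unfolding Y_def by (intro finite_SigmaI finh finite_tup)
    show "block_compose h g (\<Xi> x) = b" if "x \<in> Y b" for x b
    proof -
      obtain s y where x: "x = (s, y)" by (cases x)
      then have s: "s \<in> Yh b" and y: "y \<in> tup s" using that by (auto simp: Y_def)
      have "g (\<xi>g (y p)) = \<xi>h s p" if "p \<in> P" for p
        by (rule adversary_label[OF g tupD[OF y that]])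
      then have "h (\<lambda>p. g (\<xi>g (y p))) = h (\<xi>h s)"
        using assms(2) unfolding depends_on_def by simp
      moreover have "h (\<xi>h s) = b" by (rule adversary_label[OF h s])
      ultimately show ?thesis by (simp add: block_compose_def \<Xi>_def x)
    qed
    show "(\<Sum>y\<in>Y b. (w y)\<^sup>2) = 1" for b
      unfolding Y_def w_def using lifted_unit[OF finh[of b] wg, where u = wh] h by (simp add: adversary_def)
    have "opbound (Y False) (Y True) (lifted Gh N) A"
      unfolding Y_def using h \<open>A > 0\<close> by (intro opbound_lifted finh Nbound) (auto simp: adversary_def)
    from opbound_scale[OF this, of B]
    show "opbound (Y False) (Y True) (\<lambda>y z. B * lifted Gh N y z) (A * B)"
      using \<open>B > 0\<close> by (simp add: mult.commute)
    have "(\<Sum>y\<in>Y False. \<Sum>z\<in>Y True. B * lifted Gh N y z * w y * w z) =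
        B * (\<Sum>y\<in>Y False. \<Sum>z\<in>Y True. lifted Gh N y z * w y * w z)"
      by (simp add: sum_distrib_left mult.assoc)
    also have "(\<Sum>y\<in>Y False. \<Sum>z\<in>Y True. lifted Gh N y z * w y * w z) = A"
      using lifted_value[OF finh[of False] finh[of True] wg Nval, where M = Gh and u = wh] h
      unfolding Y_def w_def N_def adversary_def by simp
    finally show "(\<Sum>y\<in>Y False. \<Sum>z\<in>Y True. B * lifted Gh N y z * w y * w z) = A * B"
      by (simp add: mult.commute)
    fix pv assume "pv \<in> P \<times> V"
    then obtain p v where pv: "pv = (p, v)" "p \<in> P" "v \<in> V" by blast
    have "opbound (Y False) (Y True)
       (\<lambda>y z. if \<xi>g (snd y p) v \<noteq> \<xi>g (snd z p) v then lifted Gh N y z else 0) (1 / B)"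
      unfolding Y_def N_def
      using h g pv \<open>B > 0\<close> by (intro opbound_lifted_query finh) (auto simp: adversary_def)
    from opbound_scale[OF this, of B]
    show "opbound (Y False) (Y True) (\<lambda>y z. if \<Xi> y pv \<noteq> \<Xi> z pv then B * lifted Gh N y z else 0) 1"
      using \<open>B > 0\<close> by (simp add: \<Xi>_def pv if_distrib cong: if_cong)
  qed
  then show ?thesis by (rule advI)
qed

definition and_fun :: "nat \<Rightarrow> (nat \<Rightarrow> bool) \<Rightarrow> bool" where
  "and_fun m x \<longleftrightarrow> (\<forall>i<m. x i)"

text \<open>The all-ones input, with index \<open>m\<close>, is joined to the \<open>m\<close>
  inputs with a single zero, where index \<open>i < m\<close> has its zero at \<open>i\<close>. The
  resulting all-ones row has norm \<open>sqrt m\<close>, and a query meets a single entry of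
  it.\<close>

lemma adv_and:
  assumes "m > 0"
  shows "adv {..<m} (and_fun m) (sqrt m)"
proof -
  define Y where "Y = (\<lambda>b. if b then {m} else {..<m})"
  define w where "w = (\<lambda>i. if i < m then 1 / sqrt m else 1)"
  define \<xi> where "\<xi> = (\<lambda>i j :: nat. j \<noteq> i)"
  have "adversary {..<m} (and_fun m) (sqrt m) Y \<xi> (\<lambda>_ _. 1) w"
    unfolding adversary_def
  proof (intro conjI allI ballI)
    show "finite (Y b)" for b by (simp add: Y_def)
    show "and_fun m (\<xi> y) = b" if "y \<in> Y b" for y b
      using that by (auto simp: and_fun_def \<xi>_def Y_def split: if_splits)
    show "(\<Sum>y\<in>Y b. (w y)\<^sup>2) = 1" for b
      using assms by (simp add: Y_def w_def power_divide)
    show "opbound (Y False) (Y True) (\<lambda>_ _. 1) (sqrt m)"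
      using opbound_all_ones[of "{..<m}" "{m}"] by (simp add: Y_def)
    show "(\<Sum>y\<in>Y False. \<Sum>z\<in>Y True. 1 * w y * w z) = sqrt m"
      using assms by (simp add: Y_def w_def real_div_sqrt)
    show "opbound (Y False) (Y True) (\<lambda>y z. if \<xi> y v \<noteq> \<xi> z v then 1 else 0) 1" if "v \<in> {..<m}" for v
    proof (rule opboundI)
      fix a b :: "nat \<Rightarrow> real"
      have "(\<Sum>y\<in>Y False. \<Sum>z\<in>Y True. (if \<xi> y v \<noteq> \<xi> z v then 1 else 0) * a y * b z) =
          (\<Sum>y<m. (if \<xi> y v \<noteq> \<xi> m v then 1 else 0) * a y * b m)"
        by (simp add: Y_def)
      also have "\<dots> = (\<Sum>y<m. if y = v then a v * b m else 0)"
        using that by (intro sum.cong refl) (auto simp: \<xi>_def)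
      finally have "(\<Sum>y\<in>Y False. \<Sum>z\<in>Y True. (if \<xi> y v \<noteq> \<xi> z v then 1 else 0) * a y * b z) =
          (\<Sum>y<m. if y = v then a v * b m else 0)" .
      then have "(\<Sum>y\<in>Y False. \<Sum>z\<in>Y True. (if \<xi> y v \<noteq> \<xi> z v then 1 else 0) * a y * b z) = a v * b m"
        using that by simp
      moreover have "\<bar>a v\<bar> \<le> L2_set a (Y False)"
      proof -
        have "(a v)\<^sup>2 \<le> (\<Sum>y\<in>Y False. (a y)\<^sup>2)"
          using that by (intro member_le_sum) (auto simp: Y_def)
        then show ?thesis by (simp add: L2_set_def real_le_rsqrt)
      qed
      moreover have "\<bar>b m\<bar> \<le> L2_set b (Y True)" by (simp add: L2_set_def Y_def)
      ultimately show "\<bar>\<Sum>y\<in>Y False. \<Sum>z\<in>Y True. (if \<xi> y v \<noteq> \<xi> z v then 1 else 0) * a y * b z\<bar> \<le>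
          1 * (L2_set a (Y False) * L2_set b (Y True))"
        by (simp add: abs_mult mult_mono)
    qed
  qed
  then show ?thesis by (rule advI)
qed

section \<open>Cheat sheets and their adversary bound\<close>

definition certif :: "(('v \<Rightarrow> bool) \<Rightarrow> bool) \<Rightarrow> 'v set \<Rightarrow> ('v \<Rightarrow> bool) \<Rightarrow> bool" where
  "certif F D x \<longleftrightarrow> (\<forall>x'. (\<forall>v\<in>D. x' v = x v) \<longrightarrow> F x' = F x)"

text \<open>In a cheat sheet, \<open>Inl (j, v)\<close> is variable \<open>v\<close> of copy \<open>j\<close>. The values of the copies form a
  label \<open>l\<close>, which points to the cell of variables \<open>Inr (l, i)\<close>: bit \<open>i = 0\<close> validates the cell, the
  other bits encode one certificate per copy.\<close>

definition cs_label :: "nat \<Rightarrow> (('v \<Rightarrow> bool) \<Rightarrow> bool) \<Rightarrow> (nat \<times> 'v + bool list \<times> nat \<Rightarrow> bool) \<Rightarrow> bool list" where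
  "cs_label c F z = map (\<lambda>j. F (\<lambda>v. z (Inl (j, v)))) [0..<c]"

definition cs_cell :: "nat \<Rightarrow> (nat \<times> 'v + bool list \<times> nat \<Rightarrow> bool) \<Rightarrow> bool list \<Rightarrow> nat set" where
  "cs_cell B z l = {i. i < B \<and> z (Inr (l, Suc i))}"

definition cheat_sheet ::
  "nat \<Rightarrow> nat \<Rightarrow> (nat set \<Rightarrow> nat \<Rightarrow> 'v set) \<Rightarrow> (('v \<Rightarrow> bool) \<Rightarrow> bool) \<Rightarrow>
    (nat \<times> 'v + bool list \<times> nat \<Rightarrow> bool) \<Rightarrow> bool" where
  "cheat_sheet c B dec F z \<longleftrightarrow>
     (let l = cs_label c F z in
        z (Inr (l, 0)) \<and> (\<forall>j<c. certif F (dec (cs_cell B z l) j) (\<lambda>v. z (Inl (j, v)))))"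

definition cs_vars :: "nat \<Rightarrow> nat \<Rightarrow> 'v set \<Rightarrow> (nat \<times> 'v + bool list \<times> nat) set" where
  "cs_vars c B V = Inl ` ({..<c} \<times> V) \<union> Inr ` ({l. length l = c} \<times> {..B})"

lemma opbound_extend:
  assumes "finite J" "J' \<subseteq> J" "opbound I J' M \<mu>" "\<mu> \<ge> 0"
  shows "opbound I J (\<lambda>i j. if j \<in> J' then M i j else 0) \<mu>"
proof (rule opboundI)
  fix a b
  have "(\<Sum>i\<in>I. \<Sum>j\<in>J. (if j \<in> J' then M i j else 0) * a i * b j) = (\<Sum>i\<in>I. \<Sum>j\<in>J'. M i j * a i * b j)"
    using assms by (intro sum.cong refl sum.mono_neutral_cong_right) auto
  also have "\<bar>\<dots>\<bar> \<le> \<mu> * (L2_set a I * L2_set b J')" by (rule opboundD[OF assms(3)])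
  also have "\<dots> \<le> \<mu> * (L2_set a I * L2_set b J)"
  proof -
    have "(\<Sum>j\<in>J'. (b j)\<^sup>2) \<le> (\<Sum>j\<in>J. (b j)\<^sup>2)" using assms by (intro sum_mono2) auto
    then show ?thesis using assms by (intro mult_left_mono) (auto simp: L2_set_def sum_nonneg)
  qed
  finally show "\<bar>\<Sum>i\<in>I. \<Sum>j\<in>J. (if j \<in> J' then M i j else 0) * a i * b j\<bar> \<le> \<mu> * (L2_set a I * L2_set b J)" .
qed

text \<open>The 0-inputs have a blank sheet, the 1-inputs only fill the cell of their own label. Since there
  are \<open>2\<^sup>c\<close> labels of equal weight, a query to a cell only sees a \<open>2\<^sup>-\<^sup>c\<^sup>/\<^sup>2\<close> fraction of the norm
  \<open>A\<close>, which \<open>A\<^sup>2 \<le> 2\<^sup>c\<close> bounds by 1.\<close>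

lemma adv_cheat_sheet:
  assumes "adv V F A" "A > 0" "A\<^sup>2 \<le> 2 ^ c"
    and cert: "\<And>x. \<exists>D\<in>\<D>. certif F D x"
    and dec: "\<And>D. (\<And>j. j < c \<Longrightarrow> D j \<in> \<D>) \<Longrightarrow> \<exists>S\<subseteq>{..<B}. \<forall>j<c. dec S j = D j"
  shows "adv (cs_vars c B V) (cheat_sheet c B dec F) A"
proof -
  obtain Y0 :: "bool \<Rightarrow> nat set" and \<xi> G w where F: "adversary V F A Y0 \<xi> G w"
    using assms unfolding adv_def by blast
  interpret lift "{..<c}" Y0 "snd :: bool \<times> (nat \<Rightarrow> bool) \<Rightarrow> nat \<Rightarrow> bool"
    using F adversary_disjoint[OF F] by unfold_locales (auto simp: adversary_def)
  have "\<exists>S\<subseteq>{..<B}. \<forall>j<c. certif F (dec S j) (\<xi> (y j))" for y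
  proof -
    have "\<forall>j. \<exists>D. D \<in> \<D> \<and> certif F D (\<xi> (y j))" using cert by blast
    then obtain D where D: "\<forall>j. D j \<in> \<D> \<and> certif F (D j) (\<xi> (y j))"
      unfolding choice_iff by blast
    then obtain S where "S \<subseteq> {..<B}" "\<forall>j<c. dec S j = D j" using dec[of D] by blast
    then show ?thesis using D by (intro exI[of _ S]) auto
  qed
  then have "\<forall>y. \<exists>S. S \<subseteq> {..<B} \<and> (\<forall>j<c. certif F (dec S j) (\<xi> (y j)))" by blast
  then obtain S where "\<forall>y. S y \<subseteq> {..<B} \<and> (\<forall>j<c. certif F (dec (S y) j) (\<xi> (y j)))"
    unfolding choice_iff by blast
  then have S: "\<And>y. S y \<subseteq> {..<B}" "\<And>y j. j < c \<Longrightarrow> certif F (dec (S y) j) (\<xi> (y j))"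
    by auto
  define \<Lambda> where "\<Lambda> = PiE {..<c} (\<lambda>_. UNIV :: bool set)"
  \<comment> \<open>An outer input is an output bit, telling whether the sheet is filled, together
    with a label. The copies alone carry no information on the output, so the labels run over all of
    \<open>\<Lambda>\<close> on both sides.\<close>
  define L where "L = (\<lambda>b :: bool. {b} \<times> \<Lambda>)"
  define code where "code = (\<lambda>l :: nat \<Rightarrow> bool. map l [0..<c])"
  define \<Xi> where "\<Xi> = (\<lambda>(x :: (bool \<times> (nat \<Rightarrow> bool)) \<times> (nat \<Rightarrow> nat)) v. case v of
     Inl (j, v) \<Rightarrow> \<xi> (snd x j) v
   | Inr (l, i) \<Rightarrow> fst (fst x) \<and> l = code (snd (fst x)) \<and> (case i of 0 \<Rightarrow> True | Suc k \<Rightarrow> k \<in> S (snd x)))"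
  define N where "N = (\<lambda>_ :: nat. \<lambda>a b. G a b / A)"
  \<comment> \<open>All pairs of labels get the same weight; with \<open>2 ^ c\<close> rows and as
    many columns the norm is \<open>A\<close>.\<close>
  define M :: "bool \<times> (nat \<Rightarrow> bool) \<Rightarrow> bool \<times> (nat \<Rightarrow> bool) \<Rightarrow> real"
    where "M = (\<lambda>_ _. A / 2 ^ c)"
  define w' where "w' = (\<lambda>x :: (bool \<times> (nat \<Rightarrow> bool)) \<times> (nat \<Rightarrow> nat). 1 / sqrt (2 ^ c) * (\<Prod>p<c. w (snd x p)))"
  define Y where "Y = (\<lambda>b. Sigma (L b) tup)"
  have fin\<Lambda>: "finite \<Lambda>" and card\<Lambda>: "card \<Lambda> = 2 ^ c"
    unfolding \<Lambda>_def by (auto intro: finite_PiE simp: card_PiE)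
  have finL: "finite (L b)" for b using fin\<Lambda> by (simp add: L_def)
  have cardL: "card (L b) = 2 ^ c" for b using card\<Lambda> by (simp add: L_def card_cartesian_product)
  have wunit: "(\<Sum>y\<in>Y0 b. (w y)\<^sup>2) = 1" for b using F by (simp add: adversary_def)
  have Nbound: "opbound (Y0 False) (Y0 True) (N p) 1" for p
    using opbound_scale[of "Y0 False" "Y0 True" G A "1 / A"] F \<open>A > 0\<close>
    by (simp add: N_def adversary_def)
  have "(\<Sum>y\<in>Y0 False. \<Sum>z\<in>Y0 True. G y z / A * w y * w z) =
      (\<Sum>y\<in>Y0 False. \<Sum>z\<in>Y0 True. G y z * w y * w z) / A"
    by (simp add: sum_divide_distrib)
  then have Nval: "(\<Sum>y\<in>Y0 False. \<Sum>z\<in>Y0 True. G y z / A * w y * w z) = 1"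
    using F \<open>A > 0\<close> by (simp add: adversary_def)
  have Mbound: "opbound (L False) (L True) M A"
    using opbound_scale[OF opbound_all_ones[OF finL[of False] finL[of True]], where c = "A / 2 ^ c"] \<open>A > 0\<close>
    by (simp add: cardL M_def)
  have lab: "cs_label c F (\<Xi> ((b, l), y)) = code l" if "y \<in> tup (b, l)" for b l y
  proof -
    have "F (\<xi> (y j)) = l j" if "j < c" for j
      using adversary_label[OF F tupD[OF \<open>y \<in> tup (b, l)\<close>, of j]] that by simp
    then show ?thesis by (auto simp: cs_label_def \<Xi>_def code_def)
  qed
  have "adversary (cs_vars c B V) (cheat_sheet c B dec F) A Y \<Xi> (lifted M N) w'"
    unfolding adversary_def
  proof (intro conjI allI ballI)
    show "finite (Y b)" for b unfolding Y_def by (intro finite_SigmaI finL finite_tup)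
    show "cheat_sheet c B dec F (\<Xi> x) = b" if "x \<in> Y b" for x b
    proof -
      obtain s y where sy: "x = (s, y)" by (cases x)
      define l where "l = snd s"
      have "s = (b, l)" using that by (auto simp: sy Y_def L_def l_def)
      with sy have x: "x = ((b, l), y)" by simp
      have y: "y \<in> tup (b, l)" using that unfolding x Y_def by (rule SigmaD2)
      have cell: "cs_cell B (\<Xi> ((True, l), y)) (code l) = S y"
        using S(1)[of y] by (auto simp: cs_cell_def \<Xi>_def)
      show ?thesis
      proof (cases b)
        case True
        have "(\<lambda>v. \<Xi> ((True, l), y) (Inl (j, v))) = \<xi> (y j)" for j by (simp add: \<Xi>_def)
        moreover have "\<Xi> ((True, l), y) (Inr (code l, 0))" by (simp add: \<Xi>_def)
        ultimately show ?thesis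
          using True lab[OF y] S(2) by (simp add: cheat_sheet_def x cell)
      next
        case False
        then show ?thesis by (simp add: cheat_sheet_def Let_def x \<Xi>_def)
      qed
    qed
    show "(\<Sum>y\<in>Y b. (w' y)\<^sup>2) = 1" for b
      unfolding Y_def w'_def using lifted_unit[OF finL[of b] wunit, where u = "\<lambda>_. 1 / sqrt (2 ^ c)"]
      by (simp add: cardL power_divide)
    show "opbound (Y False) (Y True) (lifted M N) A"
      unfolding Y_def using \<open>A > 0\<close> by (intro opbound_lifted finL Nbound Mbound) auto
    have "(\<Sum>y\<in>Y False. \<Sum>z\<in>Y True. lifted M N y z * w' y * w' z) =
        (\<Sum>s\<in>L False. \<Sum>t\<in>L True. M s t * (1 / sqrt (2 ^ c)) * (1 / sqrt (2 ^ c)))"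
      using lifted_value[OF finL[of False] finL[of True] wunit Nval, where M = M and u = "\<lambda>_. 1 / sqrt (2 ^ c)"]
      unfolding Y_def w'_def N_def by (simp add: mult.assoc)
    also have "\<dots> = A" by (simp add: M_def cardL)
    finally show "(\<Sum>y\<in>Y False. \<Sum>z\<in>Y True. lifted M N y z * w' y * w' z) = A" .
    fix v assume "v \<in> cs_vars c B V"
    then consider j v' where "v = Inl (j, v')" "j < c" "v' \<in> V" | l i where "v = Inr (l, i)" "length l = c"
      by (auto simp: cs_vars_def)
    then show "opbound (Y False) (Y True) (\<lambda>y z. if \<Xi> y v \<noteq> \<Xi> z v then lifted M N y z else 0) 1"
    proof cases
      case 1
      \<comment> \<open>Restricting the nonnegative constant matrix to labels that differ at
        \<open>j\<close> keeps the bound \<open>A\<close>, and the gain \<open>1 / A\<close> of the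
        inner block brings it to 1.\<close>
      have "opbound (L False) (L True) (\<lambda>s t. if snd s j \<noteq> snd t j then M s t else 0) A"
        by (rule opbound_dominated[OF Mbound]) (use \<open>A > 0\<close> in \<open>auto simp: M_def\<close>)
      then have "opbound (Y False) (Y True)
         (\<lambda>y z. if \<xi> (snd y j) v' \<noteq> \<xi> (snd z j) v' then lifted M N y z else 0) (A / A)"
        unfolding Y_def N_def
        using F 1 \<open>A > 0\<close> by (intro opbound_lifted_query finL) (auto simp: adversary_def)
      then show ?thesis using \<open>A > 0\<close> by (simp add: \<Xi>_def 1)
    next
      case 2
      \<comment> \<open>A query to the cell \<open>l\<close> separates a blank sheet only from
        1-inputs with label \<open>l\<close>. They form a single column of \<open>M\<close>, of norm
        \<open>A / sqrt (2 ^ c)\<close>.\<close>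
      define J where "J = {t \<in> L True. code (snd t) = l}"
      have "t = t'" if "t \<in> J" "t' \<in> J" for t t'
      proof -
        have "snd t j = snd t' j" if "j < c" for j
        proof -
          have "code (snd t) ! j = code (snd t') ! j" using \<open>t \<in> J\<close> \<open>t' \<in> J\<close> by (simp add: J_def)
          then show ?thesis using that by (simp add: code_def)
        qed
        then have "snd t = snd t'"
          using that unfolding J_def L_def \<Lambda>_def by (intro PiE_ext[of _ "{..<c}" "\<lambda>_. UNIV"]) auto
        moreover have "fst t = fst t'" using that by (auto simp: J_def L_def)
        ultimately show ?thesis by (simp add: prod_eq_iff)
      qed
      then have "is_singleton J \<or> J = {}" by (metis is_singletonI' )
      then have "card J \<le> 1" by (auto simp: is_singleton_def)
      have "finite J" using finL by (simp add: J_def)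
      have "opbound (L False) J M 1"
      proof (rule opbound_mono)
        show "opbound (L False) J M (\<bar>A / 2 ^ c\<bar> * (sqrt (card (L False)) * sqrt (card J)))"
          using opbound_scale[OF opbound_all_ones[OF finL[of False] \<open>finite J\<close>], where c = "A / 2 ^ c"]
          by (simp add: M_def)
        have "A \<le> sqrt (2 ^ c)" using assms(3) by (rule real_le_rsqrt)
        then have "\<bar>A / 2 ^ c\<bar> * sqrt (2 ^ c) \<le> sqrt (2 ^ c) / 2 ^ c * sqrt (2 ^ c)"
          using \<open>A > 0\<close> by (intro mult_right_mono) (simp_all add: divide_right_mono)
        also have "\<dots> = 1" by simp
        finally have "\<bar>A / 2 ^ c\<bar> * sqrt (2 ^ c) \<le> 1" .
        moreover have "sqrt (card J) \<le> 1" using \<open>card J \<le> 1\<close> by simp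
        ultimately have "\<bar>A / 2 ^ c\<bar> * sqrt (2 ^ c) * sqrt (card J) \<le> 1 * 1"
          by (intro mult_mono) auto
        then show "\<bar>A / 2 ^ c\<bar> * (sqrt (card (L False)) * sqrt (card J)) \<le> 1"
          by (simp add: cardL mult.assoc)
      qed
      then have "opbound (L False) (L True) (\<lambda>s t. if t \<in> J then M s t else 0) 1"
        by (intro opbound_extend finL) (auto simp: J_def)
      then have "opbound (Y False) (Y True) (lifted (\<lambda>s t. if t \<in> J then M s t else 0) N) 1"
        unfolding Y_def by (intro opbound_lifted finL Nbound) auto
      \<comment> \<open>The mask removes the 1-inputs whose queried bit is off, because it then
        equals the blank bit.\<close>
      then have "opbound (Y False) (Y True) (\<lambda>y z. lifted (\<lambda>s t. if t \<in> J then M s t else 0) N y z *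
          (1 * (case i of 0 \<Rightarrow> 1 | Suc k \<Rightarrow> if k \<in> S (snd z) then 1 else 0))) 1"
        by (rule opbound_mask) (auto split: nat.split)
      moreover have "opbound (Y False) (Y True) (\<lambda>y z. if \<Xi> y v \<noteq> \<Xi> z v then lifted M N y z else 0) 1 \<longleftrightarrow>
          opbound (Y False) (Y True) (\<lambda>y z. lifted (\<lambda>s t. if t \<in> J then M s t else 0) N y z *
          (1 * (case i of 0 \<Rightarrow> 1 | Suc k \<Rightarrow> if k \<in> S (snd z) then 1 else 0))) 1"
        by (intro opbound_cong) (auto simp: Y_def L_def J_def lifted_def \<Xi>_def 2 split: nat.split)
      ultimately show ?thesis by blast
    qed
  qed
  then show ?thesis by (rule advI)
qed

section \<open>Quantum query algorithms\<close>

text \<open>Real and imaginary parts are taken as separate real coordinates, which reduces the claim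
  to \<open>opbound_vector\<close>.\<close>

lemma opbound_complex:
  fixes a :: "'i \<Rightarrow> 'k \<Rightarrow> complex" and b :: "'j \<Rightarrow> 'k \<Rightarrow> complex"
  assumes M: "opbound I J M \<mu>" and "\<mu> \<ge> 0"
  shows "\<bar>\<Sum>i\<in>I. \<Sum>j\<in>J. M i j * Re (\<Sum>k\<in>D. cnj (a i k) * b j k)\<bar> \<le>
    \<mu> * (sqrt (\<Sum>i\<in>I. \<Sum>k\<in>D. (cmod (a i k))\<^sup>2) * sqrt (\<Sum>j\<in>J. \<Sum>k\<in>D. (cmod (b j k))\<^sup>2))"
proof -
  define R where "R = (\<lambda>(c :: 'k \<Rightarrow> complex) p. if snd p then Im (c (fst p)) else Re (c (fst p)))"
  have pairs: "(\<Sum>p\<in>D \<times> UNIV. F p) = (\<Sum>k\<in>D. F (k, False) + F (k, True))" for F :: "'k \<times> bool \<Rightarrow> real"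
  proof -
    have "(\<Sum>p\<in>D \<times> UNIV. F p) = (\<Sum>k\<in>D. \<Sum>b\<in>UNIV. F (k, b))"
      by (simp add: sum.cartesian_product)
    then show ?thesis by (simp add: UNIV_bool)
  qed
  have 1: "Re (\<Sum>k\<in>D. cnj (a i k) * b j k) = (\<Sum>p\<in>D \<times> UNIV. R (a i) p * R (b j) p)" for i j
    by (simp add: pairs R_def)
  have 2: "(\<Sum>k\<in>D. (cmod (c k))\<^sup>2) = (\<Sum>p\<in>D \<times> UNIV. (R c p)\<^sup>2)" for c
    by (simp add: pairs R_def cmod_power2)
  show ?thesis
    unfolding 1 2 by (rule opbound_vector[OF assms])
qed

section \<open>The oracle as a permutation of basis states\<close>

definition flip :: "nat \<Rightarrow> nat \<Rightarrow> nat" where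
  "flip m r = (if even (r div m) then r div m + 1 else r div m - 1) * m + r mod m"

lemma flip_div: "m > 0 \<Longrightarrow> flip m r div m = (if even (r div m) then r div m + 1 else r div m - 1)"
  by (simp add: flip_def)

lemma flip_mod: "m > 0 \<Longrightarrow> flip m r mod m = r mod m"
  by (simp add: flip_def)

lemma query_index_flip: "m > 0 \<Longrightarrow> query_index m (flip m r) = query_index m r"
  by (auto simp: query_index_def flip_div elim!: evenE oddE)

lemma target_bit_flip: "m > 0 \<Longrightarrow> target_bit m (flip m r) \<longleftrightarrow> \<not> target_bit m r"
  by (auto simp: target_bit_def flip_div elim!: oddE)

lemma work_part_flip: "m > 0 \<Longrightarrow> work_part m (flip m r) = work_part m r"
  by (simp add: work_part_def flip_mod)

lemma basis_index_eqI:
  assumes "query_index m r = query_index m c" "target_bit m r = target_bit m c"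
    "work_part m r = work_part m c"
  shows "r = c"
proof -
  have "r div m = c div m"
    using assms(1,2) unfolding query_index_def target_bit_def
    by (metis bit_eq_rec odd_iff_mod_2_eq_one parity_cases div_mult_mod_eq)
  then show ?thesis using assms(3) unfolding work_part_def by (metis div_mult_mod_eq)
qed

lemma query_index_less_iff:
  assumes "m > 0"
  shows "query_index m r < N \<longleftrightarrow> r < 2 * N * m"
  using assms by (simp add: query_index_def div_less_iff_less_mult mult_ac)

definition oracle_perm :: "nat \<Rightarrow> bool list \<Rightarrow> nat \<Rightarrow> nat" where
  "oracle_perm m x r = (if x ! query_index m r then flip m r else r)"

lemma flip_flip: "m > 0 \<Longrightarrow> flip m (flip m r) = r"
  by (rule basis_index_eqI[where m = m]) (simp_all add: query_index_flip target_bit_flip work_part_flip)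

lemma oracle_perm_less: "m > 0 \<Longrightarrow> r < 2 * N * m \<Longrightarrow> oracle_perm m x r < 2 * N * m"
  by (simp add: oracle_perm_def query_index_flip flip: query_index_less_iff)

lemma oracle_perm_comp:
  assumes "m > 0"
  shows "oracle_perm m y (oracle_perm m x r) =
    (if x ! query_index m r = y ! query_index m r then r else flip m r)"
  using assms by (auto simp: oracle_perm_def query_index_flip flip_flip)

lemma oracle_mat_index:
  assumes "m > 0" "r < 2 * N * m" "c < 2 * N * m"
  shows "oracle_mat N m x $$ (r, c) = (if c = oracle_perm m x r then 1 else 0)"
proof -
  let ?s = "oracle_perm m x r"
  have s: "query_index m ?s = query_index m r" "work_part m ?s = work_part m r"
      "target_bit m ?s \<longleftrightarrow> (target_bit m r \<noteq> x ! query_index m r)"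
    using assms(1) by (simp_all add: oracle_perm_def query_index_flip work_part_flip target_bit_flip)
  have "(query_index m r = query_index m c \<and> target_bit m r = (target_bit m c \<noteq> x ! query_index m c) \<and>
      work_part m r = work_part m c) \<longleftrightarrow> c = ?s"
  proof
    assume h: "query_index m r = query_index m c \<and> target_bit m r = (target_bit m c \<noteq> x ! query_index m c) \<and>
      work_part m r = work_part m c"
    show "c = ?s"
    proof (rule basis_index_eqI)
      show "query_index m c = query_index m ?s" "work_part m c = work_part m ?s" using h s by simp_all
      show "target_bit m c = target_bit m ?s" using h s(3) by (cases "target_bit m c"; cases "x ! query_index m c") simp_all
    qed
  next
    assume "c = ?s"
    then show "query_index m r = query_index m c \<and> target_bit m r = (target_bit m c \<noteq> x ! query_index m c) \<and>
      work_part m r = work_part m c"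
      using s by (cases "target_bit m r"; cases "x ! query_index m r") simp_all
  qed
  then show ?thesis using assms by (simp add: oracle_mat_def)
qed

lemma oracle_mat_mult_index:
  assumes "m > 0" "v \<in> carrier_vec (2 * N * m)" "r < 2 * N * m"
  shows "(oracle_mat N m x *\<^sub>v v) $ r = v $ oracle_perm m x r"
proof -
  have "(oracle_mat N m x *\<^sub>v v) $ r = (\<Sum>c<2 * N * m. oracle_mat N m x $$ (r, c) * v $ c)"
    using assms by (simp add: oracle_mat_def scalar_prod_def lessThan_atLeast0)
  also have "\<dots> = (\<Sum>c<2 * N * m. if c = oracle_perm m x r then v $ c else 0)"
    using assms by (intro sum.cong refl) (simp add: oracle_mat_index)
  also have "\<dots> = v $ oracle_perm m x r"
    using assms oracle_perm_less by simp
  finally show ?thesis .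
qed

definition ip :: "nat \<Rightarrow> complex vec \<Rightarrow> complex vec \<Rightarrow> complex" where
  "ip d v w = (\<Sum>k<d. cnj (v $ k) * w $ k)"

lemma mat_adjoint_index:
  fixes A :: "complex mat"
  assumes "A \<in> carrier_mat d d" "i < d" "j < d"
  shows "mat_adjoint A $$ (i, j) = cnj (A $$ (j, i))"
  using assms by (simp add: mat_adjoint_def mat_of_rows_def conjugate_complex_def)

lemma ip_unitary:
  assumes U: "unitary_mat d U" and v: "v \<in> carrier_vec d" "w \<in> carrier_vec d"
  shows "ip d (U *\<^sub>v v) (U *\<^sub>v w) = ip d v w"
proof -
  have dim: "U \<in> carrier_mat d d" using U by (simp add: unitary_mat_def)
  have adim: "mat_adjoint U \<in> carrier_mat d d" using dim by (auto simp: mat_adjoint_def mat_of_rows_def)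
  have mv: "(U *\<^sub>v v) $ k = (\<Sum>i<d. U $$ (k, i) * v $ i)" if "k < d" "v \<in> carrier_vec d" for k v
    using that dim by (simp add: scalar_prod_def lessThan_atLeast0)
  have orth: "(\<Sum>k<d. cnj (U $$ (k, i)) * U $$ (k, j)) = (if i = j then 1 else 0)" if "i < d" "j < d" for i j
  proof -
    have "(mat_adjoint U * U) $$ (i, j) = (\<Sum>k<d. cnj (U $$ (k, i)) * U $$ (k, j))"
      using that dim adim by (simp add: scalar_prod_def lessThan_atLeast0 mat_adjoint_index[OF dim])
    then show ?thesis using U that by (simp add: unitary_mat_def)
  qed
  have "ip d (U *\<^sub>v v) (U *\<^sub>v w) =
      (\<Sum>k<d. \<Sum>i<d. \<Sum>j<d. cnj (v $ i) * w $ j * (cnj (U $$ (k, i)) * U $$ (k, j)))"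
    unfolding ip_def
  proof (intro sum.cong refl)
    fix k assume "k \<in> {..<d}"
    then have "cnj ((U *\<^sub>v v) $ k) * (U *\<^sub>v w) $ k =
        (\<Sum>i<d. cnj (U $$ (k, i) * v $ i)) * (\<Sum>j<d. U $$ (k, j) * w $ j)"
      using v by (simp add: mv)
    also have "\<dots> = (\<Sum>i<d. \<Sum>j<d. cnj (v $ i) * w $ j * (cnj (U $$ (k, i)) * U $$ (k, j)))"
      unfolding sum_product by (intro sum.cong refl) simp
    finally show "cnj ((U *\<^sub>v v) $ k) * (U *\<^sub>v w) $ k =
        (\<Sum>i<d. \<Sum>j<d. cnj (v $ i) * w $ j * (cnj (U $$ (k, i)) * U $$ (k, j)))" .
  qed
  also have "\<dots> = (\<Sum>i<d. \<Sum>k<d. \<Sum>j<d. cnj (v $ i) * w $ j * (cnj (U $$ (k, i)) * U $$ (k, j)))"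
    by (rule sum.swap)
  also have "\<dots> = (\<Sum>i<d. \<Sum>j<d. \<Sum>k<d. cnj (v $ i) * w $ j * (cnj (U $$ (k, i)) * U $$ (k, j)))"
    by (intro sum.cong refl sum.swap)
  also have "\<dots> = (\<Sum>i<d. \<Sum>j<d. if j = i then cnj (v $ i) * w $ j else 0)"
    by (intro sum.cong refl) (simp add: sum_distrib_left[symmetric] orth)
  finally show ?thesis by (simp add: ip_def)
qed

lemma query_state_carrier:
  assumes "\<And>s. s \<le> t \<Longrightarrow> unitary_mat (2 * N * m) (U s)"
  shows "query_state N m U x t \<in> carrier_vec (2 * N * m)"
  using assms
proof (induction t)
  case 0
  then show ?case by (auto simp: unitary_mat_def intro!: mult_mat_vec_carrier)
next
  case (Suc t)
  have "oracle_mat N m x \<in> carrier_mat (2 * N * m) (2 * N * m)" by (simp add: oracle_mat_def)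
  moreover have "U (Suc t) \<in> carrier_mat (2 * N * m) (2 * N * m)"
    using Suc.prems[of "Suc t"] by (simp add: unitary_mat_def)
  moreover have "query_state N m U x t \<in> carrier_vec (2 * N * m)" using Suc by simp
  ultimately show ?case unfolding query_state.simps by (meson mult_mat_vec_carrier)
qed

text \<open>The oracle is an involution, so reindexing moves the one for \<open>x\<close> to the
  other side; the product of both oracles flips the target exactly where the queried bits of
  \<open>x\<close> and \<open>y\<close> differ.\<close>

lemma ip_oracle:
  assumes "m > 0" "v \<in> carrier_vec (2 * N * m)" "w \<in> carrier_vec (2 * N * m)"
  shows "ip (2 * N * m) (oracle_mat N m x *\<^sub>v v) (oracle_mat N m y *\<^sub>v w) - ip (2 * N * m) v w =
    (\<Sum>i<N. if x ! i \<noteq> y ! i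
       then \<Sum>r | r < 2 * N * m \<and> query_index m r = i. cnj (v $ r) * (w $ flip m r - w $ r) else 0)"
proof -
  let ?d = "2 * N * m"
  let ?q = "query_index m"
  have "ip ?d (oracle_mat N m x *\<^sub>v v) (oracle_mat N m y *\<^sub>v w) =
     (\<Sum>r<?d. cnj (v $ oracle_perm m x r) * w $ oracle_perm m y r)"
    unfolding ip_def using assms by (intro sum.cong refl) (simp add: oracle_mat_mult_index)
  also have "\<dots> = (\<Sum>r<?d. cnj (v $ r) * w $ oracle_perm m y (oracle_perm m x r))"
    by (rule sum.reindex_bij_witness[of _ "oracle_perm m x" "oracle_perm m x"])
      (use assms(1) in \<open>auto simp: oracle_perm_comp oracle_perm_less\<close>)
  also have "\<dots> - ip ?d v w = (\<Sum>r<?d. if x ! ?q r \<noteq> y ! ?q r then cnj (v $ r) * (w $ flip m r - w $ r) else 0)"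
    unfolding ip_def sum_subtractf[symmetric] using assms(1)
    by (intro sum.cong refl) (simp add: oracle_perm_comp algebra_simps)
  also have "\<dots> = (\<Sum>i<N. \<Sum>r | r \<in> {..<?d} \<and> ?q r = i. if x ! ?q r \<noteq> y ! ?q r then cnj (v $ r) * (w $ flip m r - w $ r) else 0)"
    by (rule sum.group[symmetric]) (use assms(1) in \<open>auto simp: query_index_less_iff\<close>)
  also have "\<dots> = (\<Sum>i<N. if x ! i \<noteq> y ! i
       then \<Sum>r | r < ?d \<and> ?q r = i. cnj (v $ r) * (w $ flip m r - w $ r) else 0)"
    by (intro sum.cong refl) (auto intro!: sum.cong sum.neutral)
  finally show ?thesis .
qed

text \<open>The progress \<open>W\<close>, a weighted sum of overlaps, starts at \<open>A\<close>,
  changes by at most 2 per query and ends at most at \<open>17 / 18 * A\<close>; hence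
  \<open>A / 18 \<le> 2 * T\<close>. As entries of \<open>G\<close> may be negative, overlaps are
  never estimated one by one, but always through bilinear bounds on all pairs together.\<close>

theorem adversary_bound:
  fixes Y :: "bool \<Rightarrow> 'i set"
  assumes comp: "quantum_computes N f T"
    and fin: "\<And>b. finite (Y b)"
    and lab: "\<And>b y. y \<in> Y b \<Longrightarrow> \<xi> y \<in> cube N \<and> f (\<xi> y) = b"
    and unit: "\<And>b. (\<Sum>y\<in>Y b. (w y)\<^sup>2) = 1"
    and G: "opbound (Y False) (Y True) G A" and "A \<ge> 0"
    and val: "(\<Sum>y\<in>Y False. \<Sum>z\<in>Y True. G y z * w y * w z) = A"
    and Gi: "\<And>i. i < N \<Longrightarrow> opbound (Y False) (Y True) (\<lambda>y z. if \<xi> y ! i \<noteq> \<xi> z ! i then G y z else 0) 1"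
  shows "A \<le> 36 * real T"
proof -
  obtain m U out where "m > 0" and U: "\<And>t. t \<le> T \<Longrightarrow> unitary_mat (2 * N * m) (U t)"
    and out: "\<And>x. x \<in> cube N \<Longrightarrow> output_prob N m U out T x (f x) \<ge> 2 / 3"
    using comp unfolding quantum_computes_def by blast
  define d where "d = 2 * N * m"
  define \<psi> where "\<psi> = (\<lambda>y t. query_state N m U (\<xi> y) t)"
  have dim: "\<psi> y t \<in> carrier_vec d" if "t \<le> T" for y t
    unfolding \<psi>_def d_def using that by (intro query_state_carrier U) simp
  \<comment> \<open>For \<open>N = 0\<close> the state has dimension 0 and every output probability
    is an empty sum, so nothing can be computed.\<close>
  have "N > 0"
  proof (rule ccontr)
    assume "\<not> N > 0"
    then have "output_prob N m U out T [] (f []) = 0" "[] \<in> cube N"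
      by (simp_all add: output_prob_def cube_def)
    then show False using out[of "[]"] by simp
  qed
  then have "d > 0" using \<open>m > 0\<close> by (simp add: d_def)
  have odim: "oracle_mat N m x *\<^sub>v v \<in> carrier_vec d" if "v \<in> carrier_vec d" for x v
    by (rule mult_mat_vec_carrier[OF _ that]) (simp add: d_def oracle_mat_def)
  have step: "ip d (\<psi> y (Suc t)) (\<psi> z (Suc t)) = ip d (oracle_mat N m (\<xi> y) *\<^sub>v \<psi> y t) (oracle_mat N m (\<xi> z) *\<^sub>v \<psi> z t)"
    if "Suc t \<le> T" for y z t
    unfolding \<psi>_def query_state.simps
    by (rule ip_unitary) (use U[OF that] dim[of t] odim that in \<open>auto simp: d_def \<psi>_def\<close>)
  have norm: "ip d (\<psi> y t) (\<psi> y t) = 1" if "t \<le> T" for y t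
    using that
  proof (induction t)
    case 0
    have "ip d (\<psi> y 0) (\<psi> y 0) = ip d (unit_vec d 0) (unit_vec d 0)"
      unfolding \<psi>_def query_state.simps d_def[symmetric]
      by (rule ip_unitary) (use U[of 0] in \<open>auto simp: d_def\<close>)
    also have "\<dots> = (\<Sum>k<d. if k = 0 then 1 else 0)"
      unfolding ip_def by (intro sum.cong refl) (auto simp: unit_vec_def)
    finally show ?case using \<open>d > 0\<close> by simp
  next
    case (Suc t)
    have "ip d (\<psi> y (Suc t)) (\<psi> y (Suc t)) - ip d (\<psi> y t) (\<psi> y t) = 0"
      unfolding step[OF Suc.prems] unfolding d_def
      by (subst ip_oracle) (use dim[of t] Suc.prems \<open>m > 0\<close> in \<open>auto simp: d_def\<close>)
    then show ?case using Suc by simp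
  qed
  have norm2: "(\<Sum>k<d. (cmod (\<psi> y t $ k))\<^sup>2) = 1" if "t \<le> T" for y t
  proof -
    have "complex_of_real (\<Sum>k<d. (cmod (\<psi> y t $ k))\<^sup>2) = ip d (\<psi> y t) (\<psi> y t)"
      unfolding ip_def of_real_sum by (intro sum.cong refl) (subst complex_norm_square, rule mult.commute)
    then show ?thesis unfolding norm[OF that] by (simp only: of_real_eq_1_iff)
  qed
  define W where "W = (\<lambda>t. \<Sum>y\<in>Y False. \<Sum>z\<in>Y True. G y z * w y * w z * Re (ip d (\<psi> y t) (\<psi> z t)))"
  have W0: "W 0 = A"
  proof -
    have "\<psi> y 0 = \<psi> z 0" for y z by (simp add: \<psi>_def)
    then have "ip d (\<psi> y 0) (\<psi> z 0) = ip d (\<psi> z 0) (\<psi> z 0)" for y z by metis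
    then have "ip d (\<psi> y 0) (\<psi> z 0) = 1" for y z by (rule trans[OF _ norm[OF le0]])
    then show ?thesis by (simp add: W_def val)
  qed
  \<comment> \<open>The weights \<open>w\<close> are moved into the states, the form in which
    \<open>opbound_complex\<close> applies.\<close>
  have scal: "G y z * w y * w z * Re (\<Sum>k\<in>K. cnj (a k) * b k) =
      G y z * Re (\<Sum>k\<in>K. cnj (complex_of_real (w y) * a k) * (complex_of_real (w z) * b k))" for y z a b and K :: "nat set"
  proof -
    have "(\<Sum>k\<in>K. cnj (complex_of_real (w y) * a k) * (complex_of_real (w z) * b k)) =
        complex_of_real (w y * w z) * (\<Sum>k\<in>K. cnj (a k) * b k)"
      by (simp add: sum_distrib_left mult_ac)
    then show ?thesis by simp
  qed
  have Re_if: "c * Re (if b then s else 0) = (if b then c * Re s else 0)" for c b s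
    by simp
  have Wstep: "\<bar>W (Suc t) - W t\<bar> \<le> 2" if "Suc t \<le> T" for t
  proof -
    define B where "B = (\<lambda>i. {r. r < d \<and> query_index m r = i})"
    \<comment> \<open>\<open>\<alpha> i\<close> and \<open>\<beta> i\<close> are the total weights
      with which the two sides query \<open>i\<close>; by \<open>total\<close> each family sums to
      1.\<close>
    define \<alpha> where "\<alpha> = (\<lambda>i. \<Sum>y\<in>Y False. \<Sum>r\<in>B i. (cmod (complex_of_real (w y) * \<psi> y t $ r))\<^sup>2)"
    define \<beta> where "\<beta> = (\<lambda>i. \<Sum>z\<in>Y True. \<Sum>r\<in>B i. (cmod (complex_of_real (w z) * \<psi> z t $ r))\<^sup>2)"
    have Bsum: "(\<Sum>i<N. \<Sum>r\<in>B i. g r) = (\<Sum>r<d. g r)" for g :: "nat \<Rightarrow> real"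
    proof -
      have "(\<Sum>i<N. \<Sum>r | r \<in> {..<d} \<and> query_index m r = i. g r) = (\<Sum>r<d. g r)"
        by (rule sum.group) (use \<open>m > 0\<close> in \<open>auto simp: query_index_less_iff d_def\<close>)
      then show ?thesis by (simp add: B_def)
    qed
    have total: "(\<Sum>i<N. \<Sum>y\<in>Y b. \<Sum>r\<in>B i. (cmod (complex_of_real (w y) * \<psi> y t $ r))\<^sup>2) = 1" for b
    proof -
      have "(\<Sum>i<N. \<Sum>y\<in>Y b. \<Sum>r\<in>B i. (cmod (complex_of_real (w y) * \<psi> y t $ r))\<^sup>2) =
          (\<Sum>y\<in>Y b. \<Sum>i<N. \<Sum>r\<in>B i. (cmod (complex_of_real (w y) * \<psi> y t $ r))\<^sup>2)"
        by (rule sum.swap)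
      also have "\<dots> = (\<Sum>y\<in>Y b. (w y)\<^sup>2 * (\<Sum>r<d. (cmod (\<psi> y t $ r))\<^sup>2))"
        by (simp add: Bsum norm_mult power_mult_distrib sum_distrib_left)
      finally show ?thesis using norm2[of t] that by (simp add: unit)
    qed
    have diff: "W (Suc t) - W t = (\<Sum>i<N. \<Sum>y\<in>Y False. \<Sum>z\<in>Y True.
       (if \<xi> y ! i \<noteq> \<xi> z ! i then G y z else 0) *
       Re (\<Sum>r\<in>B i. cnj (complex_of_real (w y) * \<psi> y t $ r) *
         (complex_of_real (w z) * (\<psi> z t $ flip m r - \<psi> z t $ r))))"
    proof -
      have "G y z * w y * w z * Re (ip d (\<psi> y (Suc t)) (\<psi> z (Suc t))) - G y z * w y * w z * Re (ip d (\<psi> y t) (\<psi> z t)) =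
         (\<Sum>i<N. (if \<xi> y ! i \<noteq> \<xi> z ! i then G y z else 0) *
       Re (\<Sum>r\<in>B i. cnj (complex_of_real (w y) * \<psi> y t $ r) *
         (complex_of_real (w z) * (\<psi> z t $ flip m r - \<psi> z t $ r))))" for y z
      proof -
        have "G y z * w y * w z * Re (ip d (\<psi> y (Suc t)) (\<psi> z (Suc t))) - G y z * w y * w z * Re (ip d (\<psi> y t) (\<psi> z t)) =
           G y z * w y * w z * Re (ip d (\<psi> y (Suc t)) (\<psi> z (Suc t)) - ip d (\<psi> y t) (\<psi> z t))"
          by (simp add: right_diff_distrib)
        also have "ip d (\<psi> y (Suc t)) (\<psi> z (Suc t)) - ip d (\<psi> y t) (\<psi> z t) =
          (\<Sum>i<N. if \<xi> y ! i \<noteq> \<xi> z ! i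
             then \<Sum>r\<in>B i. cnj (\<psi> y t $ r) * (\<psi> z t $ flip m r - \<psi> z t $ r) else 0)"
          unfolding step[OF that] B_def unfolding d_def
          by (subst ip_oracle) (use dim[of t] that \<open>m > 0\<close> in \<open>auto simp: d_def\<close>)
        also have "G y z * w y * w z * Re \<dots> =
          (\<Sum>i<N. if \<xi> y ! i \<noteq> \<xi> z ! i
             then G y z * w y * w z * Re (\<Sum>r\<in>B i. cnj (\<psi> y t $ r) * (\<psi> z t $ flip m r - \<psi> z t $ r)) else 0)"
          by (subst Re_sum, subst sum_distrib_left, intro sum.cong refl, rule Re_if)
        also have "\<dots> = (\<Sum>i<N. (if \<xi> y ! i \<noteq> \<xi> z ! i then G y z else 0) *
       Re (\<Sum>r\<in>B i. cnj (complex_of_real (w y) * \<psi> y t $ r) *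
         (complex_of_real (w z) * (\<psi> z t $ flip m r - \<psi> z t $ r))))"
          unfolding scal by (intro sum.cong refl) auto
        finally show ?thesis .
      qed
      then have "W (Suc t) - W t = (\<Sum>y\<in>Y False. \<Sum>z\<in>Y True. \<Sum>i<N. (if \<xi> y ! i \<noteq> \<xi> z ! i then G y z else 0) *
       Re (\<Sum>r\<in>B i. cnj (complex_of_real (w y) * \<psi> y t $ r) *
         (complex_of_real (w z) * (\<psi> z t $ flip m r - \<psi> z t $ r))))"
        unfolding W_def sum_subtractf[symmetric] by simp
      also have "\<dots> = (\<Sum>y\<in>Y False. \<Sum>i<N. \<Sum>z\<in>Y True. (if \<xi> y ! i \<noteq> \<xi> z ! i then G y z else 0) *
       Re (\<Sum>r\<in>B i. cnj (complex_of_real (w y) * \<psi> y t $ r) *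
         (complex_of_real (w z) * (\<psi> z t $ flip m r - \<psi> z t $ r))))"
        by (intro sum.cong refl sum.swap)
      finally show ?thesis by (subst sum.swap)
    qed
    \<comment> \<open>A vector minus its flip has at most twice the norm, since \<open>flip\<close>
      permutes the indices of the block. The 2 in \<open>Wstep\<close> is this factor.\<close>
    have shift: "(\<Sum>z\<in>Y True. \<Sum>r\<in>B i. (cmod (complex_of_real (w z) * (\<psi> z t $ flip m r - \<psi> z t $ r)))\<^sup>2) \<le> 4 * \<beta> i" for i
    proof -
      have flipB: "(\<Sum>r\<in>B i. g (flip m r)) = (\<Sum>r\<in>B i. g r)" for g :: "nat \<Rightarrow> real"
        by (rule sum.reindex_bij_witness[of _ "flip m" "flip m"])
          (use \<open>m > 0\<close> in \<open>auto simp: B_def d_def flip_flip query_index_flip simp flip: query_index_less_iff\<close>)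
      have par: "(cmod (c * (a - b)))\<^sup>2 \<le> 2 * (cmod (c * a))\<^sup>2 + 2 * (cmod (c * b))\<^sup>2" for a b c
      proof -
        have "cmod (c * a - c * b) \<le> cmod (c * a) + cmod (c * b)" by (rule norm_triangle_ineq4)
        then have "(cmod (c * a - c * b))\<^sup>2 \<le> (cmod (c * a) + cmod (c * b))\<^sup>2" by (intro power_mono) auto
        also have "\<dots> \<le> 2 * (cmod (c * a))\<^sup>2 + 2 * (cmod (c * b))\<^sup>2"
          using sum_squares_bound[of "cmod (c * a)" "cmod (c * b)"] by (simp add: power2_sum)
        finally show ?thesis by (simp add: right_diff_distrib)
      qed
      have "(\<Sum>r\<in>B i. (cmod (complex_of_real (w z) * (\<psi> z t $ flip m r - \<psi> z t $ r)))\<^sup>2) \<le>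
          4 * (\<Sum>r\<in>B i. (cmod (complex_of_real (w z) * \<psi> z t $ r))\<^sup>2)" for z
      proof -
        have "(\<Sum>r\<in>B i. (cmod (complex_of_real (w z) * (\<psi> z t $ flip m r - \<psi> z t $ r)))\<^sup>2) \<le>
            (\<Sum>r\<in>B i. 2 * (cmod (complex_of_real (w z) * \<psi> z t $ flip m r))\<^sup>2 +
               2 * (cmod (complex_of_real (w z) * \<psi> z t $ r))\<^sup>2)"
          by (intro sum_mono par)
        also have "\<dots> = 2 * (\<Sum>r\<in>B i. (cmod (complex_of_real (w z) * \<psi> z t $ flip m r))\<^sup>2) +
            2 * (\<Sum>r\<in>B i. (cmod (complex_of_real (w z) * \<psi> z t $ r))\<^sup>2)"
          by (simp add: sum.distrib sum_distrib_left)
        finally show ?thesis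
          unfolding flipB[of "\<lambda>r. (cmod (complex_of_real (w z) * \<psi> z t $ r))\<^sup>2"] by simp
      qed
      then have "(\<Sum>z\<in>Y True. \<Sum>r\<in>B i. (cmod (complex_of_real (w z) * (\<psi> z t $ flip m r - \<psi> z t $ r)))\<^sup>2) \<le>
          (\<Sum>z\<in>Y True. 4 * (\<Sum>r\<in>B i. (cmod (complex_of_real (w z) * \<psi> z t $ r))\<^sup>2))"
        by (rule sum_mono)
      also have "\<dots> = 4 * \<beta> i" by (simp only: \<beta>_def sum_distrib_left)
      finally show ?thesis .
    qed
    have nonneg: "\<alpha> i \<ge> 0" "\<beta> i \<ge> 0" for i by (simp_all add: \<alpha>_def \<beta>_def sum_nonneg)
    have "\<bar>W (Suc t) - W t\<bar> \<le> (\<Sum>i<N. 1 * (sqrt (\<alpha> i) * sqrt (4 * \<beta> i)))"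
      unfolding diff
    proof (rule order_trans[OF sum_abs], rule sum_mono)
      fix i assume "i \<in> {..<N}"
      then have "\<bar>\<Sum>y\<in>Y False. \<Sum>z\<in>Y True. (if \<xi> y ! i \<noteq> \<xi> z ! i then G y z else 0) *
         Re (\<Sum>r\<in>B i. cnj (complex_of_real (w y) * \<psi> y t $ r) *
           (complex_of_real (w z) * (\<psi> z t $ flip m r - \<psi> z t $ r)))\<bar> \<le>
         1 * (sqrt (\<alpha> i) * sqrt (\<Sum>z\<in>Y True. \<Sum>r\<in>B i. (cmod (complex_of_real (w z) * (\<psi> z t $ flip m r - \<psi> z t $ r)))\<^sup>2))"
        unfolding \<alpha>_def by (intro opbound_complex Gi) auto
      also have "\<dots> \<le> 1 * (sqrt (\<alpha> i) * sqrt (4 * \<beta> i))"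
        using shift nonneg by (intro mult_left_mono real_sqrt_le_mono) auto
      finally show "\<bar>\<Sum>y\<in>Y False. \<Sum>z\<in>Y True. (if \<xi> y ! i \<noteq> \<xi> z ! i then G y z else 0) *
         Re (\<Sum>r\<in>B i. cnj (complex_of_real (w y) * \<psi> y t $ r) *
           (complex_of_real (w z) * (\<psi> z t $ flip m r - \<psi> z t $ r)))\<bar> \<le> 1 * (sqrt (\<alpha> i) * sqrt (4 * \<beta> i))" .
    qed
    also have "\<dots> = 2 * (\<Sum>i<N. \<bar>sqrt (\<alpha> i)\<bar> * \<bar>sqrt (\<beta> i)\<bar>)"
      using nonneg by (simp add: real_sqrt_mult sum_distrib_left mult_ac)
    also have "\<dots> \<le> 2 * (L2_set (\<lambda>i. sqrt (\<alpha> i)) {..<N} * L2_set (\<lambda>i. sqrt (\<beta> i)) {..<N})"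
      by (intro mult_left_mono L2_set_mult_ineq) simp
    also have "L2_set (\<lambda>i. sqrt (\<alpha> i)) {..<N} = 1"
      using total[of False] by (simp add: L2_set_def nonneg) (simp add: \<alpha>_def)
    also have "L2_set (\<lambda>i. sqrt (\<beta> i)) {..<N} = 1"
      using total[of True] by (simp add: L2_set_def nonneg) (simp add: \<beta>_def)
    finally show ?thesis by simp
  qed
  have "W t \<ge> A - 2 * t" if "t \<le> T" for t
    using that
  proof (induction t)
    case (Suc t)
    then show ?case using Wstep[of t] by (simp add: abs_le_iff)
  qed (simp add: W0)
  then have lower: "W T \<ge> A - 2 * T" by simp
  \<comment> \<open>\<open>P b c\<close> is the probability of output \<open>c\<close> on the side
    \<open>b\<close>, averaged with the squares of \<open>w\<close> as weights.\<close>
  define P where "P = (\<lambda>b c. \<Sum>y\<in>Y b. \<Sum>k | k < d \<and> out k = c. (cmod (complex_of_real (w y) * \<psi> y T $ k))\<^sup>2)"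
  have split: "(\<Sum>k<d. g k) = (\<Sum>k | k < d \<and> out k = False. g k) + (\<Sum>k | k < d \<and> out k = True. g k)"
    for g :: "nat \<Rightarrow> 'c :: comm_monoid_add"
  proof -
    have "{..<d} = {k. k < d \<and> out k = False} \<union> {k. k < d \<and> out k = True}" by auto
    then have "(\<Sum>k<d. g k) = (\<Sum>k\<in>{k. k < d \<and> out k = False} \<union> {k. k < d \<and> out k = True}. g k)"
      by simp
    also have "\<dots> = (\<Sum>k | k < d \<and> out k = False. g k) + (\<Sum>k | k < d \<and> out k = True. g k)"
      by (rule sum.union_disjoint) auto
    finally show ?thesis .
  qed
  have Psum: "P b False + P b True = 1" for b
  proof -
    have "P b False + P b True = (\<Sum>y\<in>Y b. \<Sum>k<d. (cmod (complex_of_real (w y) * \<psi> y T $ k))\<^sup>2)"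
      unfolding P_def split by (simp add: sum.distrib)
    also have "\<dots> = (\<Sum>y\<in>Y b. (w y)\<^sup>2 * (\<Sum>k<d. (cmod (\<psi> y T $ k))\<^sup>2))"
      by (simp add: norm_mult power_mult_distrib sum_distrib_left)
    finally show ?thesis using norm2[of T] by (simp add: unit)
  qed
  have Pge: "P b b \<ge> 2 / 3" for b
  proof -
    have "P b b = (\<Sum>y\<in>Y b. (w y)\<^sup>2 * output_prob N m U out T (\<xi> y) b)"
      unfolding P_def output_prob_def d_def \<psi>_def
      by (simp add: norm_mult power_mult_distrib sum_distrib_left)
    also have "\<dots> \<ge> (\<Sum>y\<in>Y b. (w y)\<^sup>2 * (2 / 3))"
      using out lab by (intro sum_mono mult_left_mono) auto
    also have "(\<Sum>y\<in>Y b. (w y)\<^sup>2 * (2 / 3)) = 2 / 3"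
      unfolding sum_distrib_right[symmetric] unit by simp
    finally show ?thesis .
  qed
  have Pnn: "P b c \<ge> 0" for b c by (simp add: P_def sum_nonneg)
  have part: "\<bar>\<Sum>y\<in>Y False. \<Sum>z\<in>Y True. G y z *
      Re (\<Sum>k | k < d \<and> out k = c. cnj (complex_of_real (w y) * \<psi> y T $ k) * (complex_of_real (w z) * \<psi> z T $ k))\<bar> \<le>
      A * (sqrt (P False c) * sqrt (P True c))" for c
    unfolding P_def by (rule opbound_complex[OF G \<open>A \<ge> 0\<close>])
  define S where "S = (\<lambda>c y z. \<Sum>k | k < d \<and> out k = c.
      cnj (complex_of_real (w y) * \<psi> y T $ k) * (complex_of_real (w z) * \<psi> z T $ k))"
  have "W T = (\<Sum>y\<in>Y False. \<Sum>z\<in>Y True. G y z * Re (S False y z) + G y z * Re (S True y z))"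
    unfolding W_def ip_def scal unfolding split S_def by (simp only: plus_complex.sel distrib_left)
  also have "\<dots> = (\<Sum>y\<in>Y False. \<Sum>z\<in>Y True. G y z * Re (S False y z)) +
      (\<Sum>y\<in>Y False. \<Sum>z\<in>Y True. G y z * Re (S True y z))"
    by (simp only: sum.distrib)
  also have "\<dots> \<le> A * (sqrt (P False False) * sqrt (P True False)) + A * (sqrt (P False True) * sqrt (P True True))"
    using part[of False] part[of True] unfolding S_def by linarith
  also have "\<dots> = A * (sqrt (P False False) * sqrt (P True False) + sqrt (P True True) * sqrt (P False True))"
    by (simp add: distrib_left mult_ac)
  also have "\<dots> \<le> A * (17 / 18)"
  proof (rule mult_left_mono[OF _ \<open>A \<ge> 0\<close>])
    \<comment> \<open>A weighted arithmetic-geometric mean. In the extreme case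
      \<open>a = 2 / 3\<close> and \<open>b = 1 / 3\<close> the optimal ratio of the roots is
      \<open>sqrt 2\<close>; the rational 3/2 in its place leads to \<open>17 / 18\<close>, just
      above the exact value \<open>2 * sqrt 2 / 3\<close>.\<close>
    have am: "sqrt a * sqrt b \<le> a / 3 + 3 * b / 4" if "a \<ge> 0" "b \<ge> 0" for a b
    proof -
      have "0 \<le> (2 * sqrt a - 3 * sqrt b)\<^sup>2" by simp
      also have "\<dots> = 4 * a + 9 * b - 12 * (sqrt a * sqrt b)"
        using that by (simp add: power2_diff power_mult_distrib)
      finally show ?thesis by simp
    qed
    have "sqrt (P False False) * sqrt (P True False) + sqrt (P True True) * sqrt (P False True) \<le>
       (P False False / 3 + 3 * P True False / 4) + (P True True / 3 + 3 * P False True / 4)"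
      by (intro add_mono am Pnn)
    also have "\<dots> \<le> 17 / 18"
      using Psum[of False] Psum[of True] Pge[of False] Pge[of True] by linarith
    finally show "sqrt (P False False) * sqrt (P True False) + sqrt (P True True) * sqrt (P False True) \<le> 17 / 18" .
  qed
  finally show ?thesis using lower by simp
qed

section \<open>An adversary bound for k-SUM with dual-rail encoding\<close>

definition sg :: "'a set \<Rightarrow> 'a set \<Rightarrow> real" where
  "sg a x = (\<Prod>e\<in>a. if e \<in> x then -1 else 1)"

lemma sg_eq_card: "finite a \<Longrightarrow> sg a x = (-1) ^ card (a \<inter> x)"
  by (simp add: sg_def prod.If_cases Int_def)

lemma sg_commute: "finite a \<Longrightarrow> finite x \<Longrightarrow> sg a x = sg x a"
  by (simp add: sg_eq_card Int_commute)

lemma sg_empty [simp]: "sg {} x = 1"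
  by (simp add: sg_def)

lemma sg_union:
  assumes "finite a" "finite b" "a \<inter> b = {}"
  shows "sg (a \<union> b) x = sg a x * sg b x"
  unfolding sg_def using assms by (rule prod.union_disjoint)

text \<open>The sum over subsets expands a product over \<open>W\<close>, in which each bit that
  separates \<open>x\<close> from \<open>y\<close> gives the factor \<open>1 - 1\<close>.\<close>

lemma sg_orthogonal:
  assumes "finite W"
  shows "(\<Sum>a\<in>Pow W. sg a x * sg a y) = (if x \<inter> W = y \<inter> W then 2 ^ card W else 0)"
proof -
  define g where "g = (\<lambda>e. (if e \<in> x then -1 else 1) * (if e \<in> y then -1 else 1 :: real))"
  have "(\<Sum>a\<in>Pow W. sg a x * sg a y) = (\<Sum>a\<in>Pow W. (\<Prod>e\<in>a. g e) * (\<Prod>e\<in>W - a. 1))"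
    by (simp add: sg_def g_def prod.distrib)
  also have "\<dots> = (\<Prod>e\<in>W. g e + 1)"
    by (rule prod_add[OF assms, symmetric])
  also have "\<dots> = (if x \<inter> W = y \<inter> W then 2 ^ card W else 0)"
  proof (cases "x \<inter> W = y \<inter> W")
    case True
    then have "(\<Prod>e\<in>W. g e + 1) = (\<Prod>e\<in>W. 2)"
      by (intro prod.cong refl) (auto simp: g_def)
    then show ?thesis using True by simp
  next
    case False
    then obtain e where "e \<in> W" "(e \<in> x) \<noteq> (e \<in> y)" by blast
    then have "g e + 1 = 0" by (auto simp: g_def)
    then have "(\<Prod>e\<in>W. g e + 1) = 0" using assms \<open>e \<in> W\<close> by (intro prod_zero) auto
    then show ?thesis using False by simp
  qed
  finally show ?thesis .
qed

text \<open>It is applied in two ways: to sets of inputs with all bits \<open>W\<close>, and to the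
  inputs solved by \<open>S\<close> with one position of \<open>S\<close> removed, where the
  remaining bits still separate them.\<close>

lemma sg_parseval:
  assumes "finite W" "finite X" "inj_on (\<lambda>x. x \<inter> W) X"
  shows "(\<Sum>a\<in>Pow W. (\<Sum>x\<in>X. c x * sg a x)\<^sup>2) = 2 ^ card W * (\<Sum>x\<in>X. (c x)\<^sup>2)"
proof -
  have "(\<Sum>a\<in>Pow W. (\<Sum>x\<in>X. c x * sg a x)\<^sup>2) =
      (\<Sum>a\<in>Pow W. \<Sum>x\<in>X. \<Sum>y\<in>X. c x * c y * (sg a x * sg a y))"
    by (simp add: power2_eq_square sum_product mult_ac)
  also have "\<dots> = (\<Sum>x\<in>X. \<Sum>a\<in>Pow W. \<Sum>y\<in>X. c x * c y * (sg a x * sg a y))"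
    by (rule sum.swap)
  also have "\<dots> = (\<Sum>x\<in>X. \<Sum>y\<in>X. \<Sum>a\<in>Pow W. c x * c y * (sg a x * sg a y))"
    by (intro sum.cong refl sum.swap)
  also have "\<dots> = (\<Sum>x\<in>X. \<Sum>y\<in>X. c x * c y * (if x \<inter> W = y \<inter> W then 2 ^ card W else 0))"
    unfolding sum_distrib_left[symmetric] sg_orthogonal[OF assms(1)] ..
  also have "\<dots> = (\<Sum>x\<in>X. \<Sum>y\<in>X. if y = x then 2 ^ card W * (c x)\<^sup>2 else 0)"
  proof (intro sum.cong refl)
    fix x y assume "x \<in> X" "y \<in> X"
    then have "x \<inter> W = y \<inter> W \<longleftrightarrow> y = x" using assms(3) by (auto dest: inj_onD)
    then show "c x * c y * (if x \<inter> W = y \<inter> W then 2 ^ card W else 0) =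
        (if y = x then 2 ^ card W * (c x)\<^sup>2 else 0)"
      by (simp add: power2_eq_square)
  qed
  finally show ?thesis using assms(2) by (simp add: sum_distrib_left)
qed

lemma sum_UN_le:
  fixes f :: "'a \<Rightarrow> real"
  assumes "finite I" "\<And>i. i \<in> I \<Longrightarrow> finite (A i)" "\<And>x. f x \<ge> 0"
  shows "(\<Sum>x\<in>(\<Union>i\<in>I. A i). f x) \<le> (\<Sum>i\<in>I. \<Sum>x\<in>A i. f x)"
  using assms(1,2)
proof (induction I rule: finite_induct)
  case (insert i I)
  have "(\<Sum>x\<in>(\<Union>i\<in>insert i I. A i). f x) \<le> (\<Sum>x\<in>A i. f x) + (\<Sum>x\<in>(\<Union>i\<in>I. A i). f x)"
    using insert.prems insert.hyps by (simp add: sum_Un assms(3) sum_nonneg)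
  then show ?case using insert by simp
qed simp

text \<open>The arithmetic at the end of \<open>adv_ksum\<close>: \<open>R\<close> counts the rows,
  \<open>l\<close> the legal inputs, \<open>B\<close> all inputs, and \<open>N\<close> is the query
  bound. The main inequality comes from testing the matrix with constant vectors.\<close>

lemma ratio_bound:
  fixes L R l k B \<mu> N :: real
  assumes main: "L * R * l / N \<le> \<mu> * (sqrt l * sqrt R)" and N: "N = sqrt (2 * k * B) * sqrt R"
    and B: "B \<le> 2 * l" and pos: "R > 0" "l > 0" "N > 0" "k > 0" "L \<ge> 0"
  shows "L / (2 * sqrt k) \<le> \<mu>"
proof -
  define s where "s = sqrt R"
  define t where "t = sqrt l"
  have st: "s > 0" "t > 0" "R = s * s" "l = t * t" using pos by (simp_all add: s_def t_def)
  have "L * R * l \<le> \<mu> * (t * s) * N"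
    using main pos by (simp add: s_def t_def pos_divide_le_eq)
  then have "(L * (s * t)) * (s * t) \<le> (\<mu> * N) * (s * t)"
    by (simp add: st(3,4) mult_ac)
  then have le: "L * (s * t) \<le> \<mu> * N"
    using st(1,2) by (simp add: mult_le_cancel_right)
  have "0 \<le> \<mu> * N" using le st pos by (meson mult_nonneg_nonneg less_imp_le order_trans)
  then have \<mu>: "\<mu> \<ge> 0" using pos by (simp add: zero_le_mult_iff)
  have "sqrt (2 * k * B) \<le> sqrt (2\<^sup>2 * (k * l))"
    using B pos by (intro real_sqrt_le_mono) simp
  also have "\<dots> = 2 * (sqrt k * t)"
    by (simp add: real_sqrt_mult t_def)
  finally have "N \<le> 2 * (sqrt k * t) * s" unfolding N s_def[symmetric] using st by (intro mult_right_mono) auto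
  then have "\<mu> * N \<le> \<mu> * (2 * (sqrt k * t) * s)" using \<mu> by (rule mult_left_mono)
  with le have "L * (s * t) \<le> (\<mu> * (2 * sqrt k)) * (s * t)" by (simp add: mult_ac)
  then have "L \<le> \<mu> * (2 * sqrt k)" using st(1,2) by (simp add: mult_le_cancel_right)
  then show ?thesis using pos by (simp add: pos_divide_le_eq)
qed

section \<open>k-SUM instances and their Fourier matrix\<close>

type_synonym pos = "nat \<times> nat"

text \<open>The bound on \<open>L ^ Suc k\<close> is the condition under which the squared
  coefficients of a query sum to at most \<open>2 * M ^ k\<close>; it lets \<open>L\<close> be about
  \<open>M powr (k / (k + 1))\<close>. The last assumption makes the alphabet so large that at least
  half of all inputs have no solution.\<close>

locale ksum =
  fixes k M r L :: nat
  assumes k: "k > 0" and r: "r > 0" and L: "L ^ Suc k \<le> M ^ k" "L > 0" and q: "2 * M ^ k \<le> 2 ^ r"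
begin

text \<open>An instance has \<open>k\<close> blocks of \<open>M\<close> symbols in \<open>{0,1}\<^sup>r\<close>, given as the set of positions and bits
  that are on. \<open>S\<close> picks one position in each block, and it is a solution if the picked symbols
  sum to zero.\<close>

definition P :: "pos set" where "P = {..<k} \<times> {..<M}"
definition W :: "(pos \<times> nat) set" where "W = P \<times> {..<r}"
definition \<S> :: "(nat \<Rightarrow> nat) set" where "\<S> = PiE {..<k} (\<lambda>_. {..<M})"
definition pos :: "(nat \<Rightarrow> nat) \<Rightarrow> pos set" where "pos S = (\<lambda>j. (j, S j)) ` {..<k}"
definition zero_sum :: "(nat \<Rightarrow> nat) \<Rightarrow> (pos \<times> nat) set \<Rightarrow> bool" where
  "zero_sum S x \<longleftrightarrow> (\<forall>b<r. even (card {j. j < k \<and> ((j, S j), b) \<in> x}))"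
definition T :: "(nat \<Rightarrow> nat) \<Rightarrow> (pos \<times> nat) set set" where "T S = {x \<in> Pow W. zero_sum S x}"
definition legal :: "(pos \<times> nat) set set" where "legal = {z \<in> Pow W. \<forall>S\<in>\<S>. \<not> zero_sum S z}"
definition Wo :: "pos \<Rightarrow> (pos \<times> nat) set" where "Wo p = W - {p} \<times> {..<r}"

lemma M: "M > 0"
proof (rule ccontr)
  assume "\<not> M > 0"
  then have "M ^ k = 0" using k by simp
  moreover have "0 < L ^ Suc k" using L(2) by simp
  ultimately show False using L(1) by linarith
qed

lemma fin: "finite P" "finite W" "finite \<S>" "finite (T S)" "finite legal" "finite (Wo p)" "finite (pos S)"
  by (auto simp: P_def W_def \<S>_def T_def legal_def Wo_def pos_def intro: finite_PiE)

lemma finW: "a \<subseteq> W \<Longrightarrow> finite a"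
  using fin(2) finite_subset by blast

lemma card_S: "card \<S> = M ^ k"
  by (simp add: \<S>_def card_PiE)

lemma pos_P: "S \<in> \<S> \<Longrightarrow> pos S \<subseteq> P"
  by (auto simp: pos_def P_def \<S>_def)

lemma card_pos: "card (pos S) = k"
  unfolding pos_def by (subst card_image) (auto simp: inj_on_def)

lemma card_Wo:
  assumes "p \<in> P"
  shows "card (Wo p) = card W - r"
proof -
  have "{p} \<times> {..<r} \<subseteq> W" using assms by (auto simp: W_def)
  then have "card (Wo p) = card W - card ({p} \<times> {..<r})"
    unfolding Wo_def by (intro card_Diff_subset) auto
  then show ?thesis by (simp add: card_cartesian_product)
qed

lemma r_le: "r \<le> card W"
proof -
  have "card W = k * M * r" by (simp add: W_def P_def card_cartesian_product)
  moreover have "1 \<le> k * M" using k M by simp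
  ultimately show ?thesis by (metis mult_le_mono1 mult_1)
qed

definition others :: "(nat \<Rightarrow> nat) \<Rightarrow> nat \<Rightarrow> nat \<Rightarrow> (pos \<times> nat) set \<Rightarrow> nat" where
  "others S j0 b x = card {j. j < k \<and> j \<noteq> j0 \<and> ((j, S j), b) \<in> x}"

lemma zero_sum_iff:
  assumes "j0 < k"
  shows "zero_sum S x \<longleftrightarrow> (\<forall>b<r. ((j0, S j0), b) \<in> x \<longleftrightarrow> odd (others S j0 b x))"
proof -
  have "even (card {j. j < k \<and> ((j, S j), b) \<in> x}) \<longleftrightarrow> (((j0, S j0), b) \<in> x \<longleftrightarrow> odd (others S j0 b x))" for b
  proof (cases "((j0, S j0), b) \<in> x")
    case True
    then have "{j. j < k \<and> ((j, S j), b) \<in> x} = insert j0 {j. j < k \<and> j \<noteq> j0 \<and> ((j, S j), b) \<in> x}"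
      using assms by auto
    then show ?thesis using True by (simp add: others_def)
  next
    case False
    then have "{j. j < k \<and> ((j, S j), b) \<in> x} = {j. j < k \<and> j \<noteq> j0 \<and> ((j, S j), b) \<in> x}"
      by auto
    then show ?thesis using False by (simp add: others_def)
  qed
  then show ?thesis by (simp add: zero_sum_def)
qed

lemma others_Wo:
  assumes "S \<in> \<S>" "b < r" "x \<inter> Wo (j0, S j0) = y \<inter> Wo (j0, S j0)"
  shows "others S j0 b x = others S j0 b y"
proof -
  have "((j, S j), b) \<in> Wo (j0, S j0)" if "j < k" "j \<noteq> j0" for j
    using assms that by (auto simp: Wo_def W_def P_def \<S>_def)
  then have "{j. j < k \<and> j \<noteq> j0 \<and> ((j, S j), b) \<in> x} = {j. j < k \<and> j \<noteq> j0 \<and> ((j, S j), b) \<in> y}"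
    using assms(3) by blast
  then show ?thesis by (simp add: others_def)
qed

text \<open>The parity equations determine the symbol at \<open>p\<close> from the other symbols of
  \<open>S\<close> and leave all other bits free. So the inputs in \<open>T S\<close> look uniform
  once a position of \<open>S\<close> is hidden, the orthogonal array property behind the
  \<open>k\<close>-SUM bound.\<close>

lemma T_bij:
  assumes S: "S \<in> \<S>" and p: "p \<in> pos S"
  shows "bij_betw (\<lambda>x. x \<inter> Wo p) (T S) (Pow (Wo p))"
proof -
  obtain j0 where j0: "p = (j0, S j0)" "j0 < k" using p by (auto simp: pos_def)
  define fill where "fill = (\<lambda>y. y \<union> {(p, b) | b. b < r \<and> odd (others S j0 b y)})"
  have pP: "p \<in> P" using pos_P[OF S] p by blast
  have fillWo: "fill y \<inter> Wo p = y" if "y \<subseteq> Wo p" for y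
    using that by (auto simp: fill_def Wo_def)
  show ?thesis
  proof (rule bij_betw_byWitness[where f' = fill])
    show "\<forall>x\<in>T S. fill (x \<inter> Wo p) = x"
    proof
      fix x assume x: "x \<in> T S"
      have eq: "others S j0 b (x \<inter> Wo p) = others S j0 b x" if "b < r" for b
        using others_Wo[OF S that, of "x \<inter> Wo p" j0 x] j0 by auto
      have mem: "(p, b) \<in> x \<longleftrightarrow> odd (others S j0 b x)" if "b < r" for b
        using x zero_sum_iff[OF j0(2)] that by (simp add: T_def j0(1))
      have "x \<subseteq> W" using x by (simp add: T_def)
      have "e \<in> fill (x \<inter> Wo p) \<longleftrightarrow> e \<in> x" for e
      proof (cases "\<exists>b<r. e = (p, b)")
        case True
        then obtain b where b: "b < r" "e = (p, b)" by blast
        then have "e \<notin> Wo p" by (simp add: Wo_def)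
        then show ?thesis using mem[OF b(1)] eq[OF b(1)] b by (auto simp: fill_def)
      next
        case False
        then have "e \<in> x \<Longrightarrow> e \<in> Wo p" using \<open>x \<subseteq> W\<close> by (auto simp: Wo_def)
        then show ?thesis using False by (auto simp: fill_def)
      qed
      then show "fill (x \<inter> Wo p) = x" by blast
    qed
    show "\<forall>y\<in>Pow (Wo p). fill y \<inter> Wo p = y" using fillWo by simp
    show "(\<lambda>x. x \<inter> Wo p) ` T S \<subseteq> Pow (Wo p)" by auto
    show "fill ` Pow (Wo p) \<subseteq> T S"
    proof
      fix x assume "x \<in> fill ` Pow (Wo p)"
      then obtain y where y: "y \<subseteq> Wo p" "x = fill y" by auto
      have "x \<subseteq> W" using y pP by (auto simp: fill_def Wo_def W_def)
      moreover have "zero_sum S x"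
        unfolding zero_sum_iff[OF j0(2)]
      proof (intro allI impI)
        fix b assume "b < r"
        have "others S j0 b x = others S j0 b y"
          using others_Wo[OF S \<open>b < r\<close>, of x j0 y] fillWo[OF y(1)] y j0 by auto
        moreover have "((j0, S j0), b) \<in> x \<longleftrightarrow> odd (others S j0 b y)"
          using y \<open>b < r\<close> j0 by (auto simp: fill_def Wo_def)
        ultimately show "((j0, S j0), b) \<in> x \<longleftrightarrow> odd (others S j0 b x)" by simp
      qed
      ultimately show "x \<in> T S" by (simp add: T_def)
    qed
  qed
qed

lemma pos_nonempty: "\<exists>p. p \<in> pos S"
  using k by (auto simp: pos_def)

lemma card_T: "S \<in> \<S> \<Longrightarrow> card (T S) = 2 ^ (card W - r)"
proof -
  assume S: "S \<in> \<S>"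
  obtain p where p: "p \<in> pos S" using pos_nonempty by blast
  then have "p \<in> P" using pos_P S by blast
  have "card (T S) = card (Pow (Wo p))" by (rule bij_betw_same_card[OF T_bij[OF S p]])
  then show ?thesis using fin by (simp add: card_Pow card_Wo[OF \<open>p \<in> P\<close>])
qed

text \<open>Union bound: each of the \<open>M ^ k\<close> selections is a solution of one in
  \<open>2 ^ r\<close> inputs, which together is at most half of them.\<close>

lemma card_legal: "2 ^ card W \<le> 2 * card legal"
proof -
  have "Pow W = legal \<union> (\<Union>S\<in>\<S>. T S)" by (auto simp: legal_def T_def)
  then have "card (Pow W) \<le> card legal + card (\<Union>S\<in>\<S>. T S)" by (metis card_Un_le)
  also have "card (\<Union>S\<in>\<S>. T S) \<le> (\<Sum>S\<in>\<S>. card (T S))" by (rule card_UN_le[OF fin(3)])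
  also have "\<dots> = M ^ k * 2 ^ (card W - r)" by (simp add: card_T card_S)
  finally have 1: "2 ^ card W \<le> card legal + M ^ k * 2 ^ (card W - r)"
    using fin by (simp add: card_Pow)
  have "2 * (M ^ k * 2 ^ (card W - r)) \<le> 2 ^ r * 2 ^ (card W - r)"
    using mult_le_mono1[OF q, of "2 ^ (card W - r)"] by (simp add: mult.assoc)
  also have "\<dots> = 2 ^ card W" using r_le by (simp flip: power_add)
  finally show ?thesis using 1 by simp
qed

text \<open>By \<open>T_bij\<close> a nonempty character that avoids a position of \<open>S\<close>
  is summed over uniform bits, so it cancels.\<close>

lemma sum_T_sg:
  assumes S: "S \<in> \<S>" and a: "a \<subseteq> W" "a \<noteq> {}" "\<not> pos S \<subseteq> fst ` a"
  shows "(\<Sum>x\<in>T S. sg a x) = 0"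
proof -
  obtain p where p: "p \<in> pos S" "p \<notin> fst ` a" using a by blast
  have aW: "a \<subseteq> Wo p" using a p by (auto simp: Wo_def image_iff)
  have "(\<Sum>x\<in>T S. sg a x) = (\<Sum>x\<in>T S. sg a (x \<inter> Wo p))"
    unfolding sg_def using aW by (intro sum.cong prod.cong refl) auto
  also have "\<dots> = (\<Sum>y\<in>Pow (Wo p). sg a y)"
    by (rule sum.reindex_bij_betw[OF T_bij[OF S p(1)]])
  also have "\<dots> = (\<Sum>y\<in>Pow (Wo p). sg y a * sg y {})"
    using finW[OF a(1)] fin(6)
    by (intro sum.cong refl) (auto simp: sg_commute[of a] finite_subset sg_def[of _ "{}"])
  also have "\<dots> = 0"
    using aW a(2) fin(6) by (subst sg_orthogonal) auto
  finally show ?thesis .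
qed

definition rows :: "((nat \<Rightarrow> nat) \<times> (pos \<times> nat) set) set" where "rows = Sigma \<S> T"

lemma rows_sum: "(\<Sum>y\<in>rows. g y) = (\<Sum>S\<in>\<S>. \<Sum>x\<in>T S. g (S, x))"
  unfolding rows_def using fin by (subst sum.Sigma) auto

text \<open>For each \<open>S\<close> this is the restriction to the rows in \<open>T S\<close> of a
  matrix that is diagonal in the basis of characters, with eigenvalues \<open>\<gamma> S a\<close>
  up to the common factor \<open>2 ^ card W\<close>.\<close>

definition fmat :: "((nat \<Rightarrow> nat) \<Rightarrow> (pos \<times> nat) set \<Rightarrow> real) \<Rightarrow>
    (nat \<Rightarrow> nat) \<times> (pos \<times> nat) set \<Rightarrow> (pos \<times> nat) set \<Rightarrow> real" where
  "fmat \<gamma> y z = (\<Sum>a\<in>Pow W. \<gamma> (fst y) a * sg a (snd y) * sg a z)"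

definition N0 :: real where "N0 = sqrt (2 * M ^ k) * sqrt (k * 2 ^ (card W - r) * 2 ^ card W)"

text \<open>Cauchy-Schwarz over pairs of a selection and a character. Characters that cover
  \<open>pos S\<close> have coefficient 0; any other one avoids some position of \<open>S\<close>,
  where Parseval holds on \<open>T S\<close>, and the union over \<open>k\<close> positions costs
  the factor \<open>k\<close> in \<open>N0\<close>. On the other side \<open>sq\<close> bounds the
  coefficients of each character, and Parseval on all bits gives \<open>2 ^ card W\<close>.\<close>

lemma opbound_fmat:
  fixes \<gamma> :: "(nat \<Rightarrow> nat) \<Rightarrow> (pos \<times> nat) set \<Rightarrow> real"
  assumes zero: "\<And>S a. S \<in> \<S> \<Longrightarrow> a \<subseteq> W \<Longrightarrow> pos S \<subseteq> fst ` a \<Longrightarrow> \<gamma> S a = 0"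
    and sq: "\<And>a. a \<subseteq> W \<Longrightarrow> (\<Sum>S\<in>\<S>. (\<gamma> S a)\<^sup>2) \<le> 2 * M ^ k" and Z: "Z \<subseteq> Pow W"
  shows "opbound rows Z (fmat \<gamma>) N0"
proof (rule opboundI)
  fix c :: "(nat \<Rightarrow> nat) \<times> (pos \<times> nat) set \<Rightarrow> real" and d :: "(pos \<times> nat) set \<Rightarrow> real"
  have finZ: "finite Z" using Z fin(2) finite_subset by blast
  define C where "C = (\<lambda>S a. \<Sum>x\<in>T S. c (S, x) * sg a x)"
  define D where "D = (\<lambda>a. \<Sum>z\<in>Z. d z * sg a z)"
  define u where "u = (\<lambda>(S, a). if pos S \<subseteq> fst ` a then 0 else C S a)"
  define v where "v = (\<lambda>(S, a). \<gamma> S a * D a)"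
  let ?n = "card W"
  have pairs: "(\<Sum>p\<in>\<S> \<times> Pow W. g p) = (\<Sum>S\<in>\<S>. \<Sum>a\<in>Pow W. g (S, a))" for g :: "_ \<Rightarrow> real"
    by (simp add: sum.cartesian_product)
  have "(\<Sum>y\<in>rows. \<Sum>z\<in>Z. fmat \<gamma> y z * c y * d z) =
      (\<Sum>S\<in>\<S>. \<Sum>x\<in>T S. \<Sum>z\<in>Z. \<Sum>a\<in>Pow W. \<gamma> S a * (c (S, x) * sg a x) * (d z * sg a z))"
    by (simp add: rows_sum fmat_def sum_distrib_left sum_distrib_right mult_ac)
  also have "\<dots> = (\<Sum>S\<in>\<S>. \<Sum>x\<in>T S. \<Sum>a\<in>Pow W. \<Sum>z\<in>Z. \<gamma> S a * (c (S, x) * sg a x) * (d z * sg a z))"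
    by (intro sum.cong refl sum.swap)
  also have "\<dots> = (\<Sum>S\<in>\<S>. \<Sum>a\<in>Pow W. \<Sum>x\<in>T S. \<Sum>z\<in>Z. \<gamma> S a * (c (S, x) * sg a x) * (d z * sg a z))"
    by (intro sum.cong refl sum.swap)
  also have "\<dots> = (\<Sum>S\<in>\<S>. \<Sum>a\<in>Pow W. \<gamma> S a * (C S a * D a))"
    unfolding C_def D_def sum_product by (simp add: sum_distrib_left mult.assoc)
  also have "\<dots> = (\<Sum>p\<in>\<S> \<times> Pow W. u p * v p)"
    unfolding pairs by (intro sum.cong refl) (auto simp: u_def v_def zero)
  finally have eq: "(\<Sum>y\<in>rows. \<Sum>z\<in>Z. fmat \<gamma> y z * c y * d z) = (\<Sum>p\<in>\<S> \<times> Pow W. u p * v p)" .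
  have Cp: "(\<Sum>a\<in>Pow (Wo p). (C S a)\<^sup>2) = 2 ^ (?n - r) * (\<Sum>x\<in>T S. (c (S, x))\<^sup>2)"
    if "S \<in> \<S>" "p \<in> pos S" for S p
  proof -
    have "p \<in> P" using that pos_P by blast
    then show ?thesis unfolding C_def
      using sg_parseval[of "Wo p" "T S" "\<lambda>x. c (S, x)"] fin T_bij[OF that] by (simp add: card_Wo bij_betw_def)
  qed
  have "(\<Sum>a\<in>Pow W. (u (S, a))\<^sup>2) \<le> k * 2 ^ (?n - r) * (\<Sum>x\<in>T S. (c (S, x))\<^sup>2)" if "S \<in> \<S>" for S
  proof -
    have "(\<Sum>a\<in>Pow W. (u (S, a))\<^sup>2) = (\<Sum>a\<in>{a \<in> Pow W. \<not> pos S \<subseteq> fst ` a}. (C S a)\<^sup>2)"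
      using fin by (intro sum.mono_neutral_cong_right) (auto simp: u_def)
    also have "\<dots> \<le> (\<Sum>a\<in>(\<Union>p\<in>pos S. Pow (Wo p)). (C S a)\<^sup>2)"
    proof (rule sum_mono2)
      show "finite (\<Union>p\<in>pos S. Pow (Wo p))" using fin by simp
      show "{a \<in> Pow W. \<not> pos S \<subseteq> fst ` a} \<subseteq> (\<Union>p\<in>pos S. Pow (Wo p))"
      proof
        fix a assume a: "a \<in> {a \<in> Pow W. \<not> pos S \<subseteq> fst ` a}"
        then obtain p where p: "p \<in> pos S" "p \<notin> fst ` a" by blast
        have "a \<subseteq> Wo p"
        proof
          fix e assume "e \<in> a"
          then have "fst e \<noteq> p" using p by blast
          then show "e \<in> Wo p" using \<open>e \<in> a\<close> a by (cases e) (auto simp: Wo_def)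
        qed
        then show "a \<in> (\<Union>p\<in>pos S. Pow (Wo p))" using p by blast
      qed
    qed simp
    also have "\<dots> \<le> (\<Sum>p\<in>pos S. \<Sum>a\<in>Pow (Wo p). (C S a)\<^sup>2)"
      by (rule sum_UN_le) (use fin in auto)
    also have "\<dots> = k * 2 ^ (?n - r) * (\<Sum>x\<in>T S. (c (S, x))\<^sup>2)"
      using that by (simp add: Cp card_pos)
    finally show ?thesis .
  qed
  then have "(\<Sum>p\<in>\<S> \<times> Pow W. (u p)\<^sup>2) \<le> (\<Sum>S\<in>\<S>. k * 2 ^ (?n - r) * (\<Sum>x\<in>T S. (c (S, x))\<^sup>2))"
    unfolding pairs by (intro sum_mono)
  also have "\<dots> = k * 2 ^ (?n - r) * (\<Sum>y\<in>rows. (c y)\<^sup>2)"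
    by (simp add: rows_sum sum_distrib_left)
  finally have u: "L2_set u (\<S> \<times> Pow W) \<le> sqrt (k * 2 ^ (?n - r)) * L2_set c rows"
    unfolding L2_set_def real_sqrt_mult[symmetric] by (rule real_sqrt_le_mono)
  have "(\<Sum>p\<in>\<S> \<times> Pow W. (v p)\<^sup>2) = (\<Sum>a\<in>Pow W. \<Sum>S\<in>\<S>. (\<gamma> S a)\<^sup>2 * (D a)\<^sup>2)"
    unfolding pairs by (subst sum.swap) (simp add: v_def power_mult_distrib)
  also have "\<dots> = (\<Sum>a\<in>Pow W. (\<Sum>S\<in>\<S>. (\<gamma> S a)\<^sup>2) * (D a)\<^sup>2)"
    by (simp add: sum_distrib_right)
  also have "\<dots> \<le> (\<Sum>a\<in>Pow W. (2 * M ^ k) * (D a)\<^sup>2)"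
    using sq by (intro sum_mono mult_right_mono) auto
  also have "\<dots> = 2 * M ^ k * (\<Sum>a\<in>Pow W. (D a)\<^sup>2)"
    by (simp add: sum_distrib_left)
  also have "(\<Sum>a\<in>Pow W. (D a)\<^sup>2) = 2 ^ ?n * (\<Sum>z\<in>Z. (d z)\<^sup>2)"
    unfolding D_def
  proof (rule sg_parseval[OF fin(2) finZ])
    show "inj_on (\<lambda>x. x \<inter> W) Z"
      using Z by (intro inj_onI) (metis Int_absorb2 PowD subsetD)
  qed
  finally have "(\<Sum>p\<in>\<S> \<times> Pow W. (v p)\<^sup>2) \<le> 2 * M ^ k * 2 ^ ?n * (\<Sum>z\<in>Z. (d z)\<^sup>2)"
    by (simp add: mult.assoc)
  then have v: "L2_set v (\<S> \<times> Pow W) \<le> sqrt (2 * M ^ k * 2 ^ ?n) * L2_set d Z"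
    unfolding L2_set_def real_sqrt_mult[symmetric] by (rule real_sqrt_le_mono)
  have "\<bar>\<Sum>y\<in>rows. \<Sum>z\<in>Z. fmat \<gamma> y z * c y * d z\<bar> \<le> (\<Sum>p\<in>\<S> \<times> Pow W. \<bar>u p\<bar> * \<bar>v p\<bar>)"
    unfolding eq by (rule order_trans[OF sum_abs]) (simp add: abs_mult)
  also have "\<dots> \<le> L2_set u (\<S> \<times> Pow W) * L2_set v (\<S> \<times> Pow W)"
    by (rule L2_set_mult_ineq)
  also have "\<dots> \<le> (sqrt (k * 2 ^ (?n - r)) * L2_set c rows) * (sqrt (2 * M ^ k * 2 ^ ?n) * L2_set d Z)"
    by (intro mult_mono u v) auto
  also have "\<dots> = N0 * (L2_set c rows * L2_set d Z)"
    by (simp add: N0_def real_sqrt_mult)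
  finally show "\<bar>\<Sum>y\<in>rows. \<Sum>z\<in>Z. fmat \<gamma> y z * c y * d z\<bar> \<le> N0 * (L2_set c rows * L2_set d Z)" .
qed

text \<open>The Fourier weights of Belovs and Spalek; \<open>L - card A\<close> is truncated at 0. In
  \<open>fmat_query\<close> the coefficients may be replaced by their differences since the characters supported
  on the queried symbol sum to zero when the two inputs differ there.\<close>

definition \<alpha> :: "(nat \<Rightarrow> nat) \<Rightarrow> pos set \<Rightarrow> real" where
  "\<alpha> S A = (if pos S \<subseteq> A then 0 else real (L - card A))"

definition \<gamma>0 :: "(nat \<Rightarrow> nat) \<Rightarrow> (pos \<times> nat) set \<Rightarrow> real" where
  "\<gamma>0 S a = \<alpha> S (fst ` a)"

definition \<gamma>d :: "pos \<Rightarrow> (nat \<Rightarrow> nat) \<Rightarrow> (pos \<times> nat) set \<Rightarrow> real" where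
  "\<gamma>d p S a = (if p \<in> fst ` a then 0 else \<alpha> S (fst ` a) - \<alpha> S (insert p (fst ` a)))"

text \<open>Such an \<open>S\<close> passes through \<open>p\<close>, which fixes its choice in the
  block \<open>fst p\<close>; the other \<open>k - 1\<close> choices lie in
  \<open>A\<close>.\<close>

lemma card_closing:
  assumes "finite A"
  shows "card {S \<in> \<S>. pos S \<subseteq> insert p A \<and> \<not> pos S \<subseteq> A} \<le> card A ^ (k - 1)"
proof (cases "fst p < k")
  case True
  let ?B = "{S \<in> \<S>. pos S \<subseteq> insert p A \<and> \<not> pos S \<subseteq> A}"
  let ?E = "PiE ({..<k} - {fst p}) (\<lambda>_. A)"
  define f where "f = (\<lambda>S :: nat \<Rightarrow> nat. restrict (\<lambda>j. (j, S j)) ({..<k} - {fst p}))"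
  have mem: "(fst p, S (fst p)) = p" if S: "S \<in> ?B" for S
  proof -
    obtain j where "j < k" "(j, S j) \<notin> A" using S by (auto simp: pos_def)
    moreover then have "(j, S j) = p" using S by (auto simp: pos_def)
    ultimately show ?thesis by (metis fst_conv)
  qed
  have "inj_on f ?B"
  proof (rule inj_onI)
    fix S S' assume S: "S \<in> ?B" "S' \<in> ?B" and eq: "f S = f S'"
    have "S j = S' j" if "j < k" for j
    proof (cases "j = fst p")
      case True
      then show ?thesis using mem[OF S(1)] mem[OF S(2)] by (metis snd_conv)
    next
      case False
      then show ?thesis using fun_cong[OF eq, of j] that by (simp add: f_def)
    qed
    then show "S = S'" using S unfolding \<S>_def by (intro PiE_ext[of S "{..<k}" "\<lambda>_. {..<M}" S']) auto
  qed
  moreover have "f ` ?B \<subseteq> ?E"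
  proof
    fix h assume "h \<in> f ` ?B"
    then obtain S where S: "S \<in> ?B" "h = f S" by blast
    have "(j, S j) \<in> A" if "j < k" "j \<noteq> fst p" for j
    proof -
      have "(j, S j) \<in> insert p A" using S that by (auto simp: pos_def)
      moreover have "(j, S j) \<noteq> p" using that by (metis fst_conv)
      ultimately show ?thesis by blast
    qed
    then show "h \<in> ?E" by (auto simp: S f_def)
  qed
  moreover have "finite ?E" using assms by (intro finite_PiE) auto
  ultimately have "card ?B \<le> card ?E" by (intro card_inj_on_le)
  also have "card ?E = card A ^ (k - 1)" using True by (simp add: card_PiE)
  finally show ?thesis .
next
  case False
  then have "p \<notin> pos S" for S by (auto simp: pos_def)
  then have "{S \<in> \<S>. pos S \<subseteq> insert p A \<and> \<not> pos S \<subseteq> A} = {}" by blast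
  then show ?thesis by (simp only: card.empty zero_le)
qed

text \<open>If \<open>p\<close> does not complete \<open>S\<close>, one more known position lowers
  the weight by at most 1, which sums to at most \<open>M ^ k\<close>. A completed \<open>S\<close>
  costs the full square \<open>(L - card A)\<^sup>2\<close>, but while \<open>card A \<le> L\<close>
  there are at most \<open>L ^ (k - 1)\<close> of them, so together at most
  \<open>L ^ Suc k\<close>. Balancing the two dictates \<open>L\<close>; for larger \<open>A\<close>
  the truncated weight is 0.\<close>

lemma \<gamma>d_squares:
  assumes a: "a \<subseteq> W"
  shows "(\<Sum>S\<in>\<S>. (\<gamma>d p S a)\<^sup>2) \<le> 2 * M ^ k"
proof (cases "p \<in> fst ` a")
  case False
  define A where "A = fst ` a"
  have finA: "finite A" using finW[OF a] by (simp add: A_def)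
  have cardA: "card (insert p A) = Suc (card A)" using False finA by (simp add: A_def)
  let ?B = "{S \<in> \<S>. pos S \<subseteq> insert p A \<and> \<not> pos S \<subseteq> A}"
  have bound: "(\<gamma>d p S a)\<^sup>2 \<le> 1 + (if S \<in> ?B then real ((L - card A)\<^sup>2) else 0)" if "S \<in> \<S>" for S
  proof -
    show ?thesis
    proof (cases "pos S \<subseteq> insert p A")
      case True
      show ?thesis
      proof (cases "pos S \<subseteq> A")
        case True
        then have "\<gamma>d p S a = 0"
          using False \<open>pos S \<subseteq> insert p A\<close> by (simp add: \<gamma>d_def \<alpha>_def flip: A_def)
        then show ?thesis by simp
      next
        case nsub: False
        then have "\<gamma>d p S a = real (L - card A)"
          using False True by (simp add: \<gamma>d_def \<alpha>_def flip: A_def)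
        then show ?thesis using that True nsub by simp
      qed
    next
      case nsub: False
      then have "\<not> pos S \<subseteq> A" by (meson subset_insertI2)
      then have "\<gamma>d p S a = real (L - card A) - real (L - Suc (card A))"
        using nsub False by (simp add: \<gamma>d_def \<alpha>_def cardA flip: A_def)
      also have "\<dots> = (if card A < L then 1 else 0)" by (simp add: of_nat_diff)
      finally show ?thesis by (simp add: nsub)
    qed
  qed
  have "card ?B * (L - card A)\<^sup>2 \<le> M ^ k"
  proof (cases "card A \<le> L")
    case True
    have "card ?B * (L - card A)\<^sup>2 \<le> L ^ (k - 1) * L\<^sup>2"
    proof (rule mult_le_mono)
      show "card ?B \<le> L ^ (k - 1)"
        using card_closing[OF finA] power_mono[OF True, of "k - 1"] by (meson le_trans zero_le)
    qed (simp add: power_mono)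
    also have "\<dots> = L ^ Suc k" using k by (simp flip: power_add)
    finally show ?thesis using L by simp
  qed simp
  then have small: "real (card ?B) * real ((L - card A)\<^sup>2) \<le> real (M ^ k)"
    unfolding of_nat_mult[symmetric] of_nat_le_iff .
  have "(\<Sum>S\<in>\<S>. (\<gamma>d p S a)\<^sup>2) \<le> (\<Sum>S\<in>\<S>. 1 + (if S \<in> ?B then real ((L - card A)\<^sup>2) else 0))"
    by (intro sum_mono bound)
  also have "\<dots> = card \<S> + (\<Sum>S\<in>\<S>. if S \<in> ?B then real ((L - card A)\<^sup>2) else 0)"
    by (simp add: sum.distrib)
  also have "(\<Sum>S\<in>\<S>. if S \<in> ?B then real ((L - card A)\<^sup>2) else 0) = (\<Sum>S\<in>?B. real ((L - card A)\<^sup>2))"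
    using fin by (intro sum.mono_neutral_cong_right) auto
  also have "\<dots> = real (card ?B) * real ((L - card A)\<^sup>2)" by simp
  finally show ?thesis using small by (simp add: card_S)
qed (simp add: \<gamma>d_def)

lemma sum_Pow_split:
  assumes "p \<in> P"
  shows "(\<Sum>a\<in>Pow W. F a) = (\<Sum>a\<in>Pow (Wo p). \<Sum>c\<in>Pow ({p} \<times> {..<r}). F (a \<union> c))"
proof -
  let ?B = "{p} \<times> {..<r}"
  have "?B \<subseteq> W" using assms by (auto simp: W_def)
  have "(\<Sum>a\<in>Pow (Wo p). \<Sum>c\<in>Pow ?B. F (a \<union> c)) = (\<Sum>ac\<in>Pow (Wo p) \<times> Pow ?B. F (fst ac \<union> snd ac))"
    by (simp add: sum.cartesian_product case_prod_unfold)
  also have "\<dots> = (\<Sum>a\<in>Pow W. F a)"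
  proof (rule sum.reindex_bij_witness[of _ "\<lambda>a. (a \<inter> Wo p, a \<inter> ?B)" "\<lambda>ac. fst ac \<union> snd ac"])
    fix ac assume "ac \<in> Pow (Wo p) \<times> Pow ?B"
    then show "((fst ac \<union> snd ac) \<inter> Wo p, (fst ac \<union> snd ac) \<inter> ?B) = ac" "fst ac \<union> snd ac \<in> Pow W"
      using \<open>?B \<subseteq> W\<close> by (cases ac; auto simp: Wo_def)+
  next
    fix a assume a: "a \<in> Pow W"
    show "fst (a \<inter> Wo p, a \<inter> ?B) \<union> snd (a \<inter> Wo p, a \<inter> ?B) = a"
      using a by (auto simp: Wo_def)
    show "(a \<inter> Wo p, a \<inter> ?B) \<in> Pow (Wo p) \<times> Pow ?B" by auto
  qed simp
  finally show ?thesis by simp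
qed

lemma fmat_query:
  assumes "p \<in> P" "b < r" "((p, b) \<in> snd y) \<noteq> ((p, b) \<in> z)"
  shows "fmat \<gamma>0 y z = fmat (\<gamma>d p) y z"
proof -
  let ?B = "{p} \<times> {..<r}" and ?S = "fst y" and ?x = "snd y"
  have finB: "finite ?B" by simp
  have sub: "p \<notin> fst ` a" if "a \<subseteq> Wo p" for a
    using that by (auto simp: Wo_def W_def)
  have disj: "sg (a \<union> c) t = sg a t * sg c t" if "a \<subseteq> Wo p" "c \<subseteq> ?B" for a c t
    using that finite_subset[OF that(1) fin(6)] finite_subset[OF that(2) finB]
    by (intro sg_union) (auto simp: Wo_def)
  have supp: "fst ` (a \<union> c) = insert p (fst ` a)" if "c \<subseteq> ?B" "c \<noteq> {}" for a c
    using that by (auto simp: image_Un) (metis SigmaD1 fst_conv imageI singletonD subsetD)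
  have "(\<Sum>c\<in>Pow ?B. sg c ?x * sg c z) = 0"
    using assms by (subst sg_orthogonal[OF finB]) auto
  moreover have "(\<Sum>c\<in>Pow ?B. sg c ?x * sg c z) = 1 + (\<Sum>c\<in>Pow ?B - {{}}. sg c ?x * sg c z)"
    using finB by (subst sum.remove[of _ "{}"]) auto
  ultimately have rest: "(\<Sum>c\<in>Pow ?B - {{}}. sg c ?x * sg c z) = -1" by simp
  have "fmat \<gamma>0 y z = (\<Sum>a\<in>Pow (Wo p). \<Sum>c\<in>Pow ?B. \<alpha> ?S (fst ` (a \<union> c)) * sg (a \<union> c) ?x * sg (a \<union> c) z)"
    unfolding fmat_def \<gamma>0_def by (rule sum_Pow_split[OF assms(1)])
  also have "\<dots> = (\<Sum>a\<in>Pow (Wo p). (\<alpha> ?S (fst ` a) - \<alpha> ?S (insert p (fst ` a))) * sg a ?x * sg a z)"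
  proof (intro sum.cong refl)
    fix a assume a: "a \<in> Pow (Wo p)"
    have "(\<Sum>c\<in>Pow ?B. \<alpha> ?S (fst ` (a \<union> c)) * sg (a \<union> c) ?x * sg (a \<union> c) z) =
        \<alpha> ?S (fst ` a) * sg a ?x * sg a z +
        (\<Sum>c\<in>Pow ?B - {{}}. \<alpha> ?S (fst ` (a \<union> c)) * sg (a \<union> c) ?x * sg (a \<union> c) z)"
      using finB by (subst sum.remove[of _ "{}"]) auto
    also have "(\<Sum>c\<in>Pow ?B - {{}}. \<alpha> ?S (fst ` (a \<union> c)) * sg (a \<union> c) ?x * sg (a \<union> c) z) =
        (\<Sum>c\<in>Pow ?B - {{}}. \<alpha> ?S (insert p (fst ` a)) * sg a ?x * sg a z * (sg c ?x * sg c z))"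
    proof (intro sum.cong refl)
      fix c assume "c \<in> Pow ?B - {{}}"
      then have c: "c \<subseteq> ?B" "c \<noteq> {}" by auto
      have "a \<subseteq> Wo p" using a by simp
      show "\<alpha> ?S (fst ` (a \<union> c)) * sg (a \<union> c) ?x * sg (a \<union> c) z =
          \<alpha> ?S (insert p (fst ` a)) * sg a ?x * sg a z * (sg c ?x * sg c z)"
        unfolding supp[OF c] disj[OF \<open>a \<subseteq> Wo p\<close> c(1)] by simp
    qed
    also have "\<dots> = \<alpha> ?S (insert p (fst ` a)) * sg a ?x * sg a z * (-1)"
      unfolding sum_distrib_left[symmetric] rest ..
    finally show "(\<Sum>c\<in>Pow ?B. \<alpha> ?S (fst ` (a \<union> c)) * sg (a \<union> c) ?x * sg (a \<union> c) z) =
        (\<alpha> ?S (fst ` a) - \<alpha> ?S (insert p (fst ` a))) * sg a ?x * sg a z"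
      by (simp add: algebra_simps)
  qed
  also have "\<dots> = (\<Sum>a\<in>Pow (Wo p). \<Sum>c\<in>Pow ?B. \<gamma>d p ?S (a \<union> c) * sg (a \<union> c) ?x * sg (a \<union> c) z)"
  proof (intro sum.cong refl)
    fix a assume a: "a \<in> Pow (Wo p)"
    have "(\<Sum>c\<in>Pow ?B - {{}}. \<gamma>d p ?S (a \<union> c) * sg (a \<union> c) ?x * sg (a \<union> c) z) = 0"
    proof (intro sum.neutral ballI)
      fix c assume "c \<in> Pow ?B - {{}}"
      then have "fst ` (a \<union> c) = insert p (fst ` a)" by (intro supp) auto
      then show "\<gamma>d p ?S (a \<union> c) * sg (a \<union> c) ?x * sg (a \<union> c) z = 0" by (simp add: \<gamma>d_def)
    qed
    moreover have "\<gamma>d p ?S a = \<alpha> ?S (fst ` a) - \<alpha> ?S (insert p (fst ` a))"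
      using sub a by (simp add: \<gamma>d_def)
    ultimately show "(\<alpha> ?S (fst ` a) - \<alpha> ?S (insert p (fst ` a))) * sg a ?x * sg a z =
        (\<Sum>c\<in>Pow ?B. \<gamma>d p ?S (a \<union> c) * sg (a \<union> c) ?x * sg (a \<union> c) z)"
      using finB by (subst sum.remove[of _ "{}"]) auto
  qed
  also have "\<dots> = fmat (\<gamma>d p) y z"
    unfolding fmat_def by (rule sum_Pow_split[OF assms(1), symmetric])
  finally show ?thesis .
qed

text \<open>The indicator of a differing bit is half of 1 minus the product of two signs, so masking
  by it averages two matrices with the same bound. Before that, \<open>fmat_query\<close> has
  replaced \<open>\<gamma>0\<close> by \<open>\<gamma>d\<close>, whose whole matrix is bounded by
  \<open>N0\<close>.\<close>

lemma opbound_query: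
  assumes "p \<in> P" "b < r" "Z \<subseteq> Pow W"
  shows "opbound rows Z (\<lambda>y z. if ((p, b) \<in> snd y) \<noteq> ((p, b) \<in> z) then fmat \<gamma>0 y z else 0) N0"
proof -
  define s where "s = (\<lambda>x. if (p, b) \<in> x then -1 else 1 :: real)"
  have F: "opbound rows Z (fmat (\<gamma>d p)) N0"
  proof (rule opbound_fmat[OF _ \<gamma>d_squares assms(3)])
    show "\<gamma>d p S a = 0" if "pos S \<subseteq> fst ` a" for S a
      using that by (auto simp: \<gamma>d_def \<alpha>_def)
  qed
  have "N0 \<ge> 0" by (simp add: N0_def)
  have "opbound rows Z (\<lambda>y z. fmat (\<gamma>d p) y z * (s (snd y) * s z)) N0"
    using F \<open>N0 \<ge> 0\<close> by (rule opbound_mask) (auto simp: s_def)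
  from opbound_add[OF opbound_scale[OF F, of "1/2"] opbound_scale[OF this, of "-1/2"]]
  have "opbound rows Z (\<lambda>y z. 1/2 * fmat (\<gamma>d p) y z + -1/2 * (fmat (\<gamma>d p) y z * (s (snd y) * s z))) N0"
    by simp
  moreover have "(if ((p, b) \<in> snd y) \<noteq> ((p, b) \<in> z) then fmat \<gamma>0 y z else 0) =
      1/2 * fmat (\<gamma>d p) y z + -1/2 * (fmat (\<gamma>d p) y z * (s (snd y) * s z))" for y z
    using fmat_query[OF assms(1,2), of y z] by (auto simp: s_def)
  ultimately show ?thesis by simp
qed

text \<open>Only the empty character survives: any other one either covers \<open>pos S\<close> and
  has coefficient 0, or sums to 0 over \<open>T S\<close>.\<close>

lemma fmat_total:
  "(\<Sum>y\<in>rows. \<Sum>z\<in>legal. fmat \<gamma>0 y z) = L * M ^ k * 2 ^ (card W - r) * card legal"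
proof -
  have "(\<Sum>y\<in>rows. \<Sum>z\<in>legal. fmat \<gamma>0 y z) =
      (\<Sum>S\<in>\<S>. \<Sum>x\<in>T S. \<Sum>z\<in>legal. \<Sum>a\<in>Pow W. \<gamma>0 S a * (sg a x * sg a z))"
    by (simp add: rows_sum fmat_def mult.assoc)
  also have "\<dots> = (\<Sum>S\<in>\<S>. \<Sum>x\<in>T S. \<Sum>a\<in>Pow W. \<Sum>z\<in>legal. \<gamma>0 S a * (sg a x * sg a z))"
    by (intro sum.cong refl sum.swap)
  also have "\<dots> = (\<Sum>S\<in>\<S>. \<Sum>a\<in>Pow W. \<Sum>x\<in>T S. \<Sum>z\<in>legal. \<gamma>0 S a * (sg a x * sg a z))"
    by (intro sum.cong refl sum.swap)
  also have "\<dots> = (\<Sum>S\<in>\<S>. \<Sum>a\<in>Pow W. \<gamma>0 S a * ((\<Sum>x\<in>T S. sg a x) * (\<Sum>z\<in>legal. sg a z)))"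
    unfolding sum_product by (simp add: sum_distrib_left)
  also have "\<dots> = (\<Sum>S\<in>\<S>. real L * (2 ^ (card W - r) * card legal))"
  proof (intro sum.cong refl)
    fix S assume S: "S \<in> \<S>"
    have "\<gamma>0 S a * ((\<Sum>x\<in>T S. sg a x) * (\<Sum>z\<in>legal. sg a z)) = 0" if "a \<in> Pow W - {{}}" for a
      using sum_T_sg[OF S, of a] that by (cases "pos S \<subseteq> fst ` a") (auto simp: \<gamma>0_def \<alpha>_def)
    then have "(\<Sum>a\<in>Pow W. \<gamma>0 S a * ((\<Sum>x\<in>T S. sg a x) * (\<Sum>z\<in>legal. sg a z))) =
        \<gamma>0 S {} * ((\<Sum>x\<in>T S. sg {} x) * (\<Sum>z\<in>legal. sg {} z))"
      using fin(2) by (subst sum.remove[of "Pow W" "{}"]) (simp_all add: sum.neutral)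
    also have "\<gamma>0 S {} = real L" using pos_nonempty[of S] by (auto simp: \<gamma>0_def \<alpha>_def)
    finally show "(\<Sum>a\<in>Pow W. \<gamma>0 S a * ((\<Sum>x\<in>T S. sg a x) * (\<Sum>z\<in>legal. sg a z))) =
        real L * (2 ^ (card W - r) * card legal)"
      using S by (simp add: card_T)
  qed
  finally show ?thesis by (simp add: card_S)
qed

section \<open>k-SUM as a monotone Boolean function\<close>

definition vars :: "((pos \<times> nat) \<times> bool) set" where "vars = W \<times> UNIV"

text \<open>In dual-rail encoding every bit is given by two variables, one for each value. Declaring inputs
  with both variables on to be positive keeps the DNF monotone and its 0-certificates all-zero.\<close>

definition ksum_fun :: "((pos \<times> nat) \<times> bool \<Rightarrow> bool) \<Rightarrow> bool" where
  "ksum_fun y \<longleftrightarrow> (\<exists>e\<in>W. y (e, True) \<and> y (e, False)) \<or>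
     (\<exists>S\<in>\<S>. \<exists>x\<in>T S. \<forall>j<k. \<forall>b<r. y (((j, S j), b), ((j, S j), b) \<in> x))"

definition enc :: "(pos \<times> nat) set \<Rightarrow> (pos \<times> nat) \<times> bool \<Rightarrow> bool" where
  "enc x v \<longleftrightarrow> (fst v \<in> x) = snd v"

lemma ksum_fun_enc: "x \<subseteq> W \<Longrightarrow> ksum_fun (enc x) \<longleftrightarrow> (\<exists>S\<in>\<S>. zero_sum S x)"
proof
  assume "x \<subseteq> W" "\<exists>S\<in>\<S>. zero_sum S x"
  then obtain S where "S \<in> \<S>" "x \<in> T S" by (auto simp: T_def)
  then show "ksum_fun (enc x)" unfolding ksum_fun_def enc_def by auto
next
  assume "ksum_fun (enc x)"
  then obtain S x' where S: "S \<in> \<S>" "x' \<in> T S"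
      and eq: "\<And>j b. j < k \<Longrightarrow> b < r \<Longrightarrow> ((j, S j), b) \<in> x \<longleftrightarrow> ((j, S j), b) \<in> x'"
    unfolding ksum_fun_def enc_def by auto
  have "{j. j < k \<and> ((j, S j), b) \<in> x} = {j. j < k \<and> ((j, S j), b) \<in> x'}" if "b < r" for b
    using eq that by blast
  then have "zero_sum S x" using S by (simp add: T_def zero_sum_def)
  then show "\<exists>S\<in>\<S>. zero_sum S x" using S by blast
qed

text \<open>The transpose of \<open>fmat \<gamma>0\<close>, divided by \<open>N0\<close>, has query
  bounds 1. Its norm \<open>\<mu>\<close> is not computed: \<open>opbound_attained\<close> gives
  vectors that attain it, and testing with constant vectors bounds it from below through
  \<open>fmat_total\<close>.\<close>

theorem adv_ksum: "adv vars ksum_fun (L / (2 * sqrt k))"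
proof -
  \<comment> \<open>Only a tag that gives legal inputs the type of the rows.\<close>
  define S0 where "S0 = (\<lambda>_ :: nat. 0 :: nat)"
  define Y where "Y = (\<lambda>b. if b then rows else Pair S0 ` legal)"
  define G where "G = (\<lambda>(z :: (nat \<Rightarrow> nat) \<times> (pos \<times> nat) set) y. fmat \<gamma>0 y (snd z) / N0)"
  define \<xi> where "\<xi> = (\<lambda>y :: (nat \<Rightarrow> nat) \<times> (pos \<times> nat) set. enc (snd y))"
  have N0: "N0 > 0" using k M by (simp add: N0_def)
  have inj: "inj_on (Pair S0) legal" by (simp add: inj_on_def)
  have legW: "legal \<subseteq> Pow W" by (auto simp: legal_def)
  have finY: "finite (Y b)" for b using fin by (simp add: Y_def rows_def)
  have leg: "card legal > 0"
    using card_legal by (metis gr0I mult_0_right not_le zero_less_numeral zero_less_power)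
  have lab: "ksum_fun (\<xi> y) = b" if "y \<in> Y b" for y b
  proof (cases b)
    case True
    then have "y \<in> Sigma \<S> T" using that by (simp add: Y_def rows_def)
    then obtain S x where "y = (S, x)" "S \<in> \<S>" "x \<in> T S" by (rule SigmaE)
    then show ?thesis using True ksum_fun_enc[of x] by (auto simp: \<xi>_def T_def)
  next
    case False
    then have "y \<in> Pair S0 ` legal" using that by (simp add: Y_def)
    then obtain z where "y = (S0, z)" "z \<in> legal" by (rule imageE)
    then show ?thesis using False ksum_fun_enc[of z] by (auto simp: \<xi>_def legal_def)
  qed
  have "S0' \<in> \<S>" if "S0' = restrict (\<lambda>_. 0) {..<k}" for S0' using M that by (auto simp: \<S>_def)
  then obtain S1 where S1: "S1 \<in> \<S>" by blast
  have "card (T S1) > 0" by (simp add: card_T[OF S1])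
  then have "T S1 \<noteq> {}" by auto
  then have ne: "Y b \<noteq> {}" for b
    using S1 leg by (auto simp: Y_def rows_def)
  obtain a c \<mu> where ac: "(\<Sum>y\<in>Y False. (a y)\<^sup>2) = 1" "(\<Sum>z\<in>Y True. (c z)\<^sup>2) = 1"
      "(\<Sum>y\<in>Y False. \<Sum>z\<in>Y True. G y z * a y * c z) = \<mu>" "opbound (Y False) (Y True) G \<mu>"
    using opbound_attained[OF finY finY ne ne, of False True G] by blast
  define w where "w = (\<lambda>y. if y \<in> Y False then a y else c y)"
  have disj: "y \<notin> Y False" if "y \<in> Y True" for y using lab[of y False] lab[of y True] that by auto
  have wc: "w y = c y" if "y \<in> Y True" for y using disj[OF that] by (simp add: w_def)
  have wa: "w y = a y" if "y \<in> Y False" for y using that by (simp add: w_def)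
  have "adversary vars ksum_fun \<mu> Y \<xi> G w"
    unfolding adversary_def
  proof (intro conjI allI ballI)
    show "(\<Sum>y\<in>Y b. (w y)\<^sup>2) = 1" for b
      using ac by (cases b) (simp_all add: wa wc cong: sum.cong)
    show "(\<Sum>y\<in>Y False. \<Sum>z\<in>Y True. G y z * w y * w z) = \<mu>"
      using ac by (simp add: wa wc cong: sum.cong)
    fix v assume "v \<in> vars"
    then obtain p b s where v: "v = ((p, b), s)" "p \<in> P" "b < r" by (auto simp: vars_def W_def)
    have "opbound legal rows (\<lambda>z y. 1 / N0 * (if ((p, b) \<in> snd y) \<noteq> ((p, b) \<in> z) then fmat \<gamma>0 y z else 0)) (\<bar>1 / N0\<bar> * N0)"
      by (rule opbound_scale[OF opbound_transpose[OF opbound_query[OF v(2,3) legW]]])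
    then have "opbound (Pair S0 ` legal) ((\<lambda>y. y) ` rows) (\<lambda>y z. if \<xi> y v \<noteq> \<xi> z v then G y z else 0) (\<bar>1 / N0\<bar> * N0)"
    proof (rule opbound_reindex[OF inj inj_on_id2])
      fix z y
      have eq: "(\<xi> (S0, z) v \<noteq> \<xi> y v) \<longleftrightarrow> ((p, b) \<in> snd y) \<noteq> ((p, b) \<in> z)"
        unfolding \<xi>_def enc_def v by (cases s; cases "(p, b) \<in> z"; cases "(p, b) \<in> snd y") simp_all
      show "(if \<xi> (S0, z) v \<noteq> \<xi> y v then G (S0, z) y else 0) =
          1 / N0 * (if ((p, b) \<in> snd y) \<noteq> ((p, b) \<in> z) then fmat \<gamma>0 y z else 0)"
        unfolding eq by (simp add: G_def)
    qed
    then show "opbound (Y False) (Y True) (\<lambda>y z. if \<xi> y v \<noteq> \<xi> z v then G y z else 0) 1"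
      using N0 by (simp add: Y_def)
  qed (use finY lab ac in auto)
  then have adv: "adv vars ksum_fun \<mu>" by (rule advI)
  let ?t = "2 ^ (card W - r) :: real"
  have cardrows: "real (card rows) = M ^ k * ?t"
    unfolding rows_def using fin by (simp add: card_SigmaI card_T card_S)
  have "(\<Sum>y\<in>Y False. \<Sum>z\<in>Y True. G y z * 1 * 1) = (\<Sum>z\<in>legal. \<Sum>y\<in>rows. fmat \<gamma>0 y z) / N0"
    by (simp add: Y_def sum.reindex[OF inj] G_def sum_divide_distrib)
  also have "(\<Sum>z\<in>legal. \<Sum>y\<in>rows. fmat \<gamma>0 y z) = L * M ^ k * ?t * card legal"
    by (subst sum.swap) (simp add: fmat_total)
  finally have "L * M ^ k * ?t * card legal / N0 \<le> \<mu> * (sqrt (card (Y False)) * sqrt (card (Y True)))"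
    using opboundD[OF ac(4), of "\<lambda>_. 1" "\<lambda>_. 1"] N0 by (simp add: L2_set_constant)
  moreover have "card (Y False) = card legal" by (simp add: Y_def card_image[OF inj])
  ultimately have main: "L * (M ^ k * ?t) * card legal / N0 \<le> \<mu> * (sqrt (card legal) * sqrt (M ^ k * ?t))"
    using cardrows by (simp add: Y_def mult.assoc)
  define R where "R = real M ^ k * ?t"
  define l where "l = real (card legal)"
  have pos: "R > 0" "l > 0" using M leg by (simp_all add: R_def l_def)
  have "real L * R * l / N0 \<le> \<mu> * (sqrt l * sqrt R)"
    using main by (simp add: R_def l_def)
  moreover have "N0 = sqrt (2 * k * 2 ^ card W) * sqrt R"
    by (simp add: N0_def R_def real_sqrt_mult)
  moreover have "2 ^ card W \<le> 2 * l"
  proof -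
    have "real (2 ^ card W) \<le> real (2 * card legal)" using card_legal by (simp only: of_nat_le_iff)
    then show ?thesis by (simp add: l_def)
  qed
  ultimately have "L / (2 * sqrt k) \<le> \<mu>"
    using pos k N0 by (intro ratio_bound[where R = R and l = l and N = N0 and B = "2 ^ card W"]) auto
  then show ?thesis using k by (intro adv_mono[OF adv]) auto
qed

end

section \<open>Certificates\<close>

definition cert :: "'v set \<Rightarrow> (('v \<Rightarrow> bool) \<Rightarrow> bool) \<Rightarrow> nat \<Rightarrow> nat \<Rightarrow> bool" where
  "cert V F c0 c1 \<longleftrightarrow>
     (\<forall>x. \<exists>D\<subseteq>V. card D \<le> (if F x then c1 else c0) \<and> certif F D x)"

text \<open>Unambiguity is the invariance of \<open>D\<close>: an input consistent with the
  certificate chosen for \<open>x\<close> chooses the same one, so no input is consistent with two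
  of them.\<close>

definition ucert :: "'v set \<Rightarrow> (('v \<Rightarrow> bool) \<Rightarrow> bool) \<Rightarrow> nat \<Rightarrow> nat \<Rightarrow> bool" where
  "ucert V F u0 u1 \<longleftrightarrow>
     (\<exists>D. \<forall>x. D x \<subseteq> V \<and> card (D x) \<le> (if F x then u1 else u0) \<and>
        (\<forall>x'. (\<forall>v\<in>D x. x' v = x v) \<longrightarrow> F x' = F x \<and> D x' = D x))"

text \<open>Certificates of a monotone function that use only variables of the same value as the function,
  so that under composition they are assembled from inner certificates of one kind only.\<close>

definition moncert :: "'p set \<Rightarrow> (('p \<Rightarrow> bool) \<Rightarrow> bool) \<Rightarrow> nat \<Rightarrow> nat \<Rightarrow> bool" where
  "moncert P h c0 c1 \<longleftrightarrow>
     (\<forall>y. \<exists>T\<subseteq>P. card T \<le> (if h y then c1 else c0) \<and> (\<forall>p\<in>T. y p = h y) \<and>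
        (\<forall>y'. (\<forall>p\<in>T. y' p = h y) \<longrightarrow> h y' = h y))"

lemma ucertE:
  assumes "ucert V F u0 u1"
  obtains D where "\<forall>x. D x \<subseteq> V" "\<forall>x. card (D x) \<le> (if F x then u1 else u0)"
    "\<forall>x x'. (\<forall>v\<in>D x. x' v = x v) \<longrightarrow> F x' = F x"
    "\<forall>x x'. (\<forall>v\<in>D x. x' v = x v) \<longrightarrow> D x' = D x"
proof -
  from assms obtain D where D: "\<forall>x. D x \<subseteq> V \<and> card (D x) \<le> (if F x then u1 else u0) \<and>
      (\<forall>x'. (\<forall>v\<in>D x. x' v = x v) \<longrightarrow> F x' = F x \<and> D x' = D x)"
    unfolding ucert_def by (rule exE)
  show ?thesis
  proof (rule that[of D]; intro allI impI)
    fix x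
    show "D x \<subseteq> V" by (rule D[THEN spec, THEN conjunct1])
    show "card (D x) \<le> (if F x then u1 else u0)" by (rule D[THEN spec, THEN conjunct2, THEN conjunct1])
    fix x' assume eq: "\<forall>v\<in>D x. x' v = x v"
    have "F x' = F x \<and> D x' = D x"
      by (rule D[THEN spec, THEN conjunct2, THEN conjunct2, THEN spec, THEN mp, OF eq])
    then show "F x' = F x" "D x' = D x" by simp_all
  qed
qed

lemma ucertI:
  assumes "\<And>x. D x \<subseteq> V" "\<And>x. card (D x) \<le> (if F x then u1 else u0)"
    "\<And>x x'. (\<forall>v\<in>D x. x' v = x v) \<Longrightarrow> F x' = F x \<and> D x' = D x"
  shows "ucert V F u0 u1"
  unfolding ucert_def
  by (rule exI[of _ D], rule allI, rule conjI[OF assms(1)], rule conjI[OF assms(2)], rule allI,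
      rule impI, rule assms(3), assumption)

lemma certifD:
  assumes "certif F D x" and eq: "\<And>v. v \<in> D \<Longrightarrow> x' v = x v"
  shows "F x' = F x"
  by (rule assms(1)[unfolded certif_def, THEN spec, THEN mp]) (rule ballI, rule eq)

lemma cert_mono:
  assumes "cert V F c0 c1" "c0 \<le> c0'" "c1 \<le> c1'"
  shows "cert V F c0' c1'"
  unfolding cert_def
proof
  fix x
  obtain D where "D \<subseteq> V" "card D \<le> (if F x then c1 else c0)" "certif F D x"
    using assms(1) unfolding cert_def by blast
  then show "\<exists>D\<subseteq>V. card D \<le> (if F x then c1' else c0') \<and> certif F D x"
    using assms(2,3) by (intro exI[of _ D]) (auto split: if_splits)
qed

lemma ucert_mono:
  assumes "ucert V F c0 c1" "c0 \<le> c0'" "c1 \<le> c1'"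
  shows "ucert V F c0' c1'"
proof -
  obtain D where reading: "\<forall>x. D x \<subseteq> V" "\<forall>x. card (D x) \<le> (if F x then c1 else c0)"
      "\<forall>x x'. (\<forall>v\<in>D x. x' v = x v) \<longrightarrow> F x' = F x"
      "\<forall>x x'. (\<forall>v\<in>D x. x' v = x v) \<longrightarrow> D x' = D x"
    using assms(1) by (rule ucertE)
  note D = reading[rule_format]
  show ?thesis
  proof (rule ucertI[of D])
    show "card (D x) \<le> (if F x then c1' else c0')" for x
      using D(2)[of x] assms(2,3) by (auto split: if_splits)
    show "F x' = F x \<and> D x' = D x" if "\<forall>v\<in>D x. x' v = x v" for x x'
      using D(3)[of x x'] D(4)[of x x'] that by simp
  qed (rule D(1))
qed

lemma ucert_depends_on:
  fixes F :: "('a \<Rightarrow> bool) \<Rightarrow> bool"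
  assumes "ucert V F u0 u1"
  shows "depends_on V F"
proof -
  obtain D where reading: "\<forall>x. D x \<subseteq> V" "\<forall>x x'. (\<forall>v\<in>D x. x' v = x v) \<longrightarrow> F x' = F x"
    using assms by (rule ucertE)
  note D = reading[rule_format]
  show ?thesis
    unfolding depends_on_def
  proof (intro allI impI)
    fix x x' :: "'a \<Rightarrow> bool" assume eq: "\<forall>v\<in>V. x' v = x v"
    show "F x' = F x" by (rule D(2)) (use eq D(1)[of x] in \<open>simp add: subset_iff\<close>)
  qed
qed

lemma moncert_depends_on:
  fixes h :: "('a \<Rightarrow> bool) \<Rightarrow> bool"
  assumes "moncert P h c0 c1"
  shows "depends_on P h"
  unfolding depends_on_def
proof (intro allI impI)
  fix x x' :: "'a \<Rightarrow> bool" assume eq: "\<forall>p\<in>P. x' p = x p"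
  obtain T where T: "T \<subseteq> P" "\<forall>p\<in>T. x p = h x" "\<forall>y'. (\<forall>p\<in>T. y' p = h x) \<longrightarrow> h y' = h x"
    using assms unfolding moncert_def by metis
  have "\<forall>p\<in>T. x' p = h x" using T(1,2) eq by (simp add: subset_iff)
  then show "h x' = h x" using T(3) by simp
qed

section \<open>Certificates under composition\<close>

lemma card_Sigma_le:
  assumes "finite I" "\<And>i. i \<in> I \<Longrightarrow> finite (A i)" "\<And>i. i \<in> I \<Longrightarrow> card (A i) \<le> n"
  shows "card (Sigma I A) \<le> card I * n"
proof -
  have "card (Sigma I A) = (\<Sum>i\<in>I. card (A i))" using assms by (simp add: card_SigmaI)
  also have "\<dots> \<le> card I * n" using sum_bounded_above[of I "\<lambda>i. card (A i)" n] assms(3) by simp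
  finally show ?thesis .
qed

lemma cert_compose:
  assumes "finite P" "finite V" and h: "moncert P h z w" and g: "cert V g c0 c1"
  shows "cert (P \<times> V) (block_compose h g) (z * c0) (w * c1)"
  unfolding cert_def
proof
  fix x :: "'a \<times> 'b \<Rightarrow> bool"
  let ?x = "\<lambda>p v. x (p, v)"
  let ?y = "\<lambda>p. g (?x p)"
  obtain T where T: "T \<subseteq> P" "card T \<le> (if h ?y then w else z)" "\<And>p. p \<in> T \<Longrightarrow> ?y p = h ?y"
      "\<And>y'. (\<forall>p\<in>T. y' p = h ?y) \<Longrightarrow> h y' = h ?y"
    using h unfolding moncert_def by metis
  have "\<forall>p. \<exists>D. D \<subseteq> V \<and> card D \<le> (if g (?x p) then c1 else c0) \<and> certif g D (?x p)"
    using g unfolding cert_def by blast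
  then obtain D where D: "\<forall>p. D p \<subseteq> V \<and> card (D p) \<le> (if g (?x p) then c1 else c0) \<and> certif g (D p) (?x p)"
    unfolding choice_iff by blast
  have DV: "D p \<subseteq> V" for p by (rule D[THEN spec, THEN conjunct1])
  have Dcard: "card (D p) \<le> (if g (?x p) then c1 else c0)" for p
    by (rule D[THEN spec, THEN conjunct2, THEN conjunct1])
  have Dcert: "certif g (D p) (?x p)" for p by (rule D[THEN spec, THEN conjunct2, THEN conjunct2])
  have finT: "finite T" by (rule finite_subset[OF T(1) assms(1)])
  let ?c = "if h ?y then c1 else c0"
  have "card (D p) \<le> ?c" if "p \<in> T" for p
  proof -
    show ?thesis using Dcard[of p] by (simp only: T(3)[OF that])
  qed
  then have "card (Sigma T D) \<le> card T * ?c"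
    by (intro card_Sigma_le finT finite_subset[OF DV assms(2)])
  also have "\<dots> \<le> (if h ?y then w * c1 else z * c0)" using T(2) by (cases "h ?y") simp_all
  finally have "card (Sigma T D) \<le> (if h ?y then w * c1 else z * c0)" .
  moreover have "Sigma T D \<subseteq> P \<times> V" by (intro Sigma_mono T(1) DV)
  moreover have "certif (block_compose h g) (Sigma T D) x"
    unfolding certif_def block_compose_def
  proof (intro allI impI)
    fix x' assume agree: "\<forall>v\<in>Sigma T D. x' v = x v"
    have "g (\<lambda>v. x' (p, v)) = h ?y" if "p \<in> T" for p
    proof -
      have "g (\<lambda>v. x' (p, v)) = g (?x p)" by (rule certifD[OF Dcert]) (use agree that in simp)
      then show ?thesis using T(3)[OF that] by (rule trans)
    qed
    then have "\<forall>p\<in>T. g (\<lambda>v. x' (p, v)) = h ?y" by (rule ballI)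
    then show "h (\<lambda>p. g (\<lambda>v. x' (p, v))) = h ?y" by (rule T(4)[of "\<lambda>p. g (\<lambda>v. x' (p, v))"])
  qed
  ultimately show "\<exists>D\<subseteq>P \<times> V. card D \<le> (if block_compose h g x then w * c1 else z * c0) \<and>
      certif (block_compose h g) D x"
    unfolding block_compose_def by (intro exI conjI)
qed

lemma moncert_and: "moncert {..<m} (and_fun m) 1 m"
  unfolding moncert_def
proof
  fix y
  show "\<exists>T\<subseteq>{..<m}. card T \<le> (if and_fun m y then m else 1) \<and> (\<forall>p\<in>T. y p = and_fun m y) \<and>
        (\<forall>y'. (\<forall>p\<in>T. y' p = and_fun m y) \<longrightarrow> and_fun m y' = and_fun m y)"
  proof (cases "and_fun m y")
    case True
    then show ?thesis by (intro exI[of _ "{..<m}"]) (auto simp: and_fun_def)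
  next
    case False
    then obtain i where "i < m" "\<not> y i" by (auto simp: and_fun_def)
    then show ?thesis using False by (intro exI[of _ "{i}"]) (auto simp: and_fun_def)
  qed
qed

lemma (in ksum) ksum_fun_mono:
  assumes "ksum_fun y'" "\<And>v. v \<in> vars \<Longrightarrow> y' v \<Longrightarrow> y v"
  shows "ksum_fun y"
proof -
  have SW: "((j, S j), b) \<in> W" if "S \<in> \<S>" "j < k" "b < r" for S j b
    using that by (auto simp: \<S>_def W_def P_def)
  from assms(1) consider e where "e \<in> W" "y' (e, True)" "y' (e, False)"
    | S x where "S \<in> \<S>" "x \<in> T S" "\<forall>j<k. \<forall>b<r. y' (((j, S j), b), ((j, S j), b) \<in> x)"
    unfolding ksum_fun_def by metis
  then show ?thesis
  proof cases
    case 1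
    then have "y (e, True)" "y (e, False)" using assms(2) by (simp_all add: vars_def)
    then show ?thesis unfolding ksum_fun_def using 1 by blast
  next
    case 2
    have "\<forall>j<k. \<forall>b<r. y (((j, S j), b), ((j, S j), b) \<in> x)"
      using 2(3) SW[OF 2(1)] assms(2) by (simp add: vars_def)
    then show ?thesis unfolding ksum_fun_def using 2 by blast
  qed
qed

text \<open>The variables that are off form a 0-certificate by monotonicity. A 1-certificate is a
  clash of two rails or the symbols of one solution.\<close>

lemma (in ksum) moncert_ksum: "moncert vars ksum_fun (card vars) (2 * k * r)"
  unfolding moncert_def
proof
  fix y
  have finv: "finite vars" using fin by (simp add: vars_def)
  have SW: "((j, S j), b) \<in> W" if "S \<in> \<S>" "j < k" "b < r" for S j b
    using that by (auto simp: \<S>_def W_def P_def)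
  show "\<exists>T\<subseteq>vars. card T \<le> (if ksum_fun y then 2 * k * r else card vars) \<and> (\<forall>p\<in>T. y p = ksum_fun y) \<and>
        (\<forall>y'. (\<forall>p\<in>T. y' p = ksum_fun y) \<longrightarrow> ksum_fun y' = ksum_fun y)"
  proof (cases "ksum_fun y")
    case True
    then consider e where "e \<in> W" "y (e, True)" "y (e, False)"
      | S x where "S \<in> \<S>" "x \<in> T S" "\<forall>j<k. \<forall>b<r. y (((j, S j), b), ((j, S j), b) \<in> x)"
      unfolding ksum_fun_def by metis
    then show ?thesis
    proof cases
      case 1
      \<comment> \<open>A clash takes 2 variables and a solution \<open>k * r\<close>. The common
        bound \<open>2 * k * r\<close>, times the fan-in \<open>M\<close> of the inner AND, equals
        \<open>card vars\<close>, so both kinds of certificates will have the same size in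
        \<open>hard_step\<close>.\<close>
      have "1 \<le> k * r" using k r by (simp add: Suc_le_eq)
      then have "2 \<le> 2 * k * r" by linarith
      then have "card {(e, True), (e, False)} \<le> 2 * k * r" by (rule order_trans[rotated]) simp
      moreover have "ksum_fun y'" if "y' (e, True)" "y' (e, False)" for y'
        unfolding ksum_fun_def using that 1 by blast
      ultimately show ?thesis using 1 True
        by (intro exI[of _ "{(e, True), (e, False)}"]) (auto simp: vars_def)
    next
      case 2
      define t where "t = (\<lambda>(j, b). (((j, S j), b), ((j, S j), b) \<in> x))"
      let ?T = "t ` ({..<k} \<times> {..<r})"
      have "card ?T \<le> k * r" using card_image_le[of "{..<k} \<times> {..<r}" t] by (simp add: card_cartesian_product)
      then have "card ?T \<le> 2 * k * r" by simp
      moreover have "?T \<subseteq> vars" using SW[OF 2(1)] by (auto simp: t_def vars_def)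
      moreover have "\<forall>p\<in>?T. y p" using 2(3) by (auto simp: t_def)
      moreover have "ksum_fun y'" if "\<forall>p\<in>?T. y' p" for y'
      proof -
        have "y' (((j, S j), b), ((j, S j), b) \<in> x)" if "j < k" "b < r" for j b
        proof -
          have "t (j, b) \<in> ?T" using that by (intro imageI) simp
          then have "y' (t (j, b))" using \<open>\<forall>p\<in>?T. y' p\<close> by blast
          then show ?thesis by (simp add: t_def)
        qed
        then show ?thesis unfolding ksum_fun_def using 2(1,2) by blast
      qed
      ultimately show ?thesis using True by (intro exI[of _ ?T]) simp
    qed
  next
    case False
    let ?T = "{v \<in> vars. \<not> y v}"
    have "card ?T \<le> card vars" using finv by (intro card_mono) auto
    moreover have "\<not> ksum_fun y'" if "\<forall>p\<in>?T. \<not> y' p" for y'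
      using False ksum_fun_mono[of y' y] that by blast
    ultimately show ?thesis using False by (intro exI[of _ ?T]) auto
  qed
qed

text \<open>Every outer position is read. For \<open>k\<close>-SUM over AND this is about
  \<open>M\<close> times more than an ordinary certificate, a loss that the cheat sheet later
  removes for 1-inputs.\<close>

lemma ucert_compose:
  assumes "finite P" "finite V" and h: "depends_on P h" and g: "ucert V g u u"
  shows "ucert (P \<times> V) (block_compose h g) (card P * u) (card P * u)"
proof -
  obtain D where reading: "\<forall>x. D x \<subseteq> V" "\<forall>x. card (D x) \<le> (if g x then u else u)"
      "\<forall>x x'. (\<forall>v\<in>D x. x' v = x v) \<longrightarrow> g x' = g x"
      "\<forall>x x'. (\<forall>v\<in>D x. x' v = x v) \<longrightarrow> D x' = D x"
    using g by (rule ucertE)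
  note D = reading[rule_format]
  have card: "card (D x) \<le> u" for x using D(2)[of x] by simp
  define E where "E = (\<lambda>x. Sigma P (\<lambda>p. D (\<lambda>v. x (p, v))))"
  have finD: "finite (D x)" for x by (rule finite_subset[OF D(1) assms(2)])
  show ?thesis
  proof (rule ucertI[of E])
    show "E x \<subseteq> P \<times> V" for x unfolding E_def by (intro Sigma_mono D(1) order_refl)
    show "card (E x) \<le> (if block_compose h g x then card P * u else card P * u)" for x
      using card_Sigma_le[OF assms(1), of "\<lambda>p. D (\<lambda>v. x (p, v))" u] finD card by (simp add: E_def)
    fix x x' assume agree: "\<forall>v\<in>E x. x' v = x v"
    have eq: "x' (p, v) = x (p, v)" if "p \<in> P" "v \<in> D (\<lambda>v. x (p, v))" for p v
      using agree that by (simp add: E_def)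
    have "D (\<lambda>v. x' (p, v)) = D (\<lambda>v. x (p, v))" if "p \<in> P" for p
      by (rule D(4)) (rule eq[OF that])
    then have "E x' = E x" unfolding E_def by (intro Sigma_cong refl)
    moreover have "g (\<lambda>v. x' (p, v)) = g (\<lambda>v. x (p, v))" if "p \<in> P" for p
      by (rule D(3)) (rule eq[OF that])
    then have "block_compose h g x' = block_compose h g x"
      using h unfolding block_compose_def depends_on_def by simp
    ultimately show "block_compose h g x' = block_compose h g x \<and> E x' = E x" by simp
  qed
qed

text \<open>Copies are read from left to right up to the first zero, so a 0-input needs only one
  0-certificate.\<close>

lemma ucert_and:
  assumes "finite V" and g: "ucert V g u0 u1"
  shows "ucert ({..<m} \<times> V) (block_compose (and_fun m) g) (m * u1 + u0) (m * u1)"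
proof -
  obtain D where reading: "\<forall>x. D x \<subseteq> V" "\<forall>x. card (D x) \<le> (if g x then u1 else u0)"
      "\<forall>x x'. (\<forall>v\<in>D x. x' v = x v) \<longrightarrow> g x' = g x"
      "\<forall>x x'. (\<forall>v\<in>D x. x' v = x v) \<longrightarrow> D x' = D x"
    using g by (rule ucertE)
  note D = reading[rule_format]
  \<comment> \<open>The positions up to and including the first zero, or all of them if there is
    none.\<close>
  define J where "J = (\<lambda>x. {i. i < m \<and> (\<forall>i'<i. g (\<lambda>v. x (i', v)))})"
  define E where "E = (\<lambda>x. Sigma (J x) (\<lambda>i. D (\<lambda>v. x (i, v))))"
  have finD: "finite (D x)" for x using D(1) assms(1) finite_subset by blast
  have finJ: "finite (J x)" for x by (simp add: J_def)
  have comp: "block_compose (and_fun m) g x \<longleftrightarrow> (\<forall>i<m. g (\<lambda>v. x (i, v)))" for x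
    by (simp add: block_compose_def and_fun_def)
  have first: "\<exists>i<m. \<not> g (\<lambda>v. x (i, v)) \<and> (\<forall>i'<i. g (\<lambda>v. x (i', v)))" if "i < m" "\<not> g (\<lambda>v. x (i, v))" for x i
  proof -
    define i0 where "i0 = (LEAST i. \<not> g (\<lambda>v. x (i, v)))"
    have "\<not> g (\<lambda>v. x (i0, v))" unfolding i0_def using that(2) by (rule LeastI)
    moreover have "i0 \<le> i" unfolding i0_def using that(2) by (rule Least_le)
    moreover have "g (\<lambda>v. x (i', v))" if "i' < i0" for i' using not_less_Least[of i'] that unfolding i0_def by blast
    ultimately show ?thesis using that(1) by (intro exI[of _ i0]) simp
  qed
  have firstF: "\<exists>i<m. \<not> g (\<lambda>v. x (i, v)) \<and> (\<forall>i'<i. g (\<lambda>v. x (i', v)))"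
    if nF: "\<not> block_compose (and_fun m) g x" for x
  proof -
    obtain i where "i < m" "\<not> g (\<lambda>v. x (i, v))" using nF unfolding comp by blast
    then show ?thesis by (rule first)
  qed
  have card1: "card (E x) \<le> (if block_compose (and_fun m) g x then m * u1 else m * u1 + u0)" for x
  proof (cases "block_compose (and_fun m) g x")
    case True
    have "card (D (\<lambda>v. x (i, v))) \<le> u1" if "i \<in> J x" for i
      using D(2)[of "\<lambda>v. x (i, v)"] that True by (simp add: comp J_def)
    then have "card (E x) \<le> card (J x) * u1"
      unfolding E_def using finJ finD by (intro card_Sigma_le)
    also have "J x \<subseteq> {..<m}" by (auto simp: J_def)
    then have "card (J x) * u1 \<le> m * u1" using card_mono[of "{..<m}" "J x"] by (intro mult_le_mono1) simp
    finally show ?thesis using True by simp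
  next
    case False
    obtain i0 where i0: "i0 < m" "\<not> g (\<lambda>v. x (i0, v))" "\<forall>i'<i0. g (\<lambda>v. x (i', v))"
      using firstF[OF False] by blast
    have J: "J x = insert i0 {..<i0}"
    proof
      show "J x \<subseteq> insert i0 {..<i0}"
      proof
        fix i assume "i \<in> J x"
        then have "\<not> i0 < i" using i0(2) by (auto simp: J_def)
        then show "i \<in> insert i0 {..<i0}" by auto
      qed
      show "insert i0 {..<i0} \<subseteq> J x" using i0 by (auto simp: J_def)
    qed
    have "card (E x) = (\<Sum>i\<in>J x. card (D (\<lambda>v. x (i, v))))"
      unfolding E_def using finJ finD by (simp add: card_SigmaI)
    also have "\<dots> = card (D (\<lambda>v. x (i0, v))) + (\<Sum>i<i0. card (D (\<lambda>v. x (i, v))))"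
      unfolding J by simp
    also have "\<dots> \<le> u0 + (\<Sum>i<i0. u1)"
    proof (intro add_mono sum_mono)
      show "card (D (\<lambda>v. x (i0, v))) \<le> u0" using D(2)[of "\<lambda>v. x (i0, v)"] i0 by simp
      show "card (D (\<lambda>v. x (i, v))) \<le> u1" if "i \<in> {..<i0}" for i using D(2)[of "\<lambda>v. x (i, v)"] i0 that by simp
    qed
    also have "\<dots> \<le> m * u1 + u0" using i0 by (simp add: mult_le_mono1)
    finally show ?thesis using False by simp
  qed
  have stable: "block_compose (and_fun m) g x' = block_compose (and_fun m) g x \<and> E x' = E x"
    if agree: "\<forall>v\<in>E x. x' v = x v" for x x'
  proof -
    have eq: "x' (i, v) = x (i, v)" if "i \<in> J x" "v \<in> D (\<lambda>v. x (i, v))" for i v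
      using agree that by (simp add: E_def)
    have same: "g (\<lambda>v. x' (i, v)) = g (\<lambda>v. x (i, v))" if "i \<in> J x" for i
      by (rule D(3)) (rule eq[OF that])
    have sameD: "D (\<lambda>v. x' (i, v)) = D (\<lambda>v. x (i, v))" if "i \<in> J x" for i
      by (rule D(4)) (rule eq[OF that])
    have down: "i' \<in> J x" if "i \<in> J x" "i' < i" for i i' using that by (auto simp: J_def)
    have J: "J x' = J x"
    proof (intro equalityI subsetI)
      fix i assume i: "i \<in> J x"
      have "g (\<lambda>v. x' (i', v))" if "i' < i" for i'
        using same[OF down[OF i that]] i that by (simp add: J_def)
      then show "i \<in> J x'" using i by (simp add: J_def)
    next
      fix i assume i: "i \<in> J x'"
      show "i \<in> J x"
      proof (rule ccontr)
        assume "i \<notin> J x"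
        then obtain i' where "i' < i" "\<not> g (\<lambda>v. x (i', v))" using i by (auto simp: J_def)
        then obtain i0 where i0: "i0 < m" "\<not> g (\<lambda>v. x (i0, v))" "\<forall>i'<i0. g (\<lambda>v. x (i', v))" "i0 \<le> i'"
        proof -
          define i0 where "i0 = (LEAST i. \<not> g (\<lambda>v. x (i, v)))"
          have "\<not> g (\<lambda>v. x (i0, v))" unfolding i0_def using \<open>\<not> g (\<lambda>v. x (i', v))\<close> by (rule LeastI)
          moreover have "i0 \<le> i'" unfolding i0_def using \<open>\<not> g (\<lambda>v. x (i', v))\<close> by (rule Least_le)
          moreover have "\<forall>i'<i0. g (\<lambda>v. x (i', v))" using not_less_Least unfolding i0_def by blast
          moreover have "i0 < m" using i \<open>i' < i\<close> \<open>i0 \<le> i'\<close> by (simp add: J_def)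
          ultimately show ?thesis using that by blast
        qed
        have "i0 \<in> J x" using i0 by (simp add: J_def)
        then have "\<not> g (\<lambda>v. x' (i0, v))" using same i0 by simp
        moreover have "i0 < i" using i0 \<open>i' < i\<close> by simp
        ultimately show False using i by (simp add: J_def)
      qed
    qed
    have "E x' = E x" unfolding E_def J by (intro Sigma_cong refl sameD)
    moreover have "block_compose (and_fun m) g x' = block_compose (and_fun m) g x"
    proof (cases "block_compose (and_fun m) g x")
      case True
      then have "i \<in> J x" if "i < m" for i using that by (simp add: J_def comp)
      then show ?thesis using True same by (simp add: comp)
    next
      case False
      obtain i0 where i0: "i0 < m" "\<not> g (\<lambda>v. x (i0, v))" "\<forall>i'<i0. g (\<lambda>v. x (i', v))"
        using firstF[OF False] by blast
      then have "i0 \<in> J x" by (simp add: J_def)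
      then have "\<not> g (\<lambda>v. x' (i0, v))" using same i0 by simp
      then have "\<not> block_compose (and_fun m) g x'" using i0(1) by (auto simp: comp)
      then show ?thesis using False by simp
    qed
    ultimately show ?thesis by simp
  qed
  have "E x \<subseteq> {..<m} \<times> V" for x using D(1) by (auto simp: E_def J_def)
  then show ?thesis by (rule ucertI[OF _ card1 stable])
qed

section \<open>The trivial query algorithm\<close>

lemma card_cube: "finite (cube N)" "card (cube N) = 2 ^ N"
proof -
  have "cube N = {xs. set xs \<subseteq> (UNIV :: bool set) \<and> length xs = N}" by (simp add: cube_def)
  then show "finite (cube N)" "card (cube N) = 2 ^ N"
    using finite_lists_length_eq[of "UNIV :: bool set" N] card_lists_length_eq[of "UNIV :: bool set" N]
    by simp_all
qed

definition perm_mat :: "nat \<Rightarrow> (nat \<Rightarrow> nat) \<Rightarrow> complex mat" where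
  "perm_mat d \<pi> = mat d d (\<lambda>(r, c). if r = \<pi> c then 1 else 0)"

lemma perm_mat_unit_vec:
  assumes "c < d" "\<pi> c < d"
  shows "perm_mat d \<pi> *\<^sub>v unit_vec d c = unit_vec d (\<pi> c)"
proof (rule eq_vecI)
  fix r assume "r < dim_vec (unit_vec d (\<pi> c) :: complex vec)"
  then have r: "r < d" by simp
  have "(perm_mat d \<pi> *\<^sub>v unit_vec d c) $ r = (\<Sum>j<d. (if r = \<pi> j then 1 else 0) * (if j = c then 1 else 0))"
    using r by (simp add: perm_mat_def scalar_prod_def lessThan_atLeast0 unit_vec_def)
  also have "\<dots> = (\<Sum>j<d. if j = c then (if r = \<pi> c then 1 else 0) else 0)"
    by (intro sum.cong refl) simp
  also have "\<dots> = unit_vec d (\<pi> c) $ r" using assms r by (simp add: unit_vec_def)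
  finally show "(perm_mat d \<pi> *\<^sub>v unit_vec d c) $ r = unit_vec d (\<pi> c) $ r" .
qed (simp add: perm_mat_def)

lemma unitary_perm_mat:
  assumes bij: "bij_betw \<pi> {..<d} {..<d}"
  shows "unitary_mat d (perm_mat d \<pi>)"
proof -
  have dim: "perm_mat d \<pi> \<in> carrier_mat d d" by (simp add: perm_mat_def)
  then have adim: "mat_adjoint (perm_mat d \<pi>) \<in> carrier_mat d d"
    by (auto simp: mat_adjoint_def mat_of_rows_def)
  have P: "perm_mat d \<pi> $$ (i, j) = (if i = \<pi> j then 1 else 0)" if "i < d" "j < d" for i j
    using that by (simp add: perm_mat_def)
  have A: "mat_adjoint (perm_mat d \<pi>) $$ (i, j) = (if j = \<pi> i then 1 else 0)" if "i < d" "j < d" for i j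
    using that by (simp add: mat_adjoint_index[OF dim] P)
  have less: "\<pi> i < d" if "i < d" for i using bij that by (auto simp: bij_betw_def)
  have "mat_adjoint (perm_mat d \<pi>) * perm_mat d \<pi> = 1\<^sub>m d"
  proof (rule eq_matI)
    fix i j assume "i < dim_row (1\<^sub>m d :: complex mat)" "j < dim_col (1\<^sub>m d :: complex mat)"
    then have ij: "i < d" "j < d" by simp_all
    have "(mat_adjoint (perm_mat d \<pi>) * perm_mat d \<pi>) $$ (i, j) =
        (\<Sum>k<d. mat_adjoint (perm_mat d \<pi>) $$ (i, k) * perm_mat d \<pi> $$ (k, j))"
      using ij dim adim by (simp add: scalar_prod_def lessThan_atLeast0)
    also have "\<dots> = (\<Sum>k<d. if k = \<pi> i then (if \<pi> i = \<pi> j then 1 else 0) else 0)"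
      using ij by (intro sum.cong refl) (simp add: A P)
    also have "\<dots> = (if \<pi> i = \<pi> j then 1 else 0)" using less ij by simp
    also have "\<dots> = 1\<^sub>m d $$ (i, j)"
      using bij ij by (auto simp: bij_betw_def dest: inj_onD)
    finally show "(mat_adjoint (perm_mat d \<pi>) * perm_mat d \<pi>) $$ (i, j) = 1\<^sub>m d $$ (i, j)" .
  qed (use dim adim in auto)
  moreover have "perm_mat d \<pi> * mat_adjoint (perm_mat d \<pi>) = 1\<^sub>m d"
  proof (rule eq_matI)
    fix i j assume "i < dim_row (1\<^sub>m d :: complex mat)" "j < dim_col (1\<^sub>m d :: complex mat)"
    then have ij: "i < d" "j < d" by simp_all
    have "i \<in> \<pi> ` {..<d}" using bij ij by (simp add: bij_betw_def)
    then obtain i' where i': "i' < d" "\<pi> i' = i" by auto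
    have "(perm_mat d \<pi> * mat_adjoint (perm_mat d \<pi>)) $$ (i, j) =
        (\<Sum>k<d. perm_mat d \<pi> $$ (i, k) * mat_adjoint (perm_mat d \<pi>) $$ (k, j))"
      using ij dim adim by (simp add: scalar_prod_def lessThan_atLeast0)
    also have "\<dots> = (\<Sum>k<d. if k = i' then (if i = j then 1 else 0) else 0)"
    proof (intro sum.cong refl)
      fix k assume "k \<in> {..<d}"
      then have k: "k < d" by simp
      have "i = \<pi> k \<longleftrightarrow> k = i'" using bij i' k by (auto simp: bij_betw_def dest: inj_onD)
      then show "perm_mat d \<pi> $$ (i, k) * mat_adjoint (perm_mat d \<pi>) $$ (k, j) =
          (if k = i' then (if i = j then 1 else 0) else 0)"
        using i' by (simp add: P[OF ij(1) k] A[OF k ij(2)])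
    qed
    also have "\<dots> = (if i = j then 1 else 0)" using i' by simp
    also have "\<dots> = 1\<^sub>m d $$ (i, j)" using ij by simp
    finally show "(perm_mat d \<pi> * mat_adjoint (perm_mat d \<pi>)) $$ (i, j) = 1\<^sub>m d $$ (i, j)" .
  qed (use dim adim in auto)
  ultimately show ?thesis using dim by (simp add: unitary_mat_def)
qed

lemma oracle_mat_unit_vec:
  assumes "m > 0" "c < 2 * N * m"
  shows "oracle_mat N m x *\<^sub>v unit_vec (2 * N * m) c = unit_vec (2 * N * m) (oracle_perm m x c)"
proof (rule eq_vecI)
  let ?d = "2 * N * m"
  fix r assume "r < dim_vec (unit_vec ?d (oracle_perm m x c) :: complex vec)"
  then have r: "r < ?d" by simp
  have inv: "oracle_perm m x (oracle_perm m x s) = s" for s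
    using oracle_perm_comp[OF assms(1), of x x s] by simp
  have "(oracle_mat N m x *\<^sub>v unit_vec ?d c) $ r = unit_vec ?d c $ oracle_perm m x r"
    using assms r by (simp add: oracle_mat_mult_index)
  also have "\<dots> = (if oracle_perm m x r = c then 1 else 0)"
    using assms oracle_perm_less[OF assms(1) r, of x] by (simp add: unit_vec_def)
  also have "oracle_perm m x r = c \<longleftrightarrow> r = oracle_perm m x c" using inv by metis
  also have "(if r = oracle_perm m x c then 1 else 0) = unit_vec ?d (oracle_perm m x c) $ r"
    using r oracle_perm_less[OF assms, of x] by (simp add: unit_vec_def)
  finally show "(oracle_mat N m x *\<^sub>v unit_vec ?d c) $ r = unit_vec ?d (oracle_perm m x c) $ r" .
qed (simp add: oracle_mat_def)

text \<open>The trivial algorithm: the query register counts through the input, and the answer to each query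
  is swapped into the workspace.\<close>

lemma quantum_computes_trivial:
  assumes "N > 0"
  shows "quantum_computes N f N"
proof -
  define m :: nat where "m = 2 ^ N"
  have m: "m > 0" by (simp add: m_def)
  obtain \<beta> where \<beta>: "bij_betw \<beta> (cube N) {..<m}"
    using finite_same_card_bij[OF card_cube(1)[of N] finite_lessThan[of m]]
    by (auto simp: card_cube m_def)
  define dec where "dec = the_inv_into (cube N) \<beta>"
  have \<beta>less: "\<beta> w < m" if "length w = N" for w
    using \<beta> that by (auto simp: bij_betw_def cube_def)
  have dec\<beta>: "dec (\<beta> w) = w" if "length w = N" for w
    unfolding dec_def using \<beta> that by (intro the_inv_into_f_f) (auto simp: bij_betw_def cube_def)
  have \<beta>dec: "\<beta> (dec z) = z" "length (dec z) = N" if "z < m" for z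
  proof -
    have "z \<in> \<beta> ` cube N" using \<beta> that by (auto simp: bij_betw_def)
    then obtain w where "w \<in> cube N" "z = \<beta> w" by blast
    then show "\<beta> (dec z) = z" "length (dec z) = N" using dec\<beta>[of w] by (auto simp: cube_def)
  qed
  define d where "d = 2 * N * m"
  define code where "code = (\<lambda>i b w. (2 * i + of_bool b) * m + \<beta> w)"
  have parts: "query_index m (code i b w) = i" "target_bit m (code i b w) = b" "work_part m (code i b w) = \<beta> w"
    if "length w = N" for i b w
  proof -
    have "code i b w div m = 2 * i + of_bool b" "code i b w mod m = \<beta> w"
      using \<beta>less[OF that] m by (simp_all add: code_def)
    then show "query_index m (code i b w) = i" "target_bit m (code i b w) = b" "work_part m (code i b w) = \<beta> w"
      by (cases b; simp add: query_index_def target_bit_def work_part_def)+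
  qed
  have code_less: "code i b w < d" if "length w = N" "i < N" for i b w
    unfolding d_def using parts(1)[OF that(1), of i b] that query_index_less_iff[OF m, of "code i b w" N] by simp
  \<comment> \<open>Advances the query index and swaps the target bit with entry \<open>i\<close> of
    the stored word; swapping instead of copying keeps the map a permutation.\<close>
  define \<pi> where "\<pi> = (\<lambda>c. let i = query_index m c; w = dec (work_part m c) in
      code ((i + 1) mod N) (w ! i) (w[i := target_bit m c]))"
  have \<pi>code: "\<pi> (code i b w) = code ((i + 1) mod N) (w ! i) (w[i := b])" if "length w = N" for i b w
    using that by (simp add: \<pi>_def Let_def parts dec\<beta>)
  have surj: "\<exists>i b w. i < N \<and> length w = N \<and> c = code i b w" if "c < d" for c
  proof (intro exI conjI)
    let ?w = "dec (work_part m c)"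
    have z: "work_part m c < m" using m by (simp add: work_part_def)
    show "query_index m c < N" using that by (simp add: query_index_less_iff[OF m] d_def)
    show "length ?w = N" using \<beta>dec[OF z] by simp
    show "c = code (query_index m c) (target_bit m c) ?w"
      by (rule basis_index_eqI[where m = m]) (simp_all add: parts \<beta>dec[OF z])
  qed
  have "inj_on \<pi> {..<d}"
  proof (rule inj_onI)
    fix c c' assume "c \<in> {..<d}" "c' \<in> {..<d}" and eq: "\<pi> c = \<pi> c'"
    then obtain i b w i' b' w' where c: "c = code i b w" "i < N" "length w = N"
      and c': "c' = code i' b' w'" "i' < N" "length w' = N"
      using surj[of c] surj[of c'] by auto
    have eq': "code ((i + 1) mod N) (w ! i) (w[i := b]) = code ((i' + 1) mod N) (w' ! i') (w'[i' := b'])"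
      using eq c c' by (simp add: \<pi>code)
    have len: "length (w[i := b]) = N" "length (w'[i' := b']) = N" using c c' by simp_all
    have "(i + 1) mod N = (i' + 1) mod N" using arg_cong[OF eq', of "query_index m"] len by (simp add: parts)
    then have i: "i = i'" using c c' by (auto simp: mod_Suc split: if_splits)
    have wi: "w ! i = w' ! i" using arg_cong[OF eq', of "target_bit m"] len i by (simp add: parts)
    have "\<beta> (w[i := b]) = \<beta> (w'[i := b'])" using arg_cong[OF eq', of "work_part m"] len i by (simp add: parts)
    then have upd: "w[i := b] = w'[i := b']" using dec\<beta>[OF len(1)] dec\<beta>[OF len(2)] i by metis
    have "b = b'" using arg_cong[OF upd, of "\<lambda>w. w ! i"] c c' i by simp
    moreover have "w = w'"
    proof -
      have "w = (w[i := b])[i := w ! i]" by simp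
      also have "\<dots> = (w'[i := b'])[i := w' ! i]" unfolding upd wi ..
      also have "\<dots> = w'" by simp
      finally show ?thesis .
    qed
    ultimately show "c = c'" using c c' i by simp
  qed
  moreover have "\<pi> ` {..<d} \<subseteq> {..<d}"
  proof
    fix c' assume "c' \<in> \<pi> ` {..<d}"
    then obtain c where "c < d" "c' = \<pi> c" by auto
    then show "c' \<in> {..<d}" using surj[of c] assms by (auto simp: \<pi>code intro!: code_less)
  qed
  ultimately have bij: "bij_betw \<pi> {..<d} {..<d}"
    by (simp add: bij_betw_def endo_inj_surj)
  define wt where "wt = (\<lambda>x t. take t x @ replicate (N - t) False)"
  have len_wt: "length (wt x t) = N" if "length x = N" "t \<le> N" for x t
    using that by (simp add: wt_def)
  define s where "s = code 0 False (wt (replicate N False) 0)"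
  have s: "s < d" using assms by (simp add: s_def code_less len_wt)
  \<comment> \<open>The algorithm starts in basis vector 0, but the blank word may have any number
    under \<open>\<beta>\<close>; the first unitary exchanges the two.\<close>
  define \<pi>0 where "\<pi>0 = (\<lambda>c. if c = 0 then s else if c = s then 0 else c)"
  have bij0: "bij_betw \<pi>0 {..<d} {..<d}"
    by (rule bij_betw_byWitness[where f' = \<pi>0]) (use s in \<open>auto simp: \<pi>0_def\<close>)
  define U where "U = (\<lambda>t :: nat. if t = 0 then perm_mat d \<pi>0 else perm_mat d \<pi>)"
  have U: "unitary_mat d (U t)" for t
    using unitary_perm_mat[OF bij] unitary_perm_mat[OF bij0] by (simp add: U_def)
  have state: "query_state N m U x t = unit_vec d (code (t mod N) False (wt x t))"
    if "length x = N" "t \<le> N" for x t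
    using that(2)
  proof (induction t)
    case 0
    have "0 < d" using s by simp
    then have "perm_mat d \<pi>0 *\<^sub>v unit_vec d 0 = unit_vec d s"
      using perm_mat_unit_vec[of 0 d \<pi>0] s by (simp add: \<pi>0_def)
    then show ?case by (simp add: U_def d_def[symmetric] s_def wt_def)
  next
    case (Suc t)
    let ?w = "wt x t"
    have t: "t < N" and len: "length ?w = N" using Suc.prems len_wt that(1) by auto
    have "oracle_perm m x (code t False ?w) = code t (x ! t) ?w"
      by (rule basis_index_eqI[where m = m])
        (simp_all add: oracle_perm_def parts len query_index_flip[OF m] target_bit_flip[OF m] work_part_flip[OF m])
    then have "oracle_mat N m x *\<^sub>v unit_vec d (code t False ?w) = unit_vec d (code t (x ! t) ?w)"
      using oracle_mat_unit_vec[OF m, of "code t False ?w" N x] code_less[OF len t] by (simp add: d_def)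
    moreover have "perm_mat d \<pi> *\<^sub>v unit_vec d (code t (x ! t) ?w) = unit_vec d (\<pi> (code t (x ! t) ?w))"
    proof (rule perm_mat_unit_vec)
      show c: "code t (x ! t) ?w < d" by (rule code_less[OF len t])
      show "\<pi> (code t (x ! t) ?w) < d" using bij c by (auto simp: bij_betw_def)
    qed
    moreover have "\<pi> (code t (x ! t) ?w) = code (Suc t mod N) False (wt x (Suc t))"
    proof -
      have "?w ! t = False" using t that(1) by (simp add: wt_def nth_append)
      moreover have "?w[t := x ! t] = wt x (Suc t)"
        by (rule nth_equalityI) (use t that(1) in \<open>auto simp: wt_def nth_append nth_list_update\<close>)
      ultimately show ?thesis by (simp add: \<pi>code[OF len])
    qed
    ultimately show ?case using Suc t by (simp add: U_def)
  qed
  define out where "out = (\<lambda>r. f (dec (work_part m r)))"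
  have "output_prob N m U out N x (f x) = 1" if "x \<in> cube N" for x
  proof -
    have lx: "length x = N" using that by (simp add: cube_def)
    define c where "c = code (N mod N) False (wt x N)"
    have wx: "wt x N = x" using lx by (simp add: wt_def)
    have c: "c < d" "out c = f x"
      using assms code_less[OF lx] by (simp_all add: c_def wx out_def parts lx dec\<beta>)
    have "output_prob N m U out N x (f x) = (\<Sum>r | r < d \<and> out r = f x. if r = c then 1 else 0)"
      unfolding output_prob_def state[OF lx order_refl] d_def[symmetric] c_def[symmetric]
      by (intro sum.cong refl) (use c in \<open>auto simp: unit_vec_def\<close>)
    then show ?thesis using c by simp
  qed
  then have "\<forall>x\<in>cube N. output_prob N m U out N x (f x) \<ge> 2 / 3" by simp
  moreover have "\<forall>t\<le>N. unitary_mat (2 * N * m) (U t)" using U by (simp add: d_def)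
  ultimately show ?thesis unfolding quantum_computes_def using m by blast
qed

section \<open>Certificates of cheat sheets\<close>

lemma certif_cong:
  assumes "\<forall>v\<in>D. x' v = x v" "F x' = F x"
  shows "certif F D x' \<longleftrightarrow> certif F D x"
proof -
  have "(\<forall>v\<in>D. y v = x' v) \<longleftrightarrow> (\<forall>v\<in>D. y v = x v)" for y using assms(1) by simp
  then show ?thesis unfolding certif_def assms(2) by simp
qed

text \<open>\<open>E j\<close> is a set read in copy \<open>j\<close> on top of the one stored in
  the cell. The decoded sets are always read, so that the validity of the stored certificates is
  determined.\<close>

definition cs_read ::
  "nat \<Rightarrow> nat \<Rightarrow> (nat set \<Rightarrow> nat \<Rightarrow> 'v set) \<Rightarrow> (('v \<Rightarrow> bool) \<Rightarrow> bool) \<Rightarrow> (nat \<Rightarrow> 'v set) \<Rightarrow>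
    (nat \<times> 'v + bool list \<times> nat \<Rightarrow> bool) \<Rightarrow> (nat \<times> 'v + bool list \<times> nat) set" where
  "cs_read c B dec F E z =
     Inl ` Sigma {..<c} (\<lambda>j. E j \<union> dec (cs_cell B z (cs_label c F z)) j) \<union> Inr ` ({cs_label c F z} \<times> {..B})"

lemma cs_read_vars:
  assumes "\<And>j. j < c \<Longrightarrow> E j \<subseteq> V" "\<And>S j. dec S j \<subseteq> V"
  shows "cs_read c B dec F E z \<subseteq> cs_vars c B V"
proof -
  have "Sigma {..<c} (\<lambda>j. E j \<union> dec (cs_cell B z (cs_label c F z)) j) \<subseteq> {..<c} \<times> V"
    using assms by blast
  moreover have "length (cs_label c F z) = c" by (simp add: cs_label_def)
  then have "{cs_label c F z} \<times> {..B} \<subseteq> {l. length l = c} \<times> {..B}" by blast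
  ultimately show ?thesis unfolding cs_read_def cs_vars_def by (intro Un_mono image_mono)
qed

lemma card_cs_read:
  assumes "finite V" "\<And>j. j < c \<Longrightarrow> E j \<subseteq> V" "\<And>S j. dec S j \<subseteq> V"
    and "\<And>j. j < c \<Longrightarrow> card (E j) \<le> u" "\<And>S j. card (dec S j) \<le> C"
  shows "card (cs_read c B dec F E z) \<le> c * (u + C) + (B + 1)"
proof -
  let ?S = "Sigma {..<c} (\<lambda>j. E j \<union> dec (cs_cell B z (cs_label c F z)) j)"
  have "card (cs_read c B dec F E z) \<le> card (Inl ` ?S :: (nat \<times> 'a + bool list \<times> nat) set) +
      card (Inr ` ({cs_label c F z} \<times> {..B}) :: (nat \<times> 'a + bool list \<times> nat) set)"
    unfolding cs_read_def by (rule card_Un_le)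
  also have "\<dots> = card ?S + (B + 1)"
    by (simp add: card_image card_cartesian_product)
  also have "card ?S \<le> card {..<c} * (u + C)"
  proof (rule card_Sigma_le)
    fix j assume "j \<in> {..<c}"
    then have j: "j < c" by simp
    show "finite (E j \<union> dec (cs_cell B z (cs_label c F z)) j)"
      using assms(1) assms(2)[OF j] assms(3) by (meson finite_UnI finite_subset)
    show "card (E j \<union> dec (cs_cell B z (cs_label c F z)) j) \<le> u + C"
      using card_Un_le[of "E j" "dec (cs_cell B z (cs_label c F z)) j"] assms(4)[OF j]
        assms(5)[of "cs_cell B z (cs_label c F z)" j] by linarith
  qed simp
  finally show ?thesis by simp
qed

text \<open>The sets read certify every copy, which fixes the label; the label fixes the cell and
  thereby the decoded sets, on which the input is fixed too. So the validity of the stored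
  certificates cannot change.\<close>

lemma cs_read_agree:
  assumes E: "\<forall>j<c. certif F (E j \<union> dec (cs_cell B z (cs_label c F z)) j) (\<lambda>v. z (Inl (j, v)))"
    and agree: "\<forall>u\<in>cs_read c B dec F E z. z' u = z u"
  shows "cs_label c F z' = cs_label c F z"
    and "cs_cell B z' (cs_label c F z) = cs_cell B z (cs_label c F z)"
    and "cheat_sheet c B dec F z' \<longleftrightarrow> cheat_sheet c B dec F z"
    and "\<And>j v. j < c \<Longrightarrow> v \<in> E j \<Longrightarrow> z' (Inl (j, v)) = z (Inl (j, v))"
proof -
  let ?l = "cs_label c F z"
  have copy: "z' (Inl (j, v)) = z (Inl (j, v))" if "j < c" "v \<in> E j \<union> dec (cs_cell B z ?l) j" for j v
  proof -
    have "Inl (j, v) \<in> cs_read c B dec F E z"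
      unfolding cs_read_def by (rule UnI1, rule imageI, rule SigmaI, simp add: that(1), rule that(2))
    then show ?thesis using agree by blast
  qed
  have cellbit: "z' (Inr (?l, i)) = z (Inr (?l, i))" if "i \<le> B" for i
  proof -
    have "Inr (?l, i) \<in> cs_read c B dec F E z"
      unfolding cs_read_def by (rule UnI2, rule imageI, rule SigmaI) (simp_all add: that)
    then show ?thesis using agree by blast
  qed
  have Fsame: "F (\<lambda>v. z' (Inl (j, v))) = F (\<lambda>v. z (Inl (j, v)))" if "j < c" for j
    by (rule certifD[OF E[rule_format, OF that]]) (rule copy[OF that])
  show l: "cs_label c F z' = ?l" by (simp add: cs_label_def Fsame)
  show cell: "cs_cell B z' ?l = cs_cell B z ?l" by (auto simp: cs_cell_def cellbit)
  show "z' (Inl (j, v)) = z (Inl (j, v))" if "j < c" "v \<in> E j" for j v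
    using copy that by simp
  have "certif F (dec (cs_cell B z ?l) j) (\<lambda>v. z' (Inl (j, v))) \<longleftrightarrow>
      certif F (dec (cs_cell B z ?l) j) (\<lambda>v. z (Inl (j, v)))" if "j < c" for j
    by (rule certif_cong) (use copy[OF that] Fsame[OF that] in simp_all)
  then show "cheat_sheet c B dec F z' \<longleftrightarrow> cheat_sheet c B dec F z"
    unfolding cheat_sheet_def Let_def l cell using cellbit[of 0] by simp
qed

lemma certif_mono:
  assumes "certif F D x" "D \<subseteq> D'"
  shows "certif F D' x"
  unfolding certif_def
proof (intro allI impI)
  fix x' assume eq: "\<forall>v\<in>D'. x' v = x v"
  show "F x' = F x"
    by (rule certifD[OF assms(1)], rule bspec[OF eq], rule subsetD[OF assms(2)])
qed

text \<open>A certificate of each copy, the cell of the label and the sets decoded from it settle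
  either value.\<close>

lemma cert_cheat_sheet:
  assumes "finite V" and dec: "\<And>S j. dec S j \<subseteq> V" "\<And>S j. card (dec S j) \<le> C"
    and F: "cert V F C C"
  shows "cert (cs_vars c B V) (cheat_sheet c B dec F) (c * (C + C) + (B + 1)) (c * (C + C) + (B + 1))"
  unfolding cert_def
proof
  fix z :: "nat \<times> 'a + bool list \<times> nat \<Rightarrow> bool"
  have "\<forall>j. \<exists>D. D \<subseteq> V \<and> card D \<le> C \<and> certif F D (\<lambda>v. z (Inl (j, v)))"
    using F unfolding cert_def by simp
  then obtain E where E: "\<forall>j. E j \<subseteq> V \<and> card (E j) \<le> C \<and> certif F (E j) (\<lambda>v. z (Inl (j, v)))"
    unfolding choice_iff by blast
  have EV: "E j \<subseteq> V" and Ecard: "card (E j) \<le> C" and Ecert: "certif F (E j) (\<lambda>v. z (Inl (j, v)))" for j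
    using E by simp_all
  let ?D = "cs_read c B dec F E z"
  have "?D \<subseteq> cs_vars c B V" by (rule cs_read_vars[OF EV dec(1)])
  moreover have "card ?D \<le> (if cheat_sheet c B dec F z then c * (C + C) + (B + 1) else c * (C + C) + (B + 1))"
    using card_cs_read[OF assms(1) EV dec(1) Ecard dec(2)] by simp
  moreover have "certif (cheat_sheet c B dec F) ?D z"
    unfolding certif_def
  proof (intro allI impI)
    fix z' assume agree: "\<forall>u\<in>?D. z' u = z u"
    have "\<forall>j<c. certif F (E j \<union> dec (cs_cell B z (cs_label c F z)) j) (\<lambda>v. z (Inl (j, v)))"
      by (intro allI impI, rule certif_mono[OF Ecert]) simp
    from cs_read_agree(3)[OF this agree] show "cheat_sheet c B dec F z' = cheat_sheet c B dec F z" .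
  qed
  ultimately show "\<exists>D\<subseteq>cs_vars c B V. card D \<le> (if cheat_sheet c B dec F z then c * (C + C) + (B + 1)
      else c * (C + C) + (B + 1)) \<and> certif (cheat_sheet c B dec F) D z"
    by (intro exI conjI)
qed

text \<open>On a 1-input the label is certified by the contents of the cell it points to, so no unambiguous
  certificates of the copies have to be read.\<close>

lemma ucert_cheat_sheet:
  assumes "finite V" and dec: "\<And>S j. dec S j \<subseteq> V" "\<And>S j. card (dec S j) \<le> C"
    and F: "ucert V F u u"
  shows "ucert (cs_vars c B V) (cheat_sheet c B dec F) (c * (u + C) + (B + 1)) (c * C + (B + 1))"
proof -
  obtain D where reading: "\<forall>x. D x \<subseteq> V" "\<forall>x. card (D x) \<le> (if F x then u else u)"
      "\<forall>x x'. (\<forall>v\<in>D x. x' v = x v) \<longrightarrow> F x' = F x"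
      "\<forall>x x'. (\<forall>v\<in>D x. x' v = x v) \<longrightarrow> D x' = D x"
    using F by (rule ucertE)
  note D = reading[rule_format]
  have cardD: "card (D x) \<le> u" for x using D(2)[of x] by simp
  define E where "E = (\<lambda>z :: nat \<times> 'a + bool list \<times> nat \<Rightarrow> bool. \<lambda>j.
      if cheat_sheet c B dec F z then {} else D (\<lambda>v. z (Inl (j, v))))"
  define R where "R = (\<lambda>z. cs_read c B dec F (E z) z)"
  have EV: "E z j \<subseteq> V" for z j using D(1) by (simp add: E_def)
  have RV: "R z \<subseteq> cs_vars c B V" for z
    unfolding R_def by (rule cs_read_vars[OF EV dec(1)])
  have Rcard: "card (R z) \<le> (if cheat_sheet c B dec F z then c * C + (B + 1) else c * (u + C) + (B + 1))" for z
  proof (cases "cheat_sheet c B dec F z")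
    case True
    have "card (R z) \<le> c * (0 + C) + (B + 1)"
      unfolding R_def by (rule card_cs_read[OF assms(1) EV dec(1) _ dec(2)]) (simp add: E_def True)
    then show ?thesis using True by simp
  next
    case False
    have "card (R z) \<le> c * (u + C) + (B + 1)"
      unfolding R_def by (rule card_cs_read[OF assms(1) EV dec(1) _ dec(2)]) (simp add: E_def False cardD)
    then show ?thesis using False by simp
  qed
  have stable: "cheat_sheet c B dec F z' = cheat_sheet c B dec F z \<and> R z' = R z"
    if agree: "\<forall>u\<in>R z. z' u = z u" for z z'
  proof -
    let ?cell = "cs_cell B z (cs_label c F z)"
    have certD: "certif F (D x) x" for x unfolding certif_def using reading(3) by blast
    have cert: "certif F (E z j \<union> dec ?cell j) (\<lambda>v. z (Inl (j, v)))" if "j < c" for j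
    proof (cases "cheat_sheet c B dec F z")
      case True
      then have "certif F (dec ?cell j) (\<lambda>v. z (Inl (j, v)))"
        using that by (simp add: cheat_sheet_def Let_def)
      then show ?thesis by (rule certif_mono) auto
    next
      case False
      show ?thesis by (rule certif_mono[OF certD]) (simp add: E_def False)
    qed
    then have "\<forall>j<c. certif F (E z j \<union> dec ?cell j) (\<lambda>v. z (Inl (j, v)))" by simp
    note same = cs_read_agree[OF this agree[unfolded R_def]]
    have "E z' j = E z j" if "j < c" for j
    proof (cases "cheat_sheet c B dec F z")
      case True
      then show ?thesis using same(3) by (simp add: E_def)
    next
      case False
      have "D (\<lambda>v. z' (Inl (j, v))) = D (\<lambda>v. z (Inl (j, v)))"
        by (rule D(4)) (rule same(4)[OF that], simp add: E_def False)
      then show ?thesis using same(3) by (simp add: E_def)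
    qed
    then have "Sigma {..<c} (\<lambda>j. E z' j \<union> dec ?cell j) = Sigma {..<c} (\<lambda>j. E z j \<union> dec ?cell j)"
      by (intro Sigma_cong refl) simp
    then have "R z' = R z" unfolding R_def cs_read_def same(1,2) by simp
    then show ?thesis using same(3) by simp
  qed
  show ?thesis by (rule ucertI[OF RV Rcard stable])
qed

text \<open>Composition and cheat sheets change the type of the variables, whereas an induction on
  the depth works in a fixed type. After every round the variables are therefore renamed into
  \<open>nat\<close>.\<close>

definition rename :: "('v \<Rightarrow> 'w) \<Rightarrow> (('v \<Rightarrow> bool) \<Rightarrow> bool) \<Rightarrow> ('w \<Rightarrow> bool) \<Rightarrow> bool" where
  "rename \<phi> F x = F (\<lambda>v. x (\<phi> v))"

lemma adv_rename:
  assumes "inj \<phi>" "adv V F A"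
  shows "adv (\<phi> ` V) (rename \<phi> F) A"
proof -
  obtain Y :: "bool \<Rightarrow> nat set" and \<xi> G w where F: "adversary V F A Y \<xi> G w"
    using assms unfolding adv_def by blast
  have "(\<lambda>v. \<xi> y (inv_into UNIV \<phi> (\<phi> v))) = \<xi> y" for y using assms(1) by simp
  then have "adversary (\<phi> ` V) (rename \<phi> F) A Y (\<lambda>y u. \<xi> y (inv_into UNIV \<phi> u)) G w"
    using F assms(1) unfolding adversary_def by (simp add: rename_def)
  then show ?thesis by (rule advI)
qed

lemma certif_rename:
  assumes "certif F D (\<lambda>v. x (\<phi> v))"
  shows "certif (rename \<phi> F) (\<phi> ` D) x"
  unfolding certif_def rename_def
proof (intro allI impI)
  fix x' assume eq: "\<forall>u\<in>\<phi> ` D. x' u = x u"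
  show "F (\<lambda>v. x' (\<phi> v)) = F (\<lambda>v. x (\<phi> v))"
    by (rule certifD[OF assms], rule bspec[OF eq], rule imageI)
qed

lemma cert_rename:
  assumes "inj \<phi>" "cert V F c0 c1"
  shows "cert (\<phi> ` V) (rename \<phi> F) c0 c1"
  unfolding cert_def
proof
  fix x
  from assms(2) obtain D where D: "D \<subseteq> V \<and> card D \<le> (if F (\<lambda>v. x (\<phi> v)) then c1 else c0) \<and> certif F D (\<lambda>v. x (\<phi> v))"
    unfolding cert_def by (elim allE[of _ "\<lambda>v. x (\<phi> v)"] exE)
  have "card (\<phi> ` D) = card D" by (intro card_image inj_on_subset[OF assms(1)] subset_UNIV)
  then have "card (\<phi> ` D) \<le> (if rename \<phi> F x then c1 else c0)" using D by (simp add: rename_def)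
  moreover have "\<phi> ` D \<subseteq> \<phi> ` V" using D by (intro image_mono) simp
  moreover have "certif (rename \<phi> F) (\<phi> ` D) x" using D by (intro certif_rename) simp
  ultimately show "\<exists>D\<subseteq>\<phi> ` V. card D \<le> (if rename \<phi> F x then c1 else c0) \<and> certif (rename \<phi> F) D x"
    by (intro exI conjI)
qed

lemma ucert_rename:
  assumes "inj \<phi>" "ucert V F u0 u1"
  shows "ucert (\<phi> ` V) (rename \<phi> F) u0 u1"
proof -
  obtain D where reading: "\<forall>x. D x \<subseteq> V" "\<forall>x. card (D x) \<le> (if F x then u1 else u0)"
      "\<forall>x x'. (\<forall>v\<in>D x. x' v = x v) \<longrightarrow> F x' = F x"
      "\<forall>x x'. (\<forall>v\<in>D x. x' v = x v) \<longrightarrow> D x' = D x"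
    using assms(2) by (rule ucertE)
  note D = reading[rule_format]
  have card: "card (\<phi> ` D x) = card (D x)" for x by (intro card_image inj_on_subset[OF assms(1)] subset_UNIV)
  show ?thesis
  proof (rule ucertI[of "\<lambda>x. \<phi> ` D (\<lambda>v. x (\<phi> v))"])
    show "\<phi> ` D (\<lambda>v. x (\<phi> v)) \<subseteq> \<phi> ` V" for x by (intro image_mono D(1))
    show "card (\<phi> ` D (\<lambda>v. x (\<phi> v))) \<le> (if rename \<phi> F x then u1 else u0)" for x
      unfolding card rename_def by (rule D(2))
    fix x x' assume agree: "\<forall>u\<in>\<phi> ` D (\<lambda>v. x (\<phi> v)). x' u = x u"
    have eq: "x' (\<phi> v) = x (\<phi> v)" if "v \<in> D (\<lambda>v. x (\<phi> v))" for v using agree that by simp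
    have "F (\<lambda>v. x' (\<phi> v)) = F (\<lambda>v. x (\<phi> v))" by (rule D(3)) (rule eq)
    moreover have "D (\<lambda>v. x' (\<phi> v)) = D (\<lambda>v. x (\<phi> v))" by (rule D(4)) (rule eq)
    ultimately show "rename \<phi> F x' = rename \<phi> F x \<and> \<phi> ` D (\<lambda>v. x' (\<phi> v)) = \<phi> ` D (\<lambda>v. x (\<phi> v))"
      by (simp add: rename_def)
  qed
qed

text \<open>The sets \<open>D x\<close> become partial assignments, whose invariance makes the
  family unambiguous. For the lower bound on \<open>UC\<close>, an optimal family has a member
  consistent with \<open>x0\<close>, and it is a certificate of \<open>x0\<close>.\<close>

lemma transfer_to_bool_lists:
  fixes V :: "'v set"
  assumes fin: "finite V" "V \<noteq> {}" and A: "adv V F A" "A \<ge> 0" and F: "ucert V F u0 u1"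
    and big: "F x0" "\<And>D. D \<subseteq> V \<Longrightarrow> certif F D x0 \<Longrightarrow> M \<le> card D"
  shows "\<exists>N f. A \<le> 36 * real (Q N f) \<and> UC N f \<le> max u0 u1 \<and> M \<le> UC N f"
proof -
  define N where "N = card V"
  have "N > 0" using fin by (simp add: N_def card_gt_0_iff)
  obtain e where e: "bij_betw e {..<N} V"
    using ex_bij_betw_nat_finite[OF fin(1)] unfolding N_def lessThan_atLeast0 by blast
  have inj: "inj_on e {..<N}" and img: "e ` {..<N} = V" using e by (simp_all add: bij_betw_def)
  define str :: "bool list \<Rightarrow> 'v \<Rightarrow> bool" where "str = (\<lambda>xs v. v \<in> V \<and> xs ! inv_into {..<N} e v)"
  define lst :: "('v \<Rightarrow> bool) \<Rightarrow> bool list" where "lst = (\<lambda>x. map (\<lambda>i. x (e i)) [0..<N])"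
  define f where "f = (\<lambda>xs. F (str xs))"
  have str_e: "str xs (e i) = xs ! i" if "i < N" for xs i
    using that inj img by (auto simp: str_def inv_into_f_f)
  have lst_nth: "lst x ! i = x (e i)" if "i < N" for x i using that by (simp add: lst_def)
  have lst_cube: "lst x \<in> cube N" for x by (simp add: lst_def cube_def)
  have f_lst: "f (lst x) = F x" for x
  proof -
    have "str (lst x) v = x v" if "v \<in> V" for v
    proof -
      have "v \<in> e ` {..<N}" using that img by simp
      then obtain i where "i < N" "v = e i" by auto
      then show ?thesis by (simp add: str_e lst_nth)
    qed
    then have "\<forall>v\<in>V. str (lst x) v = x v" by (rule ballI)
    then show ?thesis unfolding f_def
      by (rule ucert_depends_on[OF F, unfolded depends_on_def, THEN spec, THEN spec, THEN mp])
  qed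
  obtain D where reading: "\<forall>x. D x \<subseteq> V" "\<forall>x. card (D x) \<le> (if F x then u1 else u0)"
      "\<forall>x x'. (\<forall>v\<in>D x. x' v = x v) \<longrightarrow> F x' = F x"
      "\<forall>x x'. (\<forall>v\<in>D x. x' v = x v) \<longrightarrow> D x' = D x"
    using F by (rule ucertE)
  note D = reading[rule_format]
  define pa where "pa = (\<lambda>xs i. if i < N \<and> e i \<in> D (str xs) then Some (xs ! i) else None)"
  have dom_pa: "dom (pa xs) = {i. i < N \<and> e i \<in> D (str xs)}" for xs
    by (auto simp: pa_def dom_def)
  have card_pa: "card (dom (pa xs)) \<le> card (D (str xs))" for xs
  proof (rule card_inj_on_le)
    show "inj_on e (dom (pa xs))" by (rule inj_on_subset[OF inj]) (auto simp: dom_pa)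
    show "e ` dom (pa xs) \<subseteq> D (str xs)" by (auto simp: dom_pa)
    show "finite (D (str xs))" by (rule finite_subset[OF D(1) fin(1)])
  qed
  have agree: "str ys v = str xs v" if "consistent (pa xs) ys" "v \<in> D (str xs)" for xs ys v
  proof -
    have "v \<in> e ` {..<N}" using that(2) D(1)[of "str xs"] img by blast
    then obtain i where i: "i < N" "v = e i" by auto
    then have "i \<in> dom (pa xs)" using that(2) by (simp add: dom_pa)
    then have "pa xs i = Some (ys ! i)" using that(1) by (simp add: consistent_def)
    then have "ys ! i = xs ! i" by (simp add: pa_def split: if_splits)
    then show ?thesis using i by (simp add: str_e)
  qed
  have self: "consistent (pa xs) xs" for xs unfolding consistent_def dom_pa by (simp add: pa_def)
  have same: "f ys = f xs" "pa ys = pa xs" if c: "consistent (pa xs) ys" for xs ys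
  proof -
    show "f ys = f xs" unfolding f_def by (rule D(3)) (rule agree[OF c])
    have Deq: "D (str ys) = D (str xs)" by (rule D(4)) (rule agree[OF c])
    show "pa ys = pa xs"
    proof
      fix i
      show "pa ys i = pa xs i"
      proof (cases "i < N \<and> e i \<in> D (str xs)")
        case True
        then have "ys ! i = xs ! i" using agree[OF c, of "e i"] by (simp add: str_e)
        then show ?thesis by (simp add: pa_def Deq)
      qed (auto simp: pa_def Deq)
    qed
  qed
  define valid where "valid = (\<lambda>b w. \<exists>S. (\<forall>p\<in>S. b_certificate N f b p \<and> card (dom p) \<le> w) \<and>
     (\<forall>x\<in>cube N. f x = b \<longrightarrow> (\<exists>!p. p \<in> S \<and> consistent p x)))"
  have valid: "valid b (if b then u1 else u0)" for b
    unfolding valid_def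
  proof (intro exI conjI ballI impI)
    let ?S = "pa ` {x \<in> cube N. f x = b}"
    show "b_certificate N f b p" if p: "p \<in> ?S" for p
    proof -
      obtain x where x: "x \<in> cube N" "f x = b" "p = pa x" using p by blast
      have "partial_assignment N p" using x(3) by (auto simp: partial_assignment_def dom_pa)
      moreover have "\<forall>y\<in>cube N. consistent (pa x) y \<longrightarrow> f y = f x" by (intro ballI impI same(1))
      ultimately have "certificate N f x p" unfolding certificate_def x(3) using self by (intro conjI)
      then show ?thesis unfolding b_certificate_def using x by blast
    qed
    show "card (dom p) \<le> (if b then u1 else u0)" if p: "p \<in> ?S" for p
    proof -
      obtain x where x: "x \<in> cube N" "f x = b" "p = pa x" using p by blast
      have "card (dom p) \<le> (if F (str x) then u1 else u0)"
        unfolding x(3) by (rule order_trans[OF card_pa D(2)])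
      then show ?thesis using x(2) by (simp add: f_def)
    qed
    fix x assume x: "x \<in> cube N" "f x = b"
    show "\<exists>!p. p \<in> ?S \<and> consistent p x"
    proof (rule ex1I)
      show "pa x \<in> ?S \<and> consistent (pa x) x" using x self by blast
      fix p assume p: "p \<in> ?S \<and> consistent p x"
      then obtain x' where "p = pa x'" by blast
      then show "p = pa x" using same(2)[of x' x] p by simp
    qed
  qed
  have UCb: "UCb N f b = (LEAST w. valid b w)" for b by (simp add: UCb_def valid_def)
  have "UCb N f b \<le> (if b then u1 else u0)" for b
    unfolding UCb by (rule Least_le) (rule valid)
  from this[of False] this[of True] have upper: "UC N f \<le> max u0 u1"
    by (simp add: UC_def max_def)
  have "valid True (UCb N f True)" unfolding UCb using valid[of True] by (rule LeastI)
  then obtain S where S: "\<forall>p\<in>S. b_certificate N f True p \<and> card (dom p) \<le> UCb N f True"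
      "\<forall>x\<in>cube N. f x = True \<longrightarrow> (\<exists>!p. p \<in> S \<and> consistent p x)"
    unfolding valid_def by blast
  have "f (lst x0) = True" using big(1) f_lst by simp
  then have "\<exists>!p. p \<in> S \<and> consistent p (lst x0)" using S(2) lst_cube by blast
  then obtain p where p: "p \<in> S" "consistent p (lst x0)" by blast
  then have "b_certificate N f True p" using S(1) by blast
  then obtain x1 where x1: "f x1 = True" "certificate N f x1 p" unfolding b_certificate_def by blast
  have domp: "dom p \<subseteq> {..<N}" using x1(2) by (simp add: certificate_def partial_assignment_def)
  have "M \<le> card (e ` dom p)"
  proof (rule big(2))
    show "e ` dom p \<subseteq> V" using domp img by blast
    show "certif F (e ` dom p) x0"
      unfolding certif_def
    proof (intro allI impI)
      fix x' assume eq: "\<forall>v\<in>e ` dom p. x' v = x0 v"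
      have "consistent p (lst x')"
        unfolding consistent_def
      proof
        fix i assume i: "i \<in> dom p"
        then have "i < N" using domp by blast
        then have "lst x' ! i = lst x0 ! i" using eq i by (simp add: lst_nth)
        then show "p i = Some (lst x' ! i)" using p(2) i by (simp add: consistent_def)
      qed
      then have "f (lst x') = f x1" using x1(2) lst_cube unfolding certificate_def by blast
      then show "F x' = F x0" using x1(1) big(1) f_lst by simp
    qed
  qed
  also have "\<dots> \<le> card (dom p)" by (rule card_image_le) (rule finite_subset[OF domp], simp)
  also have "\<dots> \<le> UCb N f True" using S(1) p(1) by blast
  also have "\<dots> \<le> UC N f" by (simp add: UC_def)
  finally have lower: "M \<le> UC N f" .
  \<comment> \<open>The trivial algorithm ensures that the least number defining \<open>Q\<close> is
    attained.\<close>
  have comp: "quantum_computes N f (Q N f)"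
    unfolding Q_def by (rule LeastI) (rule quantum_computes_trivial[OF \<open>N > 0\<close>])
  obtain Y :: "bool \<Rightarrow> nat set" and \<xi> G w where adv: "adversary V F A Y \<xi> G w"
    using A(1) unfolding adv_def by blast
  have "A \<le> 36 * real (Q N f)"
  proof (rule adversary_bound[OF comp, where Y = Y and \<xi> = "\<lambda>y. lst (\<xi> y)" and w = w and G = G])
    show "lst (\<xi> y) \<in> cube N \<and> f (lst (\<xi> y)) = b" if "y \<in> Y b" for b y
      using lst_cube f_lst adversary_label[OF adv that] by simp
    show "opbound (Y False) (Y True) (\<lambda>y z. if lst (\<xi> y) ! i \<noteq> lst (\<xi> z) ! i then G y z else 0) 1"
      if "i < N" for i
    proof -
      have "e i \<in> V" using img that by blast
      then show ?thesis using adv by (simp add: lst_nth[OF that] adversary_def)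
    qed
  qed (use adv A(2) in \<open>simp_all add: adversary_def\<close>)
  then show ?thesis using upper lower by blast
qed

section \<open>The recursion\<close>

text \<open>A set of at most \<open>C\<close> elements is the set of letters of a word of length
  \<open>C\<close>, with \<open>None\<close> as padding.\<close>

lemma card_small_subsets:
  assumes "finite V"
  shows "card {D. D \<subseteq> V \<and> card D \<le> C} \<le> (card V + 1) ^ C"
proof -
  let ?H = "PiE {..<C} (\<lambda>_. insert None (Some ` V))"
  let ?g = "\<lambda>h. {v. \<exists>s<C. h s = Some v}"
  have fin: "finite ?H" using assms by (intro finite_PiE) auto
  have "{D. D \<subseteq> V \<and> card D \<le> C} \<subseteq> ?g ` ?H"
  proof
    fix D assume "D \<in> {D. D \<subseteq> V \<and> card D \<le> C}"
    then have D: "D \<subseteq> V" "card D \<le> C" by auto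
    then have "finite D" using assms finite_subset by blast
    then obtain b where b: "bij_betw b {0..<card D} D" using ex_bij_betw_nat_finite by blast
    then have img: "b ` {0..<card D} = D" by (simp add: bij_betw_def)
    define h where "h = restrict (\<lambda>s. if s < card D then Some (b s) else None) {..<C}"
    have "h \<in> ?H"
    proof
      fix s assume "s \<in> {..<C}"
      moreover have "b s \<in> V" if "s < card D" using img D(1) that by auto
      ultimately show "h s \<in> insert None (Some ` V)" by (simp add: h_def)
    qed (simp add: h_def)
    moreover have "?g h = D"
    proof (intro equalityI subsetI)
      fix v assume "v \<in> ?g h"
      then obtain s where "s < C" "h s = Some v" by blast
      then have "s < card D" "b s = v" by (auto simp: h_def split: if_splits)
      then show "v \<in> D" using img by auto
    next
      fix v assume "v \<in> D"
      then have "v \<in> b ` {0..<card D}" using img by simp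
      then obtain s where "s < card D" "v = b s" by auto
      then show "v \<in> ?g h" using D(2) by (intro CollectI exI[of _ s]) (simp add: h_def)
    qed
    ultimately show "D \<in> ?g ` ?H" by blast
  qed
  then have "card {D. D \<subseteq> V \<and> card D \<le> C} \<le> card ?H" by (rule surj_card_le[OF fin])
  also have "card ?H = (card V + 1) ^ C"
    using assms by (simp add: card_PiE card_image)
  finally show ?thesis .
qed

text \<open>Counting: there are at most as many choices of \<open>c\<close> sets of at most
  \<open>C\<close> variables as there are contents of a cell with \<open>c * C * \<beta>\<close>
  bits. Meaningless contents decode to empty sets, so every decoded set respects the size
  bound.\<close>

lemma ex_decoding:
  assumes "finite V" "card V + 1 \<le> 2 ^ \<beta>"
  shows "\<exists>dec. (\<forall>S j. dec S j \<subseteq> V \<and> card (dec S j) \<le> C) \<and>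
    (\<forall>D. (\<forall>j<c. D j \<subseteq> V \<and> card (D j) \<le> C) \<longrightarrow> (\<exists>S\<subseteq>{..<c * C * \<beta>}. \<forall>j<c. dec S j = D j))"
proof -
  define \<D> where "\<D> = {D. D \<subseteq> V \<and> card D \<le> C}"
  define \<Phi> where "\<Phi> = PiE {..<c} (\<lambda>_. \<D>)"
  define B where "B = Pow {..<c * C * \<beta>}"
  have "finite \<D>" using assms(1) by (simp add: \<D>_def)
  then have fin: "finite \<Phi>" unfolding \<Phi>_def by (intro finite_PiE) auto
  have finB: "finite B" by (simp add: B_def)
  have "card \<Phi> = card \<D> ^ c" by (simp add: \<Phi>_def card_PiE)
  also have "\<dots> \<le> ((card V + 1) ^ C) ^ c"
    unfolding \<D>_def by (rule power_mono[OF card_small_subsets[OF assms(1)]]) simp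
  also have "\<dots> \<le> ((2 ^ \<beta>) ^ C) ^ c" by (intro power_mono assms(2)) simp_all
  also have "\<dots> = card B" by (simp add: B_def card_Pow power_mult[symmetric] mult_ac)
  finally obtain f where f: "f ` \<Phi> \<subseteq> B" "inj_on f \<Phi>"
    by (rule exE[OF card_le_inj[OF fin finB]]) (elim conjE)
  define dec where "dec = (\<lambda>S j. if S \<in> f ` \<Phi> \<and> j < c then inv_into \<Phi> f S j else {})"
  have "dec S j \<in> \<D>" for S j
  proof (cases "S \<in> f ` \<Phi> \<and> j < c")
    case True
    then have "inv_into \<Phi> f S \<in> \<Phi>" by (intro inv_into_into) (rule conjunct1)
    moreover have "j \<in> {..<c}" using conjunct2[OF True] by simp
    ultimately have "inv_into \<Phi> f S j \<in> \<D>" unfolding \<Phi>_def by (rule PiE_mem)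
    then show ?thesis unfolding dec_def if_P[OF True] .
  next
    case False
    show ?thesis unfolding dec_def if_not_P[OF False] by (simp add: \<D>_def)
  qed
  then have dec: "\<forall>S j. dec S j \<subseteq> V \<and> card (dec S j) \<le> C" unfolding \<D>_def by simp
  have "\<exists>S\<subseteq>{..<c * C * \<beta>}. \<forall>j<c. dec S j = D j"
    if D: "\<forall>j<c. D j \<subseteq> V \<and> card (D j) \<le> C" for D
  proof -
    define R where "R = restrict D {..<c}"
    have mem: "R \<in> \<Phi>" unfolding R_def \<Phi>_def by (rule restrict_PiE_iff[THEN iffD2]) (use D in \<open>simp add: \<D>_def\<close>)
    then have S: "f R \<in> f ` \<Phi>" by (rule imageI)
    have "inv_into \<Phi> f (f R) = R" by (rule inv_into_f_f[OF f(2) mem])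
    then have "dec (f R) j = D j" if "j < c" for j
      unfolding dec_def if_P[OF conjI[OF S that]] using that by (simp add: R_def)
    then have "\<forall>j<c. dec (f R) j = D j" by (intro allI impI)
    moreover have "f R \<subseteq> {..<c * C * \<beta>}" using subsetD[OF f(1) S] by (simp add: B_def)
    ultimately show ?thesis by (intro exI conjI)
  qed
  then have "\<forall>D. (\<forall>j<c. D j \<subseteq> V \<and> card (D j) \<le> C) \<longrightarrow> (\<exists>S\<subseteq>{..<c * C * \<beta>}. \<forall>j<c. dec S j = D j)"
    by (intro allI impI)
  with dec show ?thesis by (intro exI[of _ dec] conjI)
qed

text \<open>The invariant of the recursion with fan-in \<open>M\<close>. The factor \<open>M\<close>
  for unambiguous certificates of 0-inputs is harmless, because the next AND uses at most one of
  them against up to \<open>M\<close> certificates of 1-inputs. The number \<open>g\<close> bounds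
  the binary logarithms of the certificate size and of the number of variables, on which the cost of
  the next cheat sheet depends.\<close>

definition hard ::
  "nat set \<Rightarrow> ((nat \<Rightarrow> bool) \<Rightarrow> bool) \<Rightarrow> nat \<Rightarrow> real \<Rightarrow> nat \<Rightarrow> nat \<Rightarrow> bool" where
  "hard V F M A y g \<longleftrightarrow> finite V \<and> adv V F A \<and> cert V F y y \<and> ucert V F (M * y) y \<and>
     0 < y \<and> y \<le> 2 ^ g \<and> card V + 1 \<le> 2 ^ g"

lemma hard_single:
  assumes "M > 0"
  shows "hard {..<1} (and_fun 1) M 1 1 1"
proof -
  have dep: "and_fun 1 x' = and_fun 1 x" if "\<forall>v\<in>{..<1}. x' v = x v" for x x' :: "nat \<Rightarrow> bool"
    using that by (simp add: and_fun_def)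
  have "cert {..<1} (and_fun 1) 1 1"
    unfolding cert_def certif_def
  proof
    fix x :: "nat \<Rightarrow> bool"
    show "\<exists>D\<subseteq>{..<1}. card D \<le> (if and_fun 1 x then 1 else 1) \<and>
        (\<forall>x'. (\<forall>v\<in>D. x' v = x v) \<longrightarrow> and_fun 1 x' = and_fun 1 x)"
      by (intro exI[of _ "{..<1}"] conjI allI impI) (simp, simp, rule dep)
  qed
  moreover have "ucert {..<1} (and_fun 1) 1 1"
    by (rule ucertI[of "\<lambda>_. {..<1}"]) (simp, simp, rule conjI[OF dep refl])
  then have "ucert {..<1} (and_fun 1) (M * 1) 1" by (rule ucert_mono) (use assms in simp_all)
  moreover have "adv {..<1} (and_fun 1) 1" using adv_and[of 1] by simp
  ultimately show ?thesis by (simp add: hard_def)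
qed

text \<open>One round: AND, then \<open>k\<close>-SUM, then a cheat sheet. With
  \<open>card vars = 2 * k * M * r\<close> the ordinary certificates of the composition fit into
  \<open>C = card vars * y\<close>, on 0-inputs as \<open>card vars * (1 * y)\<close> and on
  1-inputs as \<open>2 * k * r * (M * y)\<close>. The unambiguous ones have the bound
  \<open>u = 2 * M * C\<close>, and the cheat sheet confines this to 0-inputs. The factors
  \<open>c\<close> and \<open>\<beta>\<close> are the number of copies and the number of bits for
  naming one variable.\<close>

lemma (in ksum) hard_step:
  assumes hard: "hard V F M A y g" and "A > 0" and "B \<ge> 0"
    and AB: "B \<le> L / (2 * sqrt k) * sqrt M * A" and "B > 0"
    and c: "c > 0" "B\<^sup>2 \<le> 2 ^ c" and \<beta>: "card vars * M * 2 ^ g \<le> 2 ^ \<beta>" and \<beta>pos: "\<beta> > 0"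
  shows "\<exists>V' F'. hard V' F' M B (8 * c * \<beta> * card vars * y) (2 * c + 3 * \<beta> + 4)"
proof -
  let ?n = "card vars"
  have finv: "finite vars" using fin by (simp add: vars_def)
  have F: "finite V" "adv V F A" "cert V F y y" "ucert V F (M * y) y" "0 < y" "y \<le> 2 ^ g" "card V + 1 \<le> 2 ^ g"
    using hard by (simp_all add: hard_def)
  have nv: "?n = 2 * k * M * r"
    by (simp add: vars_def W_def P_def card_cartesian_product)
  have npos: "?n > 0" using k r M by (simp add: nv)
  let ?VA = "{..<M} \<times> V" and ?FA = "block_compose (and_fun M) F"
  let ?VH = "vars \<times> ?VA" and ?H = "block_compose ksum_fun ?FA"
  have finVA: "finite ?VA" using F by simp
  have finVH: "finite ?VH" using finv finVA by simp
  have advA: "adv ?VA ?FA (sqrt M * A)"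
    by (rule adv_compose[OF _ moncert_depends_on[OF moncert_and] adv_and _ F(2) \<open>A > 0\<close>])
      (use M in auto)
  have "adv ?VH ?H (L / (2 * sqrt k) * (sqrt M * A))"
    by (rule adv_compose[OF finv moncert_depends_on[OF moncert_ksum] adv_ksum _ advA])
      (use \<open>A > 0\<close> M k L(2) in auto)
  then have advH: "adv ?VH ?H B"
    by (rule adv_mono) (use AB \<open>B > 0\<close> in \<open>simp_all add: mult.assoc\<close>)
  define C where "C = ?n * y"
  have Cpos: "C > 0" using npos F by (simp add: C_def)
  have "cert ?VA ?FA (1 * y) (M * y)"
    by (rule cert_compose[OF _ F(1) moncert_and F(3)]) simp
  then have "cert ?VH ?H (?n * (1 * y)) (2 * k * r * (M * y))"
    by (rule cert_compose[OF finv finVA moncert_ksum])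
  then have certH: "cert ?VH ?H C C"
    by (rule cert_mono) (simp_all add: C_def nv)
  define u where "u = ?n * (2 * M * y)"
  have "ucert ?VA ?FA (M * y + M * y) (M * y)" by (rule ucert_and[OF F(1) F(4)])
  then have "ucert ?VA ?FA (2 * M * y) (2 * M * y)" by (rule ucert_mono) simp_all
  then have ucertH: "ucert ?VH ?H u u"
    unfolding u_def by (rule ucert_compose[OF finv finVA moncert_depends_on[OF moncert_ksum]])
  have cardVH: "card ?VH + 1 \<le> 2 ^ \<beta>"
  proof -
    have "card ?VH + 1 \<le> ?n * M * (card V + 1)"
      using npos M by (simp add: card_cartesian_product Suc_le_eq)
    also have "\<dots> \<le> ?n * M * 2 ^ g" using F(7) by (rule mult_le_mono2)
    finally show ?thesis using \<beta> by simp
  qed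
  define b where "b = c * C * \<beta>"
  obtain dec where dec1: "\<forall>S j. dec S j \<subseteq> ?VH \<and> card (dec S j) \<le> C"
      and dec2: "\<forall>D. (\<forall>j<c. D j \<subseteq> ?VH \<and> card (D j) \<le> C) \<longrightarrow> (\<exists>S\<subseteq>{..<b}. \<forall>j<c. dec S j = D j)"
    using ex_decoding[OF finVH cardVH, of C c] unfolding b_def by (elim exE conjE)
  have decV: "dec S j \<subseteq> ?VH" "card (dec S j) \<le> C" for S j using dec1 by simp_all
  let ?VC = "cs_vars c b ?VH" and ?FC = "cheat_sheet c b dec ?H"
  have advC: "adv ?VC ?FC B"
  proof (rule adv_cheat_sheet[OF advH \<open>B > 0\<close> c(2), where \<D> = "{D. D \<subseteq> ?VH \<and> card D \<le> C}"])
    show "\<exists>D\<in>{D. D \<subseteq> ?VH \<and> card D \<le> C}. certif ?H D x" for x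
    proof -
      from certH have "\<exists>D\<subseteq>?VH. card D \<le> (if ?H x then C else C) \<and> certif ?H D x"
        unfolding cert_def by (rule spec)
      then show ?thesis unfolding if_cancel by blast
    qed
    show "\<exists>S\<subseteq>{..<b}. \<forall>j<c. dec S j = D j" if "\<And>j. j < c \<Longrightarrow> D j \<in> {D. D \<subseteq> ?VH \<and> card D \<le> C}" for D
    proof (rule dec2[THEN spec, THEN mp])
      show "\<forall>j<c. D j \<subseteq> ?VH \<and> card (D j) \<le> C" using that by blast
    qed
  qed
  \<comment> \<open>The sums below are at most 5 times \<open>c * C * \<beta>\<close>, with another
    factor \<open>M\<close> for unambiguous certificates of 0-inputs; the 8 is a power of 2 to suit
    the bound by a power of 2 in \<open>hard\<close>.\<close>
  let ?y = "8 * c * \<beta> * ?n * y"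
  have cC: "c * C \<le> c * C * \<beta>" "1 \<le> c * C * \<beta>" using \<beta>pos c Cpos by (simp_all add: Suc_le_eq)
  have y: "?y = 8 * (c * C * \<beta>)" by (simp add: C_def mult_ac)
  have certC: "cert ?VC ?FC ?y ?y"
  proof (rule cert_mono[OF cert_cheat_sheet[OF finVH decV certH]])
    show "c * (C + C) + (b + 1) \<le> ?y" using cC unfolding y b_def distrib_left by linarith
    then show "c * (C + C) + (b + 1) \<le> ?y" .
  qed
  have u: "c * u = 2 * M * (c * C)" by (simp add: u_def C_def mult_ac)
  have ucertC: "ucert ?VC ?FC (M * ?y) ?y"
  proof (rule ucert_mono[OF ucert_cheat_sheet[OF finVH decV ucertH]])
    show "c * C + (b + 1) \<le> ?y" using cC unfolding y b_def by linarith
    have "c * (u + C) + (b + 1) = 2 * M * (c * C) + c * C + c * C * \<beta> + 1"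
      by (simp add: distrib_left u b_def)
    also have "\<dots> \<le> 2 * (M * (c * C * \<beta>)) + M * (c * C * \<beta>) + M * (c * C * \<beta>) + M * (c * C * \<beta>)"
    proof (intro add_mono)
      have 1: "M * (c * C) \<le> M * (c * C * \<beta>)" by (rule mult_le_mono2[OF cC(1)])
      then show "2 * M * (c * C) \<le> 2 * (M * (c * C * \<beta>))" by simp
      have 2: "c * C * \<beta> \<le> M * (c * C * \<beta>)" using M by simp
      show "c * C \<le> M * (c * C * \<beta>)" by (rule order_trans[OF cC(1) 2])
      show "c * C * \<beta> \<le> M * (c * C * \<beta>)" by (rule 2)
      show "1 \<le> M * (c * C * \<beta>)" by (rule order_trans[OF cC(2) 2])
    qed
    also have "\<dots> \<le> M * ?y" unfolding y by simp
    finally show "c * (u + C) + (b + 1) \<le> M * ?y" .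
  qed
  have finVC: "finite ?VC"
    using finVH finite_lists_length_eq[of "UNIV :: bool set" c] by (simp add: cs_vars_def)
  have Cle: "C \<le> 2 ^ \<beta>"
  proof -
    have "C \<le> ?n * 2 ^ g" unfolding C_def using F(6) by (rule mult_le_mono2)
    also have "\<dots> \<le> ?n * M * 2 ^ g" using M by simp
    finally show ?thesis using \<beta> by simp
  qed
  have less: "c \<le> 2 ^ c" "\<beta> \<le> 2 ^ \<beta>" by (simp_all add: less_imp_le)
  have ble: "c * C * \<beta> \<le> 2 ^ (c + 2 * \<beta>)"
  proof -
    have "c * C * \<beta> \<le> 2 ^ c * 2 ^ \<beta> * 2 ^ \<beta>" by (intro mult_le_mono less Cle)
    also have "\<dots> = 2 ^ (c + 2 * \<beta>)" by (simp add: power_add mult_2)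
    finally show ?thesis .
  qed
  have yle: "?y \<le> 2 ^ (2 * c + 3 * \<beta> + 4)"
  proof -
    have "?y \<le> 2 ^ 3 * 2 ^ (c + 2 * \<beta>)" using ble unfolding y by simp
    also have "\<dots> = 2 ^ (3 + (c + 2 * \<beta>))" by (simp add: power_add)
    also have "\<dots> \<le> 2 ^ (2 * c + 3 * \<beta> + 4)" by (rule power_increasing) simp_all
    finally show ?thesis .
  qed
  \<comment> \<open>There are \<open>2 ^ c\<close> cells, so the number of variables is exponential
    in \<open>c\<close>, but only its logarithm enters the next round.\<close>
  have cardVC: "card ?VC + 1 \<le> 2 ^ (2 * c + 3 * \<beta> + 4)"
  proof -
    have "card {l :: bool list. length l = c} = 2 ^ c"
      using card_lists_length_eq[of "UNIV :: bool set" c] by simp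
    then have "card ?VC \<le> c * card ?VH + 2 ^ c * (b + 1)"
      unfolding cs_vars_def
      by (intro order_trans[OF card_Un_le]) (simp add: card_image card_cartesian_product)
    also have "\<dots> \<le> 2 ^ c * 2 ^ \<beta> + 2 ^ c * (2 ^ (c + 2 * \<beta>) + 2 ^ (c + 2 * \<beta>))"
      using cardVH ble less unfolding b_def by (intro add_mono mult_le_mono) simp_all
    also have "\<dots> \<le> 2 ^ (2 * c + 2 * \<beta>) + 2 * 2 ^ (2 * c + 2 * \<beta>)"
    proof (rule add_mono)
      have "(2 :: nat) ^ c * 2 ^ \<beta> = 2 ^ (c + \<beta>)" by (simp add: power_add)
      also have "\<dots> \<le> 2 ^ (2 * c + 2 * \<beta>)" by (rule power_increasing) simp_all
      finally show "(2 :: nat) ^ c * 2 ^ \<beta> \<le> 2 ^ (2 * c + 2 * \<beta>)" .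
      have "(2 :: nat) ^ c * 2 ^ (c + 2 * \<beta>) = 2 ^ (c + (c + 2 * \<beta>))" by (rule power_add[symmetric])
      also have "c + (c + 2 * \<beta>) = 2 * c + 2 * \<beta>" by simp
      finally show "(2 :: nat) ^ c * (2 ^ (c + 2 * \<beta>) + 2 ^ (c + 2 * \<beta>)) \<le> 2 * 2 ^ (2 * c + 2 * \<beta>)"
        by (simp only: distrib_left mult_2)
    qed
    finally have "card ?VC + 1 \<le> 4 * 2 ^ (2 * c + 2 * \<beta>)"
      using one_le_power[of "2 :: nat" "2 * c + 2 * \<beta>"] by linarith
    also have "\<dots> = 2 ^ (2 + (2 * c + 2 * \<beta>))" by (simp add: power_add)
    also have "\<dots> \<le> 2 ^ (2 * c + 3 * \<beta> + 4)" by (rule power_increasing) simp_all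
    finally show ?thesis .
  qed
  let ?t = "to_nat :: nat \<times> ((pos \<times> nat) \<times> bool) \<times> nat \<times> nat + bool list \<times> nat \<Rightarrow> nat"
  have inj: "inj ?t" by simp
  have "hard (?t ` ?VC) (rename ?t ?FC) M B ?y (2 * c + 3 * \<beta> + 4)"
    unfolding hard_def
  proof (intro conjI)
    show "finite (?t ` ?VC)" using finVC by simp
    show "adv (?t ` ?VC) (rename ?t ?FC) B" by (rule adv_rename[OF inj advC])
    show "cert (?t ` ?VC) (rename ?t ?FC) ?y ?y" by (rule cert_rename[OF inj certC])
    show "ucert (?t ` ?VC) (rename ?t ?FC) (M * ?y) ?y" by (rule ucert_rename[OF inj ucertC])
    show "0 < ?y" using npos c F(5) \<beta>pos by simp
    show "?y \<le> 2 ^ (2 * c + 3 * \<beta> + 4)" by (rule yle)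
    show "card (?t ` ?VC) + 1 \<le> 2 ^ (2 * c + 3 * \<beta> + 4)"
      using cardVC by (simp add: card_image inj_on_subset[OF inj])
  qed
  then show ?thesis by blast
qed

lemma hard_mono:
  assumes "hard V F M A y g" "g \<le> g'"
  shows "hard V F M A y g'"
proof -
  have "(2 :: nat) ^ g \<le> 2 ^ g'" using assms(2) by (rule power_increasing) simp
  then show ?thesis using assms(1) unfolding hard_def by linarith
qed

lemma le_two_power: "(n :: nat) \<le> 2 ^ n"
  by (simp add: less_imp_le)

text \<open>For \<open>k = 2 * \<kappa>\<close> the product of \<open>L\<close> and
  \<open>sqrt M\<close> is \<open>2 powr (3 * \<kappa> * a + a / 2)\<close>; the spare
  \<open>a / 2\<close> pays for the denominator \<open>2 * sqrt k\<close>. An even \<open>k\<close>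
  makes the remaining exponent an integer.\<close>

lemma ksum_gain:
  assumes "\<kappa> > 0" "8 * \<kappa> \<le> (2 :: nat) ^ a"
  shows "(2 :: real) ^ (3 * \<kappa> * a) \<le> real (2 ^ (a * (2 * \<kappa>))) / (2 * sqrt (real (2 * \<kappa>))) * sqrt (real (2 ^ (a * (2 * \<kappa> + 1))))"
proof -
  have "real (8 * \<kappa>) \<le> real (2 ^ a)" using assms(2) by (simp only: of_nat_le_iff)
  then have "2\<^sup>2 * real (2 * \<kappa>) \<le> 2 ^ a" by simp
  then have "sqrt (2\<^sup>2 * real (2 * \<kappa>)) \<le> sqrt (2 ^ a)" by (rule real_sqrt_le_mono)
  then have s: "2 * sqrt (real (2 * \<kappa>)) \<le> sqrt (2 ^ a)"
    by (simp only: real_sqrt_mult real_sqrt_abs abs_numeral)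
  have pos: "0 < 2 * sqrt (real (2 * \<kappa>))" using assms(1) by simp
  have "a * (2 * \<kappa> + 1) = (a * \<kappa>) * 2 + a" by (simp add: algebra_simps)
  then have "real (2 ^ (a * (2 * \<kappa> + 1))) = (2 ^ (a * \<kappa>))\<^sup>2 * 2 ^ a"
    by (simp only: of_nat_mult of_nat_power of_nat_numeral power_add power_mult)
  then have M: "sqrt (real (2 ^ (a * (2 * \<kappa> + 1)))) = 2 ^ (a * \<kappa>) * sqrt (2 ^ a)"
    by (simp add: real_sqrt_mult)
  have "3 * \<kappa> * a = a * (2 * \<kappa>) + a * \<kappa>" by (simp add: algebra_simps)
  then have "(2 :: real) ^ (3 * \<kappa> * a) = 2 ^ (a * (2 * \<kappa>)) * 2 ^ (a * \<kappa>)"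
    by (simp only: power_add)
  also have "\<dots> = 2 ^ (a * (2 * \<kappa>)) * 2 ^ (a * \<kappa>) * 1" by simp
  also have "\<dots> \<le> 2 ^ (a * (2 * \<kappa>)) * 2 ^ (a * \<kappa>) * (sqrt (2 ^ a) / (2 * sqrt (real (2 * \<kappa>))))"
    using s pos by (intro mult_left_mono) (simp_all add: pos_le_divide_eq)
  also have "\<dots> = real (2 ^ (a * (2 * \<kappa>))) / (2 * sqrt (real (2 * \<kappa>))) * sqrt (real (2 ^ (a * (2 * \<kappa> + 1))))"
    unfolding M by simp
  finally show ?thesis .
qed

text \<open>The constant \<open>Z\<close> depends on \<open>\<kappa>\<close> and the depth
  \<open>d\<close> but not on \<open>a\<close>. Each round multiplies the certificates by
  \<open>M\<close> and by \<open>c\<close>, \<open>\<beta>\<close> and \<open>r\<close>, all linear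
  in \<open>a\<close>, whence the exponent \<open>3 * d\<close>. The exponents of \<open>L\<close>
  and \<open>M\<close> make \<open>L ^ Suc k = M ^ k\<close>.\<close>

lemma hard_family:
  assumes "\<kappa> > 0"
  shows "\<exists>Z. \<forall>a\<ge>1. 8 * \<kappa> \<le> 2 ^ a \<longrightarrow>
    (\<exists>V F y. hard V F (2 ^ (a * (2 * \<kappa> + 1))) (2 ^ (3 * \<kappa> * a * d)) y (Z * a) \<and>
       y \<le> (Z * a) ^ (3 * d) * (2 ^ (a * (2 * \<kappa> + 1))) ^ d)"
proof (induction d)
  case 0
  have "hard {..<1} (and_fun 1) (2 ^ (a * (2 * \<kappa> + 1))) (2 ^ (3 * \<kappa> * a * 0)) 1 (1 * a)" if "a \<ge> 1" for a
    using hard_mono[OF hard_single[of "2 ^ (a * (2 * \<kappa> + 1))"], of a] that by simp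
  then show ?case by (intro exI[of _ 1]) auto
next
  case (Suc d)
  from Suc.IH obtain Z where Z: "\<And>a. a \<ge> 1 \<Longrightarrow> 8 * \<kappa> \<le> 2 ^ a \<Longrightarrow>
    \<exists>V F y. hard V F (2 ^ (a * (2 * \<kappa> + 1))) (2 ^ (3 * \<kappa> * a * d)) y (Z * a) \<and>
       y \<le> (Z * a) ^ (3 * d) * (2 ^ (a * (2 * \<kappa> + 1))) ^ d" by blast
  define k where "k = 2 * \<kappa>"
  \<comment> \<open>\<open>R * a\<close> bounds \<open>r\<close>, \<open>Zb * a\<close> is the
    number of bits for a variable, \<open>W0\<close> gathers the constants of the new certificate
    size, and \<open>Z'\<close> serves both for this size and for the new \<open>g\<close>.\<close>
  define R where "R = k * (k + 1) + 1"
  define Zb where "Zb = 2 * k + R + 2 * (k + 1) + Z"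
  define W0 where "W0 = 8 * (6 * \<kappa> * Suc d) * Zb * (2 * k * R)"
  define Z' where "Z' = Z + W0 + 12 * \<kappa> * Suc d + 3 * Zb + 4"
  have "\<exists>V F y. hard V F (2 ^ (a * (2 * \<kappa> + 1))) (2 ^ (3 * \<kappa> * a * Suc d)) y (Z' * a) \<and>
       y \<le> (Z' * a) ^ (3 * Suc d) * (2 ^ (a * (2 * \<kappa> + 1))) ^ Suc d"
    if a: "a \<ge> 1" and big: "8 * \<kappa> \<le> 2 ^ a" for a
  proof -
    define M :: nat where "M = 2 ^ (a * (2 * \<kappa> + 1))"
    define L :: nat where "L = 2 ^ (a * (2 * \<kappa>))"
    \<comment> \<open>These values give \<open>2 ^ r = 2 * M ^ k\<close>, and \<open>2 ^ c\<close>
      is the square of the new adversary bound, as the cheat sheet demands.\<close>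
    define r where "r = a * k * (k + 1) + 1"
    define c where "c = 6 * \<kappa> * Suc d * a"
    define \<beta> where "\<beta> = Zb * a"
    obtain V F y where hard: "hard V F M (2 ^ (3 * \<kappa> * a * d)) y (Z * a)"
      and y: "y \<le> (Z * a) ^ (3 * d) * M ^ d"
      using Z[OF a big] unfolding M_def by blast
    have Mk: "M = 2 ^ (a * (k + 1))" by (simp add: M_def k_def)
    have Lk: "L = 2 ^ (a * k)" by (simp add: L_def k_def)
    interpret ksum k M r L
    proof
      show "k > 0" using assms by (simp add: k_def)
      show "r > 0" by (simp add: r_def)
      show "L > 0" by (simp add: L_def)
      have "L ^ Suc k = 2 ^ (a * k * Suc k)" unfolding Lk by (simp only: power_mult)
      also have "a * k * Suc k = a * (k + 1) * k" by (simp add: algebra_simps)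
      also have "2 ^ (a * (k + 1) * k) = M ^ k" unfolding Mk by (simp only: power_mult)
      finally show "L ^ Suc k \<le> M ^ k" by simp
      have "M ^ k = 2 ^ (a * (k + 1) * k)" unfolding Mk by (simp only: power_mult)
      also have "a * (k + 1) * k = a * k * (k + 1)" by (simp add: algebra_simps)
      finally show "2 * M ^ k \<le> 2 ^ r" by (simp add: r_def)
    qed
    have rR: "r \<le> R * a" using a by (simp add: r_def R_def algebra_simps)
    have nv: "card vars = 2 * k * M * r"
      by (simp add: vars_def W_def P_def card_cartesian_product)
    have c0: "c > 0" using assms a by (simp add: c_def)
    have \<beta>0: "\<beta> > 0" using a by (simp add: \<beta>_def Zb_def R_def)
    have "\<exists>V' F'. hard V' F' M (2 ^ (3 * \<kappa> * a * Suc d)) (8 * c * \<beta> * card vars * y) (2 * c + 3 * \<beta> + 4)"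
    proof (rule hard_step[OF hard])
      have "(2 :: real) ^ (3 * \<kappa> * a * Suc d) = 2 ^ (3 * \<kappa> * a) * 2 ^ (3 * \<kappa> * a * d)"
        by (simp add: power_add[symmetric])
      also have "\<dots> \<le> L / (2 * sqrt k) * sqrt M * 2 ^ (3 * \<kappa> * a * d)"
        using ksum_gain[OF assms big] unfolding L_def M_def k_def by (intro mult_right_mono) simp_all
      finally show "(2 :: real) ^ (3 * \<kappa> * a * Suc d) \<le> L / (2 * sqrt k) * sqrt M * 2 ^ (3 * \<kappa> * a * d)" .
      have "((2 :: real) ^ (3 * \<kappa> * a * Suc d))\<^sup>2 = 2 ^ (3 * \<kappa> * a * Suc d * 2)" by (simp only: power_mult)
      also have "3 * \<kappa> * a * Suc d * 2 = c" by (simp add: c_def algebra_simps)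
      finally show "((2 :: real) ^ (3 * \<kappa> * a * Suc d))\<^sup>2 \<le> 2 ^ c" by simp
      have "card vars * M * 2 ^ (Z * a) \<le> (2 ^ (2 * k) * 2 ^ (a * (k + 1)) * 2 ^ r) * 2 ^ (a * (k + 1)) * 2 ^ (Z * a)"
        unfolding nv by (intro mult_le_mono le_two_power order_refl Mk[THEN eq_imp_le])
      also have "\<dots> = 2 ^ (2 * k + a * (k + 1) + r + a * (k + 1) + Z * a)" by (simp only: power_add)
      also have "\<dots> \<le> 2 ^ \<beta>"
      proof (rule power_increasing)
        have "2 * k \<le> 2 * k * a" using a by simp
        then have "2 * k + a * (k + 1) + r + a * (k + 1) + Z * a \<le> 2 * k * a + a * (k + 1) + R * a + a * (k + 1) + Z * a"
          using rR by linarith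
        also have "\<dots> = \<beta>" by (simp add: \<beta>_def Zb_def algebra_simps)
        finally show "2 * k + a * (k + 1) + r + a * (k + 1) + Z * a \<le> \<beta>" .
      qed simp
      finally show "card vars * M * 2 ^ (Z * a) \<le> 2 ^ \<beta>" .
    qed (use c0 \<beta>0 in simp_all)
    then obtain V' F' where new: "hard V' F' M (2 ^ (3 * \<kappa> * a * Suc d)) (8 * c * \<beta> * card vars * y) (2 * c + 3 * \<beta> + 4)"
      by blast
    have "2 * c + 3 * \<beta> + 4 \<le> 2 * c + 3 * \<beta> + 4 * a" using a by simp
    also have "\<dots> = (12 * \<kappa> * Suc d + 3 * Zb + 4) * a" by (simp add: c_def \<beta>_def algebra_simps)
    also have "\<dots> \<le> Z' * a" by (intro mult_le_mono1) (simp add: Z'_def)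
    finally have g: "2 * c + 3 * \<beta> + 4 \<le> Z' * a" .
    have "8 * c * \<beta> * card vars * y \<le> 8 * c * \<beta> * (2 * k * M * (R * a)) * ((Z * a) ^ (3 * d) * M ^ d)"
      unfolding nv by (intro mult_le_mono rR y order_refl)
    also have "\<dots> = W0 * a ^ 3 * (Z * a) ^ (3 * d) * M ^ Suc d"
      by (simp add: W0_def c_def \<beta>_def power3_eq_cube)
    also have "\<dots> \<le> (Z' * a) ^ 3 * (Z' * a) ^ (3 * d) * M ^ Suc d"
    proof (intro mult_le_mono1 mult_le_mono)
      have "W0 \<le> Z'" by (simp add: Z'_def)
      also have "Z' \<le> Z' ^ 3" by (rule self_le_power) (simp_all add: Z'_def)
      finally show "W0 * a ^ 3 \<le> (Z' * a) ^ 3" by (simp add: power_mult_distrib)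
      show "(Z * a) ^ (3 * d) \<le> (Z' * a) ^ (3 * d)"
        by (intro power_mono mult_le_mono1) (simp_all add: Z'_def)
    qed
    also have "\<dots> = (Z' * a) ^ (3 * Suc d) * M ^ Suc d" by (simp add: power_add)
    finally have "8 * c * \<beta> * card vars * y \<le> (Z' * a) ^ (3 * Suc d) * M ^ Suc d" .
    then show ?thesis using hard_mono[OF new g] unfolding M_def by blast
  qed
  then show ?case by blast
qed

section \<open>Choice of parameters and the separation\<close>

lemma square_le_two_power: "n \<ge> 4 \<Longrightarrow> n * n \<le> (2 :: nat) ^ n"
proof (induction n rule: dec_induct)
  case (step n)
  have "Suc n * Suc n = n * n + (2 * n + 1)" by simp
  also have "2 * n + 1 \<le> n * n"
  proof -
    have "4 * n \<le> n * n" using step by (intro mult_le_mono1)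
    then show ?thesis using step(1) by linarith
  qed
  finally show ?case using step by simp
qed simp

lemma ex_exponential_dominates:
  fixes m Z p :: nat
  shows "\<exists>a\<ge>m. 2 * (Z * a) ^ p \<le> 2 ^ a"
proof -
  define s where "s = Z + 2 * p + m + 4"
  \<comment> \<open>For \<open>a = 2 ^ s\<close> the binary logarithm of the left side is at most
    \<open>(Z + s) * p + 1\<close>. As \<open>Z\<close> and \<open>2 * p\<close> are below
    \<open>s\<close>, this is at most \<open>s * s\<close>, hence at most \<open>a\<close>.\<close>
  define a :: nat where "a = 2 ^ s"
  have "s \<le> a" by (simp add: a_def le_two_power)
  then have "m \<le> a" by (simp add: s_def)
  have "2 * (Z * a) ^ p \<le> 2 * (2 ^ Z * 2 ^ s) ^ p"
    unfolding a_def by (intro mult_le_mono2 power_mono mult_le_mono1 le_two_power) simp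
  also have "\<dots> = 2 ^ ((Z + s) * p + 1)" by (simp add: power_add power_mult)
  also have "\<dots> \<le> 2 ^ a"
  proof (rule power_increasing)
    have "(Z + s) * p + 1 \<le> (2 * s) * p + s" by (intro add_mono mult_le_mono1) (simp_all add: s_def)
    also have "\<dots> = s * (2 * p + 1)" by (simp add: algebra_simps)
    also have "\<dots> \<le> s * s" by (intro mult_le_mono2) (simp add: s_def)
    also have "\<dots> \<le> a" unfolding a_def by (rule square_le_two_power) (simp add: s_def)
    finally show "(Z + s) * p + 1 \<le> a" .
  qed simp
  finally show ?thesis using \<open>m \<le> a\<close> by blast
qed

lemma adv_nonconstant:
  assumes "adv V F A"
  shows "\<exists>x. F x = b"
proof -
  obtain Y :: "bool \<Rightarrow> nat set" and \<xi> G w where adv: "adversary V F A Y \<xi> G w"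
    using assms unfolding adv_def by blast
  have "Y b \<noteq> {}"
  proof
    assume "Y b = {}"
    then have "(\<Sum>y\<in>Y b. (w y)\<^sup>2) = 0" by simp
    then show False using adv by (simp add: adversary_def)
  qed
  then obtain y where "y \<in> Y b" by blast
  then show ?thesis using adversary_label[OF adv] by blast
qed

text \<open>On the input with \<open>x1\<close> in every block, putting \<open>x0\<close> into one
  block changes the value, so a certificate touches all \<open>M\<close> blocks.\<close>

lemma certif_and_card:
  assumes "F x1 = True" "F x0 = False" "finite D"
    and D: "certif (block_compose (and_fun M) F) D (\<lambda>(i, v). x1 v)"
  shows "M \<le> card D"
proof -
  have "{..<M} \<subseteq> fst ` D"
  proof
    fix i assume i: "i \<in> {..<M}"
    show "i \<in> fst ` D"
    proof (rule ccontr)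
      assume ni: "i \<notin> fst ` D"
      have "block_compose (and_fun M) F (\<lambda>(j, v). if j = i then x0 v else x1 v) =
          block_compose (and_fun M) F (\<lambda>(i, v). x1 v)"
        by (rule certifD[OF D]) (use ni in force)
      moreover have "block_compose (and_fun M) F (\<lambda>(i, v). x1 v)"
        using assms(1) by (simp add: block_compose_def and_fun_def)
      moreover have "\<not> block_compose (and_fun M) F (\<lambda>(j, v). if j = i then x0 v else x1 v)"
      proof
        assume "block_compose (and_fun M) F (\<lambda>(j, v). if j = i then x0 v else x1 v)"
        then have "\<forall>j<M. F (\<lambda>v. if j = i then x0 v else x1 v)"
          by (simp add: block_compose_def and_fun_def)
        then have "F (\<lambda>v. if i = i then x0 v else x1 v)" using i by blast
        then show False using assms(2) by simp
      qed
      ultimately show False by simp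
    qed
  qed
  then have "card {..<M} \<le> card D" using assms(3) by (rule surj_card_le[rotated])
  then show ?thesis by simp
qed

text \<open>Depth and \<open>\<kappa>\<close> are both \<open>n\<close>. A last AND forces
  certificates of size \<open>M\<close>, which is what makes \<open>UC\<close> grow, and only
  doubles its upper bound; its factor \<open>sqrt M\<close> in the adversary bound is dropped. In
  units of \<open>a\<close>, the bound \<open>2 * M * y\<close> has exponent
  \<open>(2 * n + 1) * (n + 1) + 1\<close>, where the final 1 pays for the 2 and the polynomial in
  \<open>a\<close>; the exponent \<open>3 * n * n\<close> of the adversary bound loses 1 to the
  constant 36.\<close>

lemma separation:
  assumes "n > 0"
  shows "\<exists>N f a. a \<ge> 1 \<and> n \<le> UC N f \<and> UC N f \<le> 2 ^ (a * (2 * n * n + 3 * n + 2)) \<and>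
    (2 :: real) ^ (a * (3 * n * n - 1)) \<le> real (Q N f)"
proof -
  obtain Z where Z: "\<And>a. a \<ge> 1 \<Longrightarrow> 8 * n \<le> 2 ^ a \<Longrightarrow>
    \<exists>V F y. hard V F (2 ^ (a * (2 * n + 1))) (2 ^ (3 * n * a * n)) y (Z * a) \<and>
       y \<le> (Z * a) ^ (3 * n) * (2 ^ (a * (2 * n + 1))) ^ n"
    using hard_family[OF assms, of n] by blast
  \<comment> \<open>\<open>8 * n\<close> ensures the side condition of \<open>hard_family\<close>,
    and 6 gives \<open>36 \<le> 2 ^ a\<close>.\<close>
  obtain a where a: "8 * n + 6 \<le> a" "2 * (Z * a) ^ (3 * n) \<le> 2 ^ a"
    using ex_exponential_dominates[of "8 * n + 6" Z "3 * n"] by blast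
  have a2: "a \<le> 2 ^ a" by (rule le_two_power)
  define M :: nat where "M = 2 ^ (a * (2 * n + 1))"
  obtain V F y where hard: "hard V F M (2 ^ (3 * n * a * n)) y (Z * a)"
    and y: "y \<le> (Z * a) ^ (3 * n) * M ^ n"
    using Z[of a] a a2 unfolding M_def by fastforce
  have F: "finite V" "adv V F (2 ^ (3 * n * a * n))" "ucert V F (M * y) y"
    using hard by (simp_all add: hard_def)
  have M1: "M \<ge> 1" by (simp add: M_def)
  have aM: "2 ^ a \<le> M" unfolding M_def by (rule power_increasing) simp_all
  obtain x1 x0 where x: "F x1 = True" "F x0 = False" using adv_nonconstant[OF F(2)] by metis
  have "V \<noteq> {}"
  proof
    assume "V = {}"
    then have "F x1 = F x0" using ucert_depends_on[OF F(3)] by (simp add: depends_on_def)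
    then show False using x by simp
  qed
  let ?V = "{..<M} \<times> V" and ?F = "block_compose (and_fun M) F"
  have "adv ?V ?F (sqrt M * 2 ^ (3 * n * a * n))"
    by (rule adv_compose[OF _ moncert_depends_on[OF moncert_and] adv_and _ F(2)]) (use M1 in auto)
  then have adv: "adv ?V ?F (2 ^ (3 * n * a * n))"
    by (rule adv_mono) (use M1 in simp_all)
  have "\<exists>N f. 2 ^ (3 * n * a * n) \<le> 36 * real (Q N f) \<and> UC N f \<le> max (M * y + M * y) (M * y) \<and> M \<le> UC N f"
  proof (rule transfer_to_bool_lists[OF _ _ adv _ ucert_and[OF F(1) F(3)]])
    show "finite ?V" using F(1) by simp
    show "?V \<noteq> {}" using M1 \<open>V \<noteq> {}\<close> by (simp add: lessThan_empty_iff)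
    show "?F (\<lambda>(i, v). x1 v)" using x(1) by (simp add: block_compose_def and_fun_def)
    show "M \<le> card D" if "D \<subseteq> ?V" "certif ?F D (\<lambda>(i, v). x1 v)" for D
      by (rule certif_and_card[OF x _ that(2)]) (rule finite_subset[OF that(1)], use F(1) in simp)
  qed simp
  then obtain N f where Q: "2 ^ (3 * n * a * n) \<le> 36 * real (Q N f)"
    and U: "UC N f \<le> max (M * y + M * y) (M * y)" "M \<le> UC N f" by blast
  have "UC N f \<le> 2 * M * y" using U(1) by simp
  also have "\<dots> \<le> 2 * M * ((Z * a) ^ (3 * n) * M ^ n)" using y by (rule mult_le_mono2)
  also have "\<dots> = (2 * (Z * a) ^ (3 * n)) * M ^ Suc n" by simp
  also have "\<dots> \<le> 2 ^ a * M ^ Suc n" using a(2) by (rule mult_le_mono1)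
  also have "\<dots> = 2 ^ (a + a * (2 * n + 1) * Suc n)" unfolding M_def by (simp only: power_add power_mult)
  also have "a + a * (2 * n + 1) * Suc n = a * (2 * n * n + 3 * n + 2)" by (simp add: algebra_simps)
  finally have upper: "UC N f \<le> 2 ^ (a * (2 * n * n + 3 * n + 2))" .
  have "n \<le> UC N f" using a(1) a2 aM U(2) by linarith
  moreover have "(2 :: real) ^ (a * (3 * n * n - 1)) \<le> real (Q N f)"
  proof -
    have "1 \<le> 3 * n * n" using assms by (simp add: Suc_le_eq)
    then have "a * (3 * n * n) = a * ((3 * n * n - 1) + 1)" by (simp only: le_add_diff_inverse2)
    then have "3 * n * a * n = a * (3 * n * n - 1) + a" by (simp only: distrib_left mult_1_right mult_ac)
    then have pw: "(2 :: real) ^ (3 * n * a * n) = 2 ^ (a * (3 * n * n - 1)) * 2 ^ a" by (simp only: power_add)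
    have "36 \<le> (2 :: real) ^ a"
    proof -
      have "(36 :: real) \<le> 2 ^ 6" by simp
      also have "\<dots> \<le> 2 ^ a" using a(1) by (intro power_increasing) simp_all
      finally show ?thesis .
    qed
    then have "36 * real (Q N f) \<le> 2 ^ a * real (Q N f)" by (rule mult_right_mono) simp
    with Q have "2 ^ (a * (3 * n * n - 1)) * 2 ^ a \<le> 2 ^ a * real (Q N f)" unfolding pw by (rule order_trans)
    then have "2 ^ (a * (3 * n * n - 1)) * 2 ^ a \<le> real (Q N f) * 2 ^ a" by (simp only: mult.commute)
    then show ?thesis by (rule mult_right_le_imp_le) simp
  qed
  moreover have "a \<ge> 1" using a(1) by simp
  ultimately show ?thesis using upper by blast
qed

theorem theorem4:
  shows "\<exists>(N :: nat \<Rightarrow> nat) (f :: nat \<Rightarrow> bool list \<Rightarrow> bool) (\<epsilon> :: nat \<Rightarrow> real).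
    filterlim (\<lambda>j. UC (N j) (f j)) at_top sequentially \<and>
    \<epsilon> \<longlonglongrightarrow> 0 \<and>
    (\<forall>j. real (Q (N j) (f j)) \<ge> real (UC (N j) (f j)) powr (1.5 - \<epsilon> j))"
proof -
  \<comment> \<open>\<open>Suc j\<close> plays the part of the positive \<open>n\<close> in
    \<open>separation\<close>.\<close>
  define num where "num = (\<lambda>j. 3 * Suc j * Suc j - 1)"
  define den where "den = (\<lambda>j. 2 * Suc j * Suc j + 3 * Suc j + 2)"
  have "\<forall>j. \<exists>p :: nat \<times> (bool list \<Rightarrow> bool) \<times> nat. Suc j \<le> UC (fst p) (fst (snd p)) \<and>
      UC (fst p) (fst (snd p)) \<le> 2 ^ (snd (snd p) * den j) \<and>
      (2 :: real) ^ (snd (snd p) * num j) \<le> real (Q (fst p) (fst (snd p)))"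
  proof
    fix j
    obtain N f a where "Suc j \<le> UC N f" "UC N f \<le> 2 ^ (a * den j)" "(2 :: real) ^ (a * num j) \<le> real (Q N f)"
      using separation[of "Suc j"] unfolding num_def den_def by auto
    then show "\<exists>p :: nat \<times> (bool list \<Rightarrow> bool) \<times> nat. Suc j \<le> UC (fst p) (fst (snd p)) \<and>
      UC (fst p) (fst (snd p)) \<le> 2 ^ (snd (snd p) * den j) \<and>
      (2 :: real) ^ (snd (snd p) * num j) \<le> real (Q (fst p) (fst (snd p)))"
      by (intro exI[of _ "(N, f, a)"]) simp
  qed
  then obtain p :: "nat \<Rightarrow> nat \<times> (bool list \<Rightarrow> bool) \<times> nat" where
    p: "\<forall>j. Suc j \<le> UC (fst (p j)) (fst (snd (p j))) \<and>
      UC (fst (p j)) (fst (snd (p j))) \<le> 2 ^ (snd (snd (p j)) * den j) \<and>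
      (2 :: real) ^ (snd (snd (p j)) * num j) \<le> real (Q (fst (p j)) (fst (snd (p j))))"
    unfolding choice_iff by blast
  define N where "N = (\<lambda>j. fst (p j))"
  define f where "f = (\<lambda>j. fst (snd (p j)))"
  define a where "a = (\<lambda>j. snd (snd (p j)))"
  have U1: "Suc j \<le> UC (N j) (f j)" and U2: "UC (N j) (f j) \<le> 2 ^ (a j * den j)"
    and Qj: "(2 :: real) ^ (a j * num j) \<le> real (Q (N j) (f j))" for j
    using p unfolding N_def f_def a_def by simp_all
  define \<epsilon> where "\<epsilon> = (\<lambda>j. 1.5 - real (num j) / real (den j))"
  have "filterlim (\<lambda>j. UC (N j) (f j)) at_top sequentially"
    by (rule filterlim_at_top_mono[OF filterlim_ident]) (intro always_eventually allI, rule Suc_leD[OF U1])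
  moreover have "\<epsilon> \<longlonglongrightarrow> 0"
  proof -
    \<comment> \<open>The numerator is \<open>3 / 2 * den j - num j\<close>, in which the quadratic
      terms cancel.\<close>
    have "\<epsilon> j = (9 / 2 * (real j + 1) + 4) / (2 * (real j + 1)\<^sup>2 + 3 * (real j + 1) + 2)" for j
    proof -
      have "1 \<le> 3 * Suc j * Suc j" by simp
      then have n: "real (num j) = 3 * (real j + 1)\<^sup>2 - 1"
        unfolding num_def by (subst of_nat_diff) (simp_all add: power2_eq_square algebra_simps)
      have d: "real (den j) = 2 * (real j + 1)\<^sup>2 + 3 * (real j + 1) + 2"
        unfolding den_def by (simp add: power2_eq_square algebra_simps)
      have "den j > 0" by (simp add: den_def)
      then have "real (den j) > 0" by (simp only: of_nat_0_less_iff)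
      then have "\<epsilon> j = (3 / 2 * real (den j) - real (num j)) / real (den j)"
        by (simp add: \<epsilon>_def field_simps)
      also have "3 / 2 * real (den j) - real (num j) = 9 / 2 * (real j + 1) + 4"
        unfolding n d by (simp add: field_simps)
      finally show ?thesis unfolding d .
    qed
    then have "\<epsilon> = (\<lambda>j. (9 / 2 * (real j + 1) + 4) / (2 * (real j + 1)\<^sup>2 + 3 * (real j + 1) + 2))"
      by (rule ext)
    moreover have "(\<lambda>j. (9 / 2 * (real j + 1) + 4) / (2 * (real j + 1)\<^sup>2 + 3 * (real j + 1) + 2)) \<longlonglongrightarrow> 0"
      by real_asymp
    ultimately show ?thesis by (simp only:)
  qed
  moreover have "real (Q (N j) (f j)) \<ge> real (UC (N j) (f j)) powr (1.5 - \<epsilon> j)" for j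
  proof -
    have "den j > 0" by (simp add: den_def)
    then have d: "real (den j) > 0" by (simp only: of_nat_0_less_iff)
    have exp: "1.5 - \<epsilon> j = real (num j) / real (den j)" by (simp add: \<epsilon>_def)
    have "real (UC (N j) (f j)) \<le> real (2 ^ (a j * den j))" using U2 by (simp only: of_nat_le_iff)
    also have "\<dots> = 2 powr (real (a j) * real (den j))" by (simp add: powr_realpow[symmetric])
    finally have "real (UC (N j) (f j)) powr (real (num j) / real (den j)) \<le>
        (2 powr (real (a j) * real (den j))) powr (real (num j) / real (den j))"
      by (intro powr_mono2) simp_all
    also have "\<dots> = 2 powr (real (a j) * real (num j))" using d by (simp add: powr_powr)
    also have "\<dots> = 2 ^ (a j * num j)" by (simp add: powr_realpow[symmetric])
    also have "\<dots> \<le> real (Q (N j) (f j))" by (rule Qj)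
    finally show ?thesis unfolding exp .
  qed
  ultimately show ?thesis by blast
qed

end
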